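(* Let $G$ be a compact abelian Lie group of dimension $s$ with character group $\Gamma$, and let $X$ be a finite list of elements of $\Gamma$ whose images span $V=\mathrm{Lie}(G)^*\neq\{0\}$. Let $a\in X$ be an element of infinite order, write $X=[Z,a]$, and let $\tilde Z$ be the image of the list $Z$ in $\Gamma/\mathbb Z a$. Then: 1) The sequence $$0\to DM(\tilde Z)\xrightarrow{\,i_a\,}DM(X)\xrightarrow{\,\nabla_a\,}DM(Z)\to0$$ is exact. 2) The map $$\Pi_X:\ H^X=\bigoplus_{\underline r\in S_X^{(s-1)}}DM^{(G)}(X\cap\underline r)\to DM(X)$$ given on the summand $\underline r$ by convolution with $\mathcal Q^V_{\underline r}$ is surjective.
   Context: $\Gamma$ is a finitely generated abelian group written additively, $\Gamma_t$ its torsion subgroup; $V=\mathrm{Lie}(G)^*$ has dimension $s$ and $\gamma\mapsto\overline\gamma\in V$ (differential of the character) has kernel $\Gamma_t$ and image a lattice $\Lambda$ spanning $V$. A list spans a subspace if the images $\overline a$ of its elements do. $\mathcal C[\Gamma]$ is the group of functions $\Gamma\to\mathbb Z$, a module over $R(G)=\mathbb Z[\Gamma]$ via $(\tau_\gamma f)(\nu)=f(\nu-\gamma)$; $\nabla_\gamma:=1-\tau_\gamma$; $\nabla_Y:=\prod_{a\in Y}\nabla_a$, $\nabla_\emptyset=1$. $DM(X)$ is the set of $f\in\mathcal C[\Gamma]$ with $\nabla_Yf=0$ for every sublist $Y$ of $X$ such that $X\setminus Y$ does not span $V$ (so $DM(X)=0$ if $X$ does not span $V$; if $\Gamma$ is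 finite, so $V=0$, then $DM(X)=\mathcal C[\Gamma]$). The same definition applies to any finitely generated abelian group in place of $\Gamma$, with $V$ replaced by the group tensored with $\mathbb R$; $DM(\tilde Z)\subset\mathcal C[\Gamma/\mathbb Za]$ is taken with respect to $\Gamma/\mathbb Z a$. The map $i_a:\mathcal C[\Gamma/\mathbb Za]\to\mathcal C[\Gamma]$ is $i_a(f)(x)=f(x+\mathbb Za)$. $\underline r\subset V$ is rational if spanned by images of a sublist of $X$; $S_X^{(i)}$ is the set of rational subspaces of dimension $i$. $X\cap\underline r$ is the sublist of $a\in X$ with $\overline a\in\underline r$. $\Gamma_{\underline r}=\{\gamma\in\Gamma\mid\overline\gamma\in\underline r\}$; $DM(X\cap\underline r)\subset\mathcal C[\Gamma_{\underline r}]$ is taken with respect to $\Gamma_{\underline r}$ (and $\underline r$ in place of $V$), $\mathcal C[\Gamma_{\underline r}]$ is embedded in $\mathcal C[\Gamma]$ by extension by $0$, and $DM^{(G)}(X\cap\underline r)$ is the $R(G)$-submodule of $\mathcal C[\Gamma]$ generated by $DM(X\cap\underline r)$. Convolution: $(f_1*f_2)(\gamma)=\sum_{\gamma_1+\gamma_2=\gamma}f_1(\gamma_1)f_2(\gamma_2)$ whenever the sums are finite; $\delta_\gamma$ is the indicator function of $\{\gamma\}$; for $\gamma$ of infinite order $H_\gamma=\sum_{k\ge0}\delta_{k\gamma}$, and $H_A$ is the convolution of the $H_a$, $a\in A$ ($H_\emptyset=\delta_0$); $-B$ is the list of $-b$, $b\in B$. For $\underline r\in S_X^{(s-1)}$,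 choose one of the two open half-spaces of $V\setminus\underline r$ as positive (a choice of orientations of $\underline r$ and $V$ determines it), and let $A$ (resp. $B$) be the sublist of $a\in X$ with $\overline a$ in the positive (resp. negative) half-space. Put $$\mathcal Q^V_{\underline r}:=(-1)^{|B|}\delta_{-\sum_{b\in B}b}*H_A*H_{-B}-(-1)^{|A|}\delta_{-\sum_{a\in A}a}*H_B*H_{-A}.$$ Convolution with $\mathcal Q^V_{\underline r}$ is well defined on $DM^{(G)}(X\cap\underline r)$ and maps it to $DM(X)$. *)

theory Defs
  imports "HOL-Analysis.Analysis" "HOL-Algebra.Elementary_Groups" "HOL-Library.Multiset" "HOL-Library.Poly_Mapping"
begin

text \<open>
  Abelian groups are HOL-Algebra groups, so the additive notation of the mathematics becomes
  multiplicative: \<open>\<gamma> + \<nu>\<close> is \<open>\<gamma> \<otimes> \<nu>\<close>, \<open>-\<gamma>\<close> is \<open>inv \<gamma>\<close>, \<open>k\<gamma>\<close> is \<open>\<gamma> [^] k\<close>, and the subgroup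
  generated by \<open>a\<close> is \<open>generate \<Gamma> {a}\<close>. The character group of a compact abelian Lie group enters
  as a finitely generated abelian group \<open>\<Gamma>\<close> together with the differential \<open>bar : \<Gamma> \<rightarrow> V\<close>.

  Lists are considered up to reordering: \<open>Y\<close> is a sublist of \<open>X\<close> iff \<open>mset Y \<subseteq># mset X\<close>.
\<close>

definition fin_gen_group :: "('k, 'm) monoid_scheme \<Rightarrow> bool" where
  "fin_gen_group K \<longleftrightarrow> (\<exists>S. finite S \<and> S \<subseteq> carrier K \<and> generate K S = carrier K)"

definition torsion :: "('k, 'm) monoid_scheme \<Rightarrow> 'k set" where
  "torsion K = {x \<in> carrier K. \<exists>n::nat. 0 < n \<and> x [^]\<^bsub>K\<^esub> n = \<one>\<^bsub>K\<^esub>}"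

text \<open>A lattice spanning the whole space: the integer span of a basis.\<close>

definition full_lattice :: "'v::euclidean_space set \<Rightarrow> bool" where
  "full_lattice L \<longleftrightarrow> (\<exists>B. independent B \<and> span B = UNIV \<and>
     L = {\<Sum>b\<in>B. real_of_int (c b) *\<^sub>R b | c. True})"


subsection \<open>Functions on a group and difference operators\<close>

text \<open>
  A function on \<open>K\<close> is represented by its extension by 0 outside \<open>carrier K\<close>. For a subgroup,
  the embedding of functions by extension by 0 is then an inclusion of sets.
\<close>

definition Cfun :: "('k, 'm) monoid_scheme \<Rightarrow> ('k \<Rightarrow> int) set" where
  "Cfun K = {f. \<forall>x. x \<notin> carrier K \<longrightarrow> f x = 0}"

definition translate :: "('k, 'm) monoid_scheme \<Rightarrow> 'k \<Rightarrow> ('k \<Rightarrow> int) \<Rightarrow> 'k \<Rightarrow> int" where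
  "translate K \<gamma> f = (\<lambda>\<nu>. if \<nu> \<in> carrier K then f (\<nu> \<otimes>\<^bsub>K\<^esub> inv\<^bsub>K\<^esub> \<gamma>) else 0)"

definition nabla :: "('k, 'm) monoid_scheme \<Rightarrow> 'k \<Rightarrow> ('k \<Rightarrow> int) \<Rightarrow> 'k \<Rightarrow> int" where
  "nabla K \<gamma> f = (\<lambda>\<nu>. f \<nu> - translate K \<gamma> f \<nu>)"

definition nabla_list :: "('k, 'm) monoid_scheme \<Rightarrow> 'k list \<Rightarrow> ('k \<Rightarrow> int) \<Rightarrow> 'k \<Rightarrow> int" where
  "nabla_list K Y f = foldr (nabla K) Y f"

text \<open>
  The parameter \<open>spans\<close> says which sets of group elements have images spanning the ambient real
  vector space (\<open>V\<close>, a rational subspace, or the group tensored with the reals).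
\<close>

definition DM :: "('k, 'm) monoid_scheme \<Rightarrow> ('k set \<Rightarrow> bool) \<Rightarrow> 'k list \<Rightarrow> ('k \<Rightarrow> int) set" where
  "DM K spans X = {f \<in> Cfun K. \<forall>Y. mset Y \<subseteq># mset X \<and> \<not> spans (set_mset (mset X - mset Y))
     \<longrightarrow> nabla_list K Y f = (\<lambda>_. 0)}"

definition spans_in :: "('k \<Rightarrow> 'v::real_vector) \<Rightarrow> 'v set \<Rightarrow> 'k set \<Rightarrow> bool" where
  "spans_in bar U S \<longleftrightarrow> span (bar ` S) = U"

text \<open>
  \<open>K \<otimes> \<real>\<close> is the free real vector space on \<open>carrier K\<close> (finitely supported functions, with
  \<open>Poly_Mapping.single x 1\<close> for the generator \<open>x \<otimes> 1\<close>) modulo the subspace spanned by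
  \<open>tensor_relations K\<close>. Hence \<open>S\<close> spans \<open>K \<otimes> \<real>\<close> iff \<open>S\<close> and the relations together span the free
  space.
\<close>

definition scale_free :: "real \<Rightarrow> ('k \<Rightarrow>\<^sub>0 real) \<Rightarrow> 'k \<Rightarrow>\<^sub>0 real" where
  "scale_free r p = Poly_Mapping.map (\<lambda>c. r * c) p"

global_interpretation free_real: vector_space "scale_free :: real \<Rightarrow> ('k \<Rightarrow>\<^sub>0 real) \<Rightarrow> 'k \<Rightarrow>\<^sub>0 real"
proof -
  have l: "poly_mapping.lookup (scale_free r p) x = r * poly_mapping.lookup p x" for r x and p :: "'k \<Rightarrow>\<^sub>0 real"
    by (simp add: scale_free_def Poly_Mapping.map.rep_eq when_def)
  show "vector_space (scale_free :: real \<Rightarrow> ('k \<Rightarrow>\<^sub>0 real) \<Rightarrow> 'k \<Rightarrow>\<^sub>0 real)"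
    by unfold_locales (auto intro!: poly_mapping_eqI simp: l lookup_add algebra_simps)
qed

definition tensor_relations :: "('k, 'm) monoid_scheme \<Rightarrow> ('k \<Rightarrow>\<^sub>0 real) set" where
  "tensor_relations K = {Poly_Mapping.single (x \<otimes>\<^bsub>K\<^esub> y) 1 - Poly_Mapping.single x 1
       - Poly_Mapping.single y 1 | x y. x \<in> carrier K \<and> y \<in> carrier K}"

definition spans_tensor :: "('k, 'm) monoid_scheme \<Rightarrow> 'k set \<Rightarrow> bool" where
  "spans_tensor K S \<longleftrightarrow>
     free_real.span ((\<lambda>x. Poly_Mapping.single x 1) ` S \<union> tensor_relations K)
       = {p. Poly_Mapping.keys p \<subseteq> carrier K}"


subsection \<open>Exact sequences\<close>

text \<open>
  \<open>short_exact_sequence\<close> of the library requires its three groups to live on one type, which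
  excludes sequences starting with functions on a quotient group.
\<close>

definition fun_group :: "('k \<Rightarrow> int) set \<Rightarrow> ('k \<Rightarrow> int) monoid" where
  "fun_group M = \<lparr>carrier = M, mult = (\<lambda>f g x. f x + g x), one = (\<lambda>_. 0)\<rparr>"

definition short_exact ::
    "'a monoid \<Rightarrow> 'b monoid \<Rightarrow> 'c monoid \<Rightarrow> ('a \<Rightarrow> 'b) \<Rightarrow> ('b \<Rightarrow> 'c) \<Rightarrow> bool" where
  "short_exact A B C i p \<longleftrightarrow> comm_group A \<and> comm_group B \<and> comm_group C \<and>
     i \<in> mon A B \<and> i ` carrier A = kernel B C p \<and> p \<in> epi B C"

definition coset_of :: "('k, 'm) monoid_scheme \<Rightarrow> 'k \<Rightarrow> 'k \<Rightarrow> 'k set" where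
  "coset_of K a x = generate K {a} #>\<^bsub>K\<^esub> x"

definition cyclic_quotient :: "('k, 'm) monoid_scheme \<Rightarrow> 'k \<Rightarrow> 'k set monoid" where
  "cyclic_quotient K a = K Mod generate K {a}"

definition pull_quotient :: "('k, 'm) monoid_scheme \<Rightarrow> 'k \<Rightarrow> ('k set \<Rightarrow> int) \<Rightarrow> 'k \<Rightarrow> int" where
  "pull_quotient K a f = (\<lambda>x. if x \<in> carrier K then f (coset_of K a x) else 0)"


subsection \<open>Modules over the integral group ring\<close>

text \<open>
  An element of the group ring is a finitely supported function \<open>c\<close>, standing for
  \<open>\<Sum>\<gamma>. c \<gamma> \<cdot> \<gamma>\<close>, and acts as \<open>\<Sum>\<gamma>. c \<gamma> \<cdot> translate \<gamma>\<close>.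
\<close>

definition group_ring :: "('k, 'm) monoid_scheme \<Rightarrow> ('k \<Rightarrow> int) set" where
  "group_ring K = {c \<in> Cfun K. finite {\<gamma>. c \<gamma> \<noteq> 0}}"

definition ring_act :: "('k, 'm) monoid_scheme \<Rightarrow> ('k \<Rightarrow> int) \<Rightarrow> ('k \<Rightarrow> int) \<Rightarrow> 'k \<Rightarrow> int" where
  "ring_act K c f = (\<lambda>x. \<Sum>\<gamma> | c \<gamma> \<noteq> 0. c \<gamma> * translate K \<gamma> f x)"

definition submodule_C :: "('k, 'm) monoid_scheme \<Rightarrow> ('k \<Rightarrow> int) set \<Rightarrow> bool" where
  "submodule_C K M \<longleftrightarrow> M \<subseteq> Cfun K \<and> (\<lambda>_. 0) \<in> M \<and>
     (\<forall>f\<in>M. \<forall>g\<in>M. (\<lambda>x. f x + g x) \<in> M) \<and> (\<forall>c\<in>group_ring K. \<forall>f\<in>M. ring_act K c f \<in> M)"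


subsection \<open>Rational subspaces\<close>

definition sub_list_in :: "('k \<Rightarrow> 'v) \<Rightarrow> 'v set \<Rightarrow> 'k list \<Rightarrow> 'k list" where
  "sub_list_in bar U X = filter (\<lambda>a. bar a \<in> U) X"

definition rational_subspaces ::
    "('k \<Rightarrow> 'v::euclidean_space) \<Rightarrow> 'k list \<Rightarrow> nat \<Rightarrow> 'v set set" where
  "rational_subspaces bar X i =
     {r. (\<exists>Y. mset Y \<subseteq># mset X \<and> r = span (bar ` set Y)) \<and> dim r = i}"

definition subgroup_over :: "('k, 'm) monoid_scheme \<Rightarrow> ('k \<Rightarrow> 'v) \<Rightarrow> 'v set \<Rightarrow> ('k, 'm) monoid_scheme"
  where "subgroup_over K bar r = K\<lparr>carrier := {\<gamma> \<in> carrier K. bar \<gamma> \<in> r}\<rparr>"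

definition DM_G :: "('k, 'm) monoid_scheme \<Rightarrow> ('k \<Rightarrow> 'v::euclidean_space) \<Rightarrow> 'k list \<Rightarrow> 'v set
    \<Rightarrow> ('k \<Rightarrow> int) set" where
  "DM_G K bar X r =
     submodule_C K hull DM (subgroup_over K bar r) (spans_in bar r) (sub_list_in bar r X)"


subsection \<open>Convolution\<close>

text \<open>Only meaningful where the index sets are finite (the value is 0 otherwise).\<close>

definition conv :: "('k, 'm) monoid_scheme \<Rightarrow> ('k \<Rightarrow> int) \<Rightarrow> ('k \<Rightarrow> int) \<Rightarrow> 'k \<Rightarrow> int" where
  "conv K f g = (\<lambda>\<gamma>. \<Sum>(x, y) \<in> {(x, y). x \<in> carrier K \<and> y \<in> carrier K \<and>
     x \<otimes>\<^bsub>K\<^esub> y = \<gamma> \<and> f x * g y \<noteq> 0}. f x * g y)"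

definition delta :: "'k \<Rightarrow> 'k \<Rightarrow> int" where
  "delta \<gamma> = (\<lambda>x. if x = \<gamma> then 1 else 0)"

text \<open>For \<open>\<gamma>\<close> of infinite order, the pointwise sum of \<open>delta (\<gamma> [^] k)\<close> over all natural \<open>k\<close>.\<close>

definition heaviside :: "('k, 'm) monoid_scheme \<Rightarrow> 'k \<Rightarrow> 'k \<Rightarrow> int" where
  "heaviside K \<gamma> = (\<lambda>x. \<Sum>k::nat | x = \<gamma> [^]\<^bsub>K\<^esub> k. delta (\<gamma> [^]\<^bsub>K\<^esub> k) x)"

definition heaviside_list :: "('k, 'm) monoid_scheme \<Rightarrow> 'k list \<Rightarrow> 'k \<Rightarrow> int" where
  "heaviside_list K A = foldr (\<lambda>a h. conv K (heaviside K a) h) A (delta \<one>\<^bsub>K\<^esub>)"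

definition list_total :: "('k, 'm) monoid_scheme \<Rightarrow> 'k list \<Rightarrow> 'k" where
  "list_total K B = foldr (\<lambda>b c. b \<otimes>\<^bsub>K\<^esub> c) B \<one>\<^bsub>K\<^esub>"

definition neg_list :: "('k, 'm) monoid_scheme \<Rightarrow> 'k list \<Rightarrow> 'k list" where
  "neg_list K B = map (\<lambda>b. inv\<^bsub>K\<^esub> b) B"

definition open_half_space :: "'v::euclidean_space set \<Rightarrow> 'v set \<Rightarrow> bool" where
  "open_half_space r P \<longleftrightarrow>
     (\<exists>l::'v \<Rightarrow> real. linear l \<and> (\<exists>v. l v \<noteq> 0) \<and> r = {v. l v = 0} \<and> P = {v. 0 < l v})"

text \<open>The positive half-space is \<open>P\<close>, the negative one is \<open>- (r \<union> P)\<close>.\<close>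

definition Q_fun :: "('k, 'm) monoid_scheme \<Rightarrow> ('k \<Rightarrow> 'v::euclidean_space) \<Rightarrow> 'k list \<Rightarrow> 'v set
    \<Rightarrow> 'v set \<Rightarrow> 'k \<Rightarrow> int" where
  "Q_fun K bar X r P =
     (let A = sub_list_in bar P X; B = sub_list_in bar (- (r \<union> P)) X in
      (\<lambda>x. (-1) ^ length B *
             conv K (conv K (delta (inv\<^bsub>K\<^esub> (list_total K B))) (heaviside_list K A))
               (heaviside_list K (neg_list K B)) x
         - (-1) ^ length A *
             conv K (conv K (delta (inv\<^bsub>K\<^esub> (list_total K A))) (heaviside_list K B))
               (heaviside_list K (neg_list K A)) x))"

text \<open>
  There are finitely many rational subspaces, so their direct sum is the full product, here the set
  of extensional families.
\<close>

definition H_sum :: "('k, 'm) monoid_scheme \<Rightarrow> ('k \<Rightarrow> 'v::euclidean_space) \<Rightarrow> 'k list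
    \<Rightarrow> ('v set \<Rightarrow> 'k \<Rightarrow> int) set" where
  "H_sum K bar X = (\<Pi>\<^sub>E r \<in> rational_subspaces bar X (DIM('v) - 1). DM_G K bar X r)"

definition Pi_map :: "('k, 'm) monoid_scheme \<Rightarrow> ('k \<Rightarrow> 'v::euclidean_space) \<Rightarrow> 'k list
    \<Rightarrow> ('v set \<Rightarrow> 'v set) \<Rightarrow> ('v set \<Rightarrow> 'k \<Rightarrow> int) \<Rightarrow> 'k \<Rightarrow> int" where
  "Pi_map K bar X P F = (\<lambda>x. \<Sum>r \<in> rational_subspaces bar X (DIM('v) - 1).
     conv K (Q_fun K bar X r (P r)) (F r) x)"

end

theory Submission
  imports Defs
begin

text \<open>
  Both parts are proved together, by induction on the length of the list, for functions that are
  moreover periodic under a set \<open>L\<close> and live on finitely many cosets of a subspace \<open>U\<close>; this covers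
  quotients and the subgroups over rational subspaces at once.

  Part 2 for \<open>Z\<close> gives part 1 for \<open>[Z, a]\<close>: write \<open>f \<in> DM(Z)\<close> as a sum of \<open>Q\<^sub>r * g\<close>. If \<open>a\<close> lies outside
  \<open>r\<close>, then \<open>\<nabla>\<^sub>a\<close> carries the function \<open>Q\<^sub>r * g\<close> formed with \<open>[Z, a]\<close> to the one formed with \<open>Z\<close>; if \<open>a\<close>
  lies in \<open>r\<close>, lift \<open>g\<close> along \<open>\<nabla>\<^sub>a\<close> by part 1 for the shorter list \<open>Z \<inter> r\<close>.

  Conversely let \<open>f \<in> DM([Z, a])\<close>. By part 1 some \<open>f'\<close> in the image of \<open>\<Pi>\<close> has \<open>\<nabla>\<^sub>a f' = \<nabla>\<^sub>a f\<close>, and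
  \<open>f - f'\<close> is an \<open>a\<close>-periodic function in \<open>DM(Z)\<close>, to which part 2 for \<open>Z\<close> with the additional period
  \<open>a\<close> applies. This reduction ends in rank one, where \<open>f\<close> is cut into its two halves.
\<close>


subsection \<open>Difference operators\<close>

text \<open>Infinite convolution sums are avoided in the induction. On functions whose support is
  bounded below along \<open>l\<close>, \<open>nabla\<close> is injective for every element on which
  \<open>l\<close> is nonzero, so each half of \<open>Q * g\<close> is the only one-sided function
  whose differences along the elements off the kernel of \<open>l\<close> give \<open>g\<close>.
  Periods, vanishing conditions, supports and changes of the list pass from \<open>g\<close> to the
  half by this uniqueness; the explicit kernels serve only for existence and for the comparison with
  \<open>Q\<close>. The recursion leaves the original setting in two ways: into hyperplanes, and
  into quotients by list elements, where the type of the functions would change. Hence all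
  \<open>U\<close> and \<open>L\<close> are quantified over inside the induction. Finitely many
  cosets of \<open>U\<close> stand for the module generated by translates, and they bound
  \<open>g\<close> on both sides of a hyperplane. Cutting a function along a hyperplane commutes in
  general with \<open>nabla\<close> only for elements of the hyperplane. In higher rank the cut need
  not respect the remaining vanishing conditions; in rank one there are none, which is why the
  reduction goes down to that case.\<close>

lemma dif_zero [simp]: "nabla K a (\<lambda>_. 0) = (\<lambda>_. 0)"
  and dif_add: "nabla K a (\<lambda>x. f x + g x) = (\<lambda>x. nabla K a f x + nabla K a g x)"
  and dif_diff: "nabla K a (\<lambda>x. f x - g x) = (\<lambda>x. nabla K a f x - nabla K a g x)"
  and dif_scale: "nabla K a (\<lambda>x. c * f x) = (\<lambda>x. c * nabla K a f x)"
  by (auto simp: translate_def nabla_def algebra_simps)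

lemma difs_Nil [simp]: "nabla_list K [] f = f"
  and difs_Cons [simp]: "nabla_list K (a # Y) f = nabla K a (nabla_list K Y f)"
  and difs_append: "nabla_list K (Y @ Y') f = nabla_list K Y (nabla_list K Y' f)"
  by (auto simp: nabla_list_def)

lemma difs_zero [simp]: "nabla_list K Y (\<lambda>_. 0) = (\<lambda>_. 0)"
  and difs_add: "nabla_list K Y (\<lambda>x. f x + g x) = (\<lambda>x. nabla_list K Y f x + nabla_list K Y g x)"
  and difs_diff: "nabla_list K Y (\<lambda>x. f x - g x) = (\<lambda>x. nabla_list K Y f x - nabla_list K Y g x)"
  and difs_scale: "nabla_list K Y (\<lambda>x. c * f x) = (\<lambda>x. c * nabla_list K Y f x)"
  by (induction Y) (auto simp: dif_add dif_diff dif_scale)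

lemma tr_diff: "translate K a (\<lambda>x. f x - g x) = (\<lambda>x. translate K a f x - translate K a g x)"
  and tr_zero [simp]: "translate K a (\<lambda>_. 0) = (\<lambda>_. 0)"
  by (auto simp: translate_def)

context comm_group
begin

abbreviation "tr \<equiv> translate G"
abbreviation "dif \<equiv> nabla G"
abbreviation "difs \<equiv> nabla_list G"

lemma supp_carrier: "f \<in> Cfun G \<Longrightarrow> f x \<noteq> 0 \<Longrightarrow> x \<in> carrier G"
  by (auto simp: Cfun_def)

lemma Cfun_zero: "(\<lambda>_. 0) \<in> Cfun G"
  and Cfun_add: "f \<in> Cfun G \<Longrightarrow> g \<in> Cfun G \<Longrightarrow> (\<lambda>x. f x + g x) \<in> Cfun G"
  and Cfun_diff: "f \<in> Cfun G \<Longrightarrow> g \<in> Cfun G \<Longrightarrow> (\<lambda>x. f x - g x) \<in> Cfun G"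
  and Cfun_scale: "f \<in> Cfun G \<Longrightarrow> (\<lambda>x. c * f x) \<in> Cfun G"
  and Cfun_tr: "tr a f \<in> Cfun G"
  and Cfun_dif: "f \<in> Cfun G \<Longrightarrow> dif a f \<in> Cfun G"
  by (auto simp: Cfun_def translate_def nabla_def)

lemma Cfun_difs: "f \<in> Cfun G \<Longrightarrow> difs Y f \<in> Cfun G"
  by (induction Y) (auto simp: Cfun_dif)

lemma tr_tr: "a \<in> carrier G \<Longrightarrow> b \<in> carrier G \<Longrightarrow> tr a (tr b f) = tr (a \<otimes> b) f"
  by (auto simp: translate_def fun_eq_iff inv_mult m_assoc)

lemma tr_one: "f \<in> Cfun G \<Longrightarrow> tr \<one> f = f"
  by (auto simp: translate_def fun_eq_iff Cfun_def)

lemma tr_dif: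
  assumes "a \<in> carrier G" "b \<in> carrier G"
  shows "tr a (dif b f) = dif b (tr a f)"
  unfolding nabla_def using assms by (auto simp: tr_diff tr_tr m_comm)

lemma tr_difs: "a \<in> carrier G \<Longrightarrow> set Y \<subseteq> carrier G \<Longrightarrow> tr a (difs Y f) = difs Y (tr a f)"
  by (induction Y) (auto simp: tr_dif)

lemma dif_commute:
  assumes "a \<in> carrier G" "b \<in> carrier G"
  shows "dif a (dif b f) = dif b (dif a f)"
proof -
  have "dif a (dif b f) = (\<lambda>x. dif b f x - tr a (dif b f) x)" by (rule nabla_def)
  also have "\<dots> = dif b (\<lambda>x. f x - tr a f x)" using assms by (simp only: tr_dif dif_diff)
  also have "(\<lambda>x. f x - tr a f x) = dif a f" by (simp add: nabla_def)
  finally show ?thesis .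
qed

lemma dif_difs: "a \<in> carrier G \<Longrightarrow> set Y \<subseteq> carrier G \<Longrightarrow> dif a (difs Y f) = difs Y (dif a f)"
  by (induction Y) (auto simp: dif_commute)

lemma difs_commute:
  "set Y \<subseteq> carrier G \<Longrightarrow> set Y' \<subseteq> carrier G \<Longrightarrow> difs Y (difs Y' f) = difs Y' (difs Y f)"
  by (induction Y) (auto simp: dif_difs)

lemma difs_mset:
  assumes "mset Y = mset Y'" "set Y \<subseteq> carrier G"
  shows "difs Y f = difs Y' f"
proof -
  have "fold dif (rev Y) = fold dif (rev Y')"
    by (rule fold_multiset_equiv) (use assms in \<open>auto simp: fun_eq_iff dif_commute subset_iff\<close>)
  then show ?thesis by (simp add: nabla_list_def foldr_conv_fold)
qed

lemma difs_mset_union: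
  assumes "mset X = mset Y + mset Y'" "set X \<subseteq> carrier G"
  shows "difs X f = difs Y (difs Y' f)"
  using difs_mset[of X "Y @ Y'" f] assms by (simp add: difs_append)

text \<open>The factors commute, so those of the shorter list can be applied first. Vanishing
  conditions therefore have to be checked for minimal lists only.\<close>

lemma difs_eq_0_mono:
  assumes "mset Y \<subseteq># mset X" "set X \<subseteq> carrier G" "difs Y f = (\<lambda>_. 0)"
  shows "difs X f = (\<lambda>_. 0)"
proof -
  obtain Y' where Y': "mset Y' = mset X - mset Y" using ex_mset by blast
  have "mset X = mset Y' + mset Y" using assms(1) Y' by simp
  with assms difs_mset_union show ?thesis by simp
qed

lemma dif_eq_0D: "dif a f = (\<lambda>_. 0) \<Longrightarrow> x \<in> carrier G \<Longrightarrow> f (x \<otimes> inv a) = f x"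
  by (drule fun_cong[of _ _ x]) (simp add: nabla_def translate_def)

lemma dif_eq_0D': "dif a f = (\<lambda>_. 0) \<Longrightarrow> x \<in> carrier G \<Longrightarrow> a \<in> carrier G \<Longrightarrow> f (x \<otimes> a) = f x"
  using dif_eq_0D[of a f "x \<otimes> a"] by (simp add: m_assoc)

end

section \<open>The group with its map to the real vector space\<close>

locale lattice_group = comm_group \<Gamma> for \<Gamma> :: "('g, 'm) monoid_scheme" (structure) +
  fixes bar :: "'g \<Rightarrow> 'v::euclidean_space"
  assumes bar_mult: "\<And>\<gamma> \<nu>. \<gamma> \<in> carrier \<Gamma> \<Longrightarrow> \<nu> \<in> carrier \<Gamma> \<Longrightarrow> bar (\<gamma> \<otimes> \<nu>) = bar \<gamma> + bar \<nu>"
    and bar_kernel: "{\<gamma> \<in> carrier \<Gamma>. bar \<gamma> = 0} = torsion \<Gamma>"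
    and bar_lattice: "full_lattice (bar ` carrier \<Gamma>)"
begin

lemma bar_one [simp]: "bar \<one> = 0"
  using bar_mult[of \<one> \<one>] by simp

lemma bar_inv [simp]: "x \<in> carrier \<Gamma> \<Longrightarrow> bar (inv x) = - bar x"
  using bar_mult[of x "inv x"] by (simp add: eq_neg_iff_add_eq_0 add.commute)

lemma bar_pow: "x \<in> carrier \<Gamma> \<Longrightarrow> bar (x [^] (n::nat)) = real n *\<^sub>R bar x"
  by (induction n) (auto simp: bar_mult algebra_simps)

lemma bar_int_pow: "x \<in> carrier \<Gamma> \<Longrightarrow> bar (x [^] (n::int)) = real_of_int n *\<^sub>R bar x"
  by (cases n rule: int_cases2) (auto simp: int_pow_neg int_pow_int bar_pow)

lemma bar_eq_0_iff: "x \<in> carrier \<Gamma> \<Longrightarrow> bar x = 0 \<longleftrightarrow> x \<in> torsion \<Gamma>"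
  using bar_kernel by auto


section \<open>Cutting functions off along subsets of the vector space\<close>

definition restr :: "'v set \<Rightarrow> ('g \<Rightarrow> int) \<Rightarrow> 'g \<Rightarrow> int" where
  "restr W f = (\<lambda>x. if bar x \<in> W then f x else 0)"

text \<open>Two-sided invariance is what lets the cut-off \<open>restr W\<close> pass through the
  difference operator of an element over \<open>u\<close>: a value and the value it is compared with
  are kept or discarded together.\<close>

definition stable :: "'v set \<Rightarrow> 'v \<Rightarrow> bool" where
  "stable W u \<longleftrightarrow> (\<forall>v. v + u \<in> W \<longleftrightarrow> v \<in> W)"

lemma stable_minus: "stable W u \<Longrightarrow> v - u \<in> W \<longleftrightarrow> v \<in> W"
  unfolding stable_def by (metis diff_add_cancel)

lemma stable_cosets:
  assumes "subspace U" "u \<in> U"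
  shows "stable {w. \<exists>v\<in>F. w - v \<in> U} u"
proof -
  have "w + u - v \<in> U \<longleftrightarrow> w - v \<in> U" for w v
    using assms subspace_add[of U "w - v" u] subspace_diff[of U "w + u - v" u]
    by (auto simp: algebra_simps)
  then show ?thesis by (simp add: stable_def)
qed

lemma restr_dif:
  assumes "stable W (bar a)" "a \<in> carrier \<Gamma>"
  shows "restr W (dif a f) = dif a (restr W f)"
  using assms stable_minus[OF assms(1)]
  by (auto simp: restr_def nabla_def translate_def fun_eq_iff bar_mult)

lemma restr_difs:
  "(\<And>a. a \<in> set Y \<Longrightarrow> stable W (bar a)) \<Longrightarrow> set Y \<subseteq> carrier \<Gamma> \<Longrightarrow>
    restr W (difs Y f) = difs Y (restr W f)"
  by (induction Y) (auto simp: restr_dif)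

lemma Cfun_restr: "f \<in> Cfun \<Gamma> \<Longrightarrow> restr W f \<in> Cfun \<Gamma>"
  by (auto simp: Cfun_def restr_def)


subsection \<open>Inverting difference operators on functions bounded below\<close>

definition bnd :: "('v \<Rightarrow> real) \<Rightarrow> ('g \<Rightarrow> int) \<Rightarrow> bool" where
  "bnd l f \<longleftrightarrow> (\<exists>C. \<forall>x. f x \<noteq> 0 \<longrightarrow> C \<le> l (bar x))"

lemma bnd_zero: "bnd l (\<lambda>_. 0)" by (simp add: bnd_def)

lemma bnd_comb:
  assumes "bnd l f" "bnd l g" "\<And>x. f x = 0 \<Longrightarrow> g x = 0 \<Longrightarrow> h x = 0"
  shows "bnd l h"
proof -
  obtain C C' where "\<And>x. f x \<noteq> 0 \<Longrightarrow> C \<le> l (bar x)" "\<And>x. g x \<noteq> 0 \<Longrightarrow> C' \<le> l (bar x)"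
    using assms unfolding bnd_def by auto
  with assms(3) show ?thesis unfolding bnd_def by (intro exI[of _ "min C C'"]) (metis min.coboundedI1 min.coboundedI2)
qed

lemma bnd_add: "bnd l f \<Longrightarrow> bnd l g \<Longrightarrow> bnd l (\<lambda>x. f x + g x)"
  and bnd_diff: "bnd l f \<Longrightarrow> bnd l g \<Longrightarrow> bnd l (\<lambda>x. f x - g x)"
  by (erule (1) bnd_comb; simp)+

lemma bnd_mono: "bnd l f \<Longrightarrow> (\<And>x. f x = 0 \<Longrightarrow> h x = 0) \<Longrightarrow> bnd l h"
  using bnd_comb[of l f f h] by auto

lemma bnd_tr:
  assumes "linear l" "bnd l f" "a \<in> carrier \<Gamma>"
  shows "bnd l (tr a f)"
proof -
  obtain C where "\<And>x. f x \<noteq> 0 \<Longrightarrow> C \<le> l (bar x)" using assms unfolding bnd_def by auto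
  then have "tr a f x \<noteq> 0 \<Longrightarrow> C \<le> l (bar x) - l (bar a)" for x
    using assms(1,3) by (force simp: translate_def bar_mult linear_diff split: if_splits)
  then show ?thesis unfolding bnd_def by (intro exI[of _ "C + l (bar a)"]) (auto simp: algebra_simps)
qed

lemma bnd_dif: "linear l \<Longrightarrow> bnd l f \<Longrightarrow> a \<in> carrier \<Gamma> \<Longrightarrow> bnd l (dif a f)"
  unfolding nabla_def by (intro bnd_diff bnd_tr)

lemma bnd_difs: "linear l \<Longrightarrow> bnd l f \<Longrightarrow> set Y \<subseteq> carrier \<Gamma> \<Longrightarrow> bnd l (difs Y f)"
  by (induction Y) (auto intro: bnd_dif)

text \<open>The equation makes \<open>f\<close> periodic under \<open>a\<close>, so a point of the
  support could be moved by multiples of \<open>a\<close> or of its inverse until \<open>l\<close>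
  drops below every bound.\<close>

lemma bnd_dif_eq_0:
  assumes l: "linear l" "bnd l f" and a: "a \<in> carrier \<Gamma>" "l (bar a) \<noteq> 0"
    and f: "f \<in> Cfun \<Gamma>" "dif a f = (\<lambda>_. 0)"
  shows "f = (\<lambda>_. 0)"
proof (rule ccontr)
  assume "f \<noteq> (\<lambda>_. 0)"
  then obtain x where x: "f x \<noteq> 0" by auto
  then have xc: "x \<in> carrier \<Gamma>" using f supp_carrier by blast
  obtain C where C: "\<And>x. f x \<noteq> 0 \<Longrightarrow> C \<le> l (bar x)" using l unfolding bnd_def by auto
  define b where "b = (if l (bar a) > 0 then inv a else a)"
  have b: "b \<in> carrier \<Gamma>" "l (bar b) < 0"
    using a l(1) by (auto simp: b_def linear_neg)
  have "f (x \<otimes> b [^] n) = f x" for n :: nat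
  proof (induction n)
    case (Suc n)
    have "f (x \<otimes> b [^] n \<otimes> b) = f (x \<otimes> b [^] n)"
      using dif_eq_0D[OF f(2)] dif_eq_0D'[OF f(2)] xc b a by (auto simp: b_def)
    with Suc show ?case using xc b by (simp add: m_assoc)
  qed (use xc in auto)
  then have *: "C \<le> l (bar x) + n * l (bar b)" for n :: nat
    using C[of "x \<otimes> b [^] n"] x xc b l(1) by (simp add: bar_mult bar_pow linear_add linear_scale)
  obtain n :: nat where "n * (- l (bar b)) > l (bar x) - C"
    using reals_Archimedean3[of "- l (bar b)"] b by auto
  with *[of n] show False by simp
qed

lemma bnd_difs_eq_0:
  assumes "linear l" "bnd l f" "set Y \<subseteq> carrier \<Gamma>" "\<And>a. a \<in> set Y \<Longrightarrow> l (bar a) \<noteq> 0"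
    and "f \<in> Cfun \<Gamma>" "difs Y f = (\<lambda>_. 0)"
  shows "f = (\<lambda>_. 0)"
  using assms(3,4,6)
proof (induction Y)
  case (Cons a Y)
  have "difs Y f = (\<lambda>_. 0)"
    by (rule bnd_dif_eq_0[of l _ a]) (use Cons assms in \<open>auto intro: bnd_difs Cfun_difs\<close>)
  with Cons show ?case by simp
qed simp

abbreviation off :: "('v \<Rightarrow> real) \<Rightarrow> 'g list \<Rightarrow> 'g list" where
  "off l X \<equiv> filter (\<lambda>x. l (bar x) \<noteq> 0) X"

text \<open>
  Elements on which \<open>l\<close> is nonzero act injectively on functions bounded below along \<open>l\<close>, so there is
  at most one such \<open>h\<close>. It is the convolution of \<open>g\<close> with one of the two terms of \<open>Q\<^sub>r\<close>, \<open>r\<close> the kernel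
  of \<open>l\<close>; the other term belongs to \<open>- l\<close>.
\<close>

definition sol :: "('v \<Rightarrow> real) \<Rightarrow> 'g list \<Rightarrow> ('g \<Rightarrow> int) \<Rightarrow> ('g \<Rightarrow> int) \<Rightarrow> bool" where
  "sol l X g h \<longleftrightarrow> h \<in> Cfun \<Gamma> \<and> bnd l h \<and> difs (off l X) h = g"

lemma sol_unique:
  assumes "linear l" "set X \<subseteq> carrier \<Gamma>" "sol l X g h" "sol l X g h'"
  shows "h = h'"
proof -
  have "(\<lambda>x. h x - h' x) = (\<lambda>_. 0)"
    by (rule bnd_difs_eq_0[OF assms(1), of _ "off l X"])
      (use assms in \<open>auto simp: sol_def difs_diff intro: bnd_diff Cfun_diff\<close>)
  then show ?thesis by (simp add: fun_eq_iff)
qed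

lemma sol_add: "sol l X g h \<Longrightarrow> sol l X g' h' \<Longrightarrow> sol l X (\<lambda>x. g x + g' x) (\<lambda>x. h x + h' x)"
  and sol_diff: "sol l X g h \<Longrightarrow> sol l X g' h' \<Longrightarrow> sol l X (\<lambda>x. g x - g' x) (\<lambda>x. h x - h' x)"
  and sol_zero: "sol l X (\<lambda>_. 0) (\<lambda>_. 0)"
  by (auto simp: sol_def difs_add difs_diff bnd_add bnd_diff Cfun_add Cfun_diff Cfun_zero bnd_zero)

lemma sol_dif:
  assumes "linear l" "set X \<subseteq> carrier \<Gamma>" "b \<in> carrier \<Gamma>" "sol l X g h"
  shows "sol l X (dif b g) (dif b h)"
  using assms dif_difs[of b "off l X" h] by (auto simp: sol_def bnd_dif Cfun_dif subset_iff)

lemma sol_difs: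
  assumes "linear l" "set X \<subseteq> carrier \<Gamma>" "set Y \<subseteq> carrier \<Gamma>" "sol l X g h"
  shows "sol l X (difs Y g) (difs Y h)"
  using assms(3) by (induction Y) (use assms in \<open>auto simp: sol_dif\<close>)

text \<open>The factor of \<open>a\<close> in the longer product is moved onto the solution; by
  uniqueness the result is the solution for the shorter list with the same \<open>g\<close>.\<close>

lemma sol_Cons_off: "l (bar a) \<noteq> 0 \<Longrightarrow> linear l \<Longrightarrow> a \<in> carrier \<Gamma> \<Longrightarrow> set X \<subseteq> carrier \<Gamma> \<Longrightarrow>
    sol l (a # X) g h \<Longrightarrow> sol l X g (dif a h)"
  using dif_difs[of a "off l X" h] by (auto simp: sol_def bnd_dif Cfun_dif subset_iff)

lemma sol_Cons_on: "l (bar a) = 0 \<Longrightarrow> sol l (a # X) g h \<longleftrightarrow> sol l X g h"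
  by (simp add: sol_def)

text \<open>Together with \<open>sol_unique\<close> this confines the support of a solution: if
  \<open>restr W\<close> fixes \<open>g\<close>, it fixes \<open>h\<close>.\<close>

lemma sol_restr:
  assumes "\<And>a. a \<in> set X \<Longrightarrow> stable W (bar a)" "set X \<subseteq> carrier \<Gamma>" "sol l X g h"
  shows "sol l X (restr W g) (restr W h)"
proof -
  have "restr W (difs (off l X) h) = difs (off l X) (restr W h)"
    by (rule restr_difs) (use assms in auto)
  moreover have "bnd l (restr W h)"
    using assms(3) by (auto simp: sol_def restr_def intro: bnd_mono[of l h])
  ultimately show ?thesis using assms(3) by (auto simp: sol_def Cfun_restr)
qed


subsection \<open>Convolution with Heaviside functions\<close>

text \<open>Stronger than \<open>bnd\<close>, and meant for the kernels: a function with finitely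
  many support points below each level can be convolved with every function that is bounded below,
  each value being a finite sum.\<close>

definition slice_fin :: "('v \<Rightarrow> real) \<Rightarrow> ('g \<Rightarrow> int) \<Rightarrow> bool" where
  "slice_fin l f \<longleftrightarrow> f \<in> Cfun \<Gamma> \<and> (\<forall>c. finite {x. f x \<noteq> 0 \<and> l (bar x) \<le> c})"

lemma slice_fin_bnd:
  assumes "slice_fin l f"
  shows "bnd l f"
proof -
  define S where "S = {x. f x \<noteq> 0 \<and> l (bar x) \<le> 0}"
  have fin: "finite S" using assms by (auto simp: slice_fin_def S_def)
  define C where "C = Min (insert 0 ((\<lambda>x. l (bar x)) ` S))"
  have "C \<le> l (bar x)" if "f x \<noteq> 0" for x
  proof (cases "l (bar x) \<le> 0")
    case True
    with that fin show ?thesis by (auto simp: C_def S_def intro!: Min_le)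
  next
    case False
    have "C \<le> 0" using fin by (auto simp: C_def intro!: Min_le)
    with False show ?thesis by simp
  qed
  then show ?thesis unfolding bnd_def by blast
qed

lemma slice_fin_Cfun: "slice_fin l f \<Longrightarrow> f \<in> Cfun \<Gamma>"
  by (simp add: slice_fin_def)

lemma slice_fin_comb:
  assumes "slice_fin l f" "slice_fin l g" "\<And>x. f x = 0 \<Longrightarrow> g x = 0 \<Longrightarrow> h x = 0"
  shows "slice_fin l h"
proof -
  have "finite {x. h x \<noteq> 0 \<and> l (bar x) \<le> c}" for c
    by (rule finite_subset[of _ "{x. f x \<noteq> 0 \<and> l (bar x) \<le> c} \<union> {x. g x \<noteq> 0 \<and> l (bar x) \<le> c}"])
      (use assms in \<open>auto simp: slice_fin_def\<close>)
  moreover have "h \<in> Cfun \<Gamma>"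
    using assms by (auto simp: Cfun_def slice_fin_def)
  ultimately show ?thesis by (simp add: slice_fin_def)
qed

lemma slice_fin_tr:
  assumes "linear l" "slice_fin l f" "a \<in> carrier \<Gamma>"
  shows "slice_fin l (tr a f)"
proof -
  have "finite {x. tr a f x \<noteq> 0 \<and> l (bar x) \<le> c}" for c
  proof (rule finite_subset)
    show "{x. tr a f x \<noteq> 0 \<and> l (bar x) \<le> c} \<subseteq>
      (\<lambda>x. x \<otimes> a) ` {x. f x \<noteq> 0 \<and> l (bar x) \<le> c - l (bar a)}"
    proof (clarsimp)
      fix x assume x: "tr a f x \<noteq> 0" "l (bar x) \<le> c"
      then have xc: "x \<in> carrier \<Gamma>" by (auto simp: translate_def split: if_splits)
      show "x \<in> (\<lambda>x. x \<otimes> a) ` {x. f x \<noteq> 0 \<and> l (bar x) \<le> c - l (bar a)}"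
        by (rule image_eqI[of _ _ "x \<otimes> inv a"])
          (use x xc assms in \<open>auto simp: translate_def m_assoc bar_mult linear_diff\<close>)
    qed
    show "finite ((\<lambda>x. x \<otimes> a) ` {x. f x \<noteq> 0 \<and> l (bar x) \<le> c - l (bar a)})"
      using assms by (auto simp: slice_fin_def)
  qed
  then show ?thesis by (simp add: slice_fin_def Cfun_tr)
qed

lemma slice_fin_dif: "linear l \<Longrightarrow> slice_fin l f \<Longrightarrow> a \<in> carrier \<Gamma> \<Longrightarrow> slice_fin l (dif a f)"
  by (rule slice_fin_comb[of l f "tr a f"]) (auto intro: slice_fin_tr simp: nabla_def)

lemma slice_fin_difs: "linear l \<Longrightarrow> slice_fin l f \<Longrightarrow> set Y \<subseteq> carrier \<Gamma> \<Longrightarrow> slice_fin l (difs Y f)"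
  by (induction Y) (auto intro: slice_fin_dif)

lemma slice_fin_delta: "d \<in> carrier \<Gamma> \<Longrightarrow> slice_fin l (delta d)"
  by (auto simp: slice_fin_def delta_def Cfun_def intro: finite_subset[of _ "{d}"])

definition conv_fin :: "('g \<Rightarrow> int) \<Rightarrow> ('g \<Rightarrow> int) \<Rightarrow> 'g \<Rightarrow> bool" where
  "conv_fin f g z \<longleftrightarrow> finite {x \<in> carrier \<Gamma>. f x * g (inv x \<otimes> z) \<noteq> 0}"

text \<open>If the factors at \<open>x\<close> and at \<open>z - x\<close> are both nonzero, the
  lower bound of \<open>g\<close> puts an upper bound on \<open>l\<close> at \<open>x\<close>, and
  below it \<open>f\<close> has only finitely many support points.\<close>

lemma conv_fin_bnd:
  assumes "linear l" "slice_fin l f" "bnd l g" "z \<in> carrier \<Gamma>"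
  shows "conv_fin f g z"
proof -
  obtain C where C: "\<And>x. g x \<noteq> 0 \<Longrightarrow> C \<le> l (bar x)" using assms unfolding bnd_def by auto
  have "{x \<in> carrier \<Gamma>. f x * g (inv x \<otimes> z) \<noteq> 0} \<subseteq> {x. f x \<noteq> 0 \<and> l (bar x) \<le> l (bar z) - C}"
  proof clarify
    fix x assume x: "x \<in> carrier \<Gamma>" "f x * g (inv x \<otimes> z) \<noteq> 0"
    have "C \<le> l (bar (inv x \<otimes> z))" using x by (intro C) auto
    also have "\<dots> = l (bar z) - l (bar x)"
      using x assms by (simp add: bar_mult linear_diff[symmetric])
    finally show "f x \<noteq> 0 \<and> l (bar x) \<le> l (bar z) - C" using x by auto
  qed
  then show ?thesis unfolding conv_fin_def using assms(2) slice_fin_def finite_subset by blast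
qed

text \<open>Passes from pairs to a single variable and leaves the finite index set free, so that
  several convolutions can be summed over a common set.\<close>

lemma conv_eq:
  assumes "z \<in> carrier \<Gamma>" "finite S" "S \<subseteq> carrier \<Gamma>"
    "\<And>x. x \<in> carrier \<Gamma> \<Longrightarrow> f x * g (inv x \<otimes> z) \<noteq> 0 \<Longrightarrow> x \<in> S"
  shows "conv \<Gamma> f g z = (\<Sum>x\<in>S. f x * g (inv x \<otimes> z))"
proof -
  let ?T = "{x \<in> carrier \<Gamma>. f x * g (inv x \<otimes> z) \<noteq> 0}"
  have eq: "y = inv x \<otimes> (x \<otimes> y)" if "x \<in> carrier \<Gamma>" "y \<in> carrier \<Gamma>" for x y
    using that by (simp add: m_assoc[symmetric])
  have "conv \<Gamma> f g z = (\<Sum>x\<in>?T. f x * g (inv x \<otimes> z))"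
    unfolding conv_def
    by (rule sum.reindex_bij_witness[where i = "\<lambda>x. (x, inv x \<otimes> z)" and j = fst])
      (use assms(1) eq in \<open>auto simp: m_assoc[symmetric]\<close>)
  also have "\<dots> = (\<Sum>x\<in>S. f x * g (inv x \<otimes> z))"
    by (rule sum.mono_neutral_left) (use assms in auto)
  finally show ?thesis .
qed

lemma conv_outside: "z \<notin> carrier \<Gamma> \<Longrightarrow> conv \<Gamma> f g z = 0"
  unfolding conv_def by (rule sum.neutral) auto

lemma Cfun_conv: "conv \<Gamma> f g \<in> Cfun \<Gamma>"
  by (simp add: Cfun_def conv_outside)

lemma conv_nonzero:
  "conv \<Gamma> f g z \<noteq> 0 \<Longrightarrow> \<exists>x\<in>carrier \<Gamma>. f x \<noteq> 0 \<and> g (inv x \<otimes> z) \<noteq> 0 \<and> z \<in> carrier \<Gamma>"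
proof (rule ccontr)
  assume z: "conv \<Gamma> f g z \<noteq> 0" and n: "\<not> (\<exists>x\<in>carrier \<Gamma>. f x \<noteq> 0 \<and> g (inv x \<otimes> z) \<noteq> 0 \<and> z \<in> carrier \<Gamma>)"
  from z have "z \<in> carrier \<Gamma>" using conv_outside by blast
  with n conv_eq[of z "{}" f g] z show False by auto
qed

lemma bnd_conv:
  assumes "linear l" "bnd l f" "bnd l g"
  shows "bnd l (conv \<Gamma> f g)"
proof -
  obtain C C' where C: "\<And>x. f x \<noteq> 0 \<Longrightarrow> C \<le> l (bar x)" "\<And>x. g x \<noteq> 0 \<Longrightarrow> C' \<le> l (bar x)"
    using assms unfolding bnd_def by auto
  have "C + C' \<le> l (bar z)" if nz: "conv \<Gamma> f g z \<noteq> 0" for z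
  proof -
    from conv_nonzero[OF nz] obtain x where
      x: "x \<in> carrier \<Gamma>" "f x \<noteq> 0" "g (inv x \<otimes> z) \<noteq> 0" "z \<in> carrier \<Gamma>" by auto
    have "l (bar z) = l (bar x) + l (bar (inv x \<otimes> z))"
      using x assms(1) by (simp add: bar_mult linear_add[symmetric])
    with C x show ?thesis by (simp add: add_mono)
  qed
  then show ?thesis unfolding bnd_def by blast
qed

lemma slice_fin_conv:
  assumes l: "linear l" and f: "slice_fin l f" and g: "slice_fin l g"
  shows "slice_fin l (conv \<Gamma> f g)"
proof -
  obtain C C' where C: "\<And>x. f x \<noteq> 0 \<Longrightarrow> C \<le> l (bar x)" "\<And>x. g x \<noteq> 0 \<Longrightarrow> C' \<le> l (bar x)"
    using slice_fin_bnd[OF f] slice_fin_bnd[OF g] unfolding bnd_def by auto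
  have "finite {z. conv \<Gamma> f g z \<noteq> 0 \<and> l (bar z) \<le> c}" for c
  proof (rule finite_subset)
    show "{z. conv \<Gamma> f g z \<noteq> 0 \<and> l (bar z) \<le> c} \<subseteq> (\<lambda>(x, y). x \<otimes> y) `
      ({x. f x \<noteq> 0 \<and> l (bar x) \<le> c - C'} \<times> {x. g x \<noteq> 0 \<and> l (bar x) \<le> c - C})"
    proof
      fix z assume "z \<in> {z. conv \<Gamma> f g z \<noteq> 0 \<and> l (bar z) \<le> c}"
      then have z: "conv \<Gamma> f g z \<noteq> 0" "l (bar z) \<le> c" by auto
      from conv_nonzero[OF z(1)] obtain x where
        x: "x \<in> carrier \<Gamma>" "f x \<noteq> 0" "g (inv x \<otimes> z) \<noteq> 0" "z \<in> carrier \<Gamma>" by auto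
      have e: "l (bar z) = l (bar x) + l (bar (inv x \<otimes> z))"
        using x l by (simp add: bar_mult linear_add[symmetric])
      have "z = x \<otimes> (inv x \<otimes> z)" using x by (simp add: m_assoc[symmetric])
      moreover have "l (bar x) \<le> c - C'" using C(2)[OF x(3)] e z by linarith
      moreover have "l (bar (inv x \<otimes> z)) \<le> c - C" using C(1)[OF x(2)] e z by linarith
      ultimately show "z \<in> (\<lambda>(x, y). x \<otimes> y) `
        ({x. f x \<noteq> 0 \<and> l (bar x) \<le> c - C'} \<times> {x. g x \<noteq> 0 \<and> l (bar x) \<le> c - C})"
        using x by (intro image_eqI[of _ _ "(x, inv x \<otimes> z)"]) auto
    qed
    show "finite ((\<lambda>(x, y). x \<otimes> y) `
      ({x. f x \<noteq> 0 \<and> l (bar x) \<le> c - C'} \<times> {x. g x \<noteq> 0 \<and> l (bar x) \<le> c - C}))"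
      using f g by (auto simp: slice_fin_def)
  qed
  then show ?thesis by (simp add: slice_fin_def Cfun_conv)
qed

text \<open>The shape with two coefficients and a minus sign serves three purposes: the two terms of
  \<open>Q_fun\<close>, the difference in \<open>nabla\<close>, and (with second coefficient 0) a
  scalar multiple.\<close>

lemma conv_linear:
  assumes "\<And>z. z \<in> carrier \<Gamma> \<Longrightarrow> conv_fin f g z" "\<And>z. z \<in> carrier \<Gamma> \<Longrightarrow> conv_fin f' g z"
  shows "conv \<Gamma> (\<lambda>x. c * f x - c' * f' x) g = (\<lambda>x. c * conv \<Gamma> f g x - c' * conv \<Gamma> f' g x)"
proof
  fix z
  show "conv \<Gamma> (\<lambda>x. c * f x - c' * f' x) g z = c * conv \<Gamma> f g z - c' * conv \<Gamma> f' g z"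
  proof (cases "z \<in> carrier \<Gamma>")
    case z: True
    let ?S = "{x \<in> carrier \<Gamma>. f x * g (inv x \<otimes> z) \<noteq> 0} \<union> {x \<in> carrier \<Gamma>. f' x * g (inv x \<otimes> z) \<noteq> 0}"
    have fin: "finite ?S" using assms[OF z] by (simp add: conv_fin_def)
    have "conv \<Gamma> h g z = (\<Sum>x\<in>?S. h x * g (inv x \<otimes> z))"
      if "h \<in> {f, f', \<lambda>x. c * f x - c' * f' x}" for h
      by (rule conv_eq[OF z fin]) (use that in auto)
    then show ?thesis
      by (simp add: left_diff_distrib sum_subtractf sum_distrib_left mult.assoc)
  qed (simp add: conv_outside)
qed

lemma conv_delta:
  assumes "d \<in> carrier \<Gamma>"
  shows "conv \<Gamma> (delta d) g = tr d g"
proof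
  fix z
  show "conv \<Gamma> (delta d) g z = tr d g z"
  proof (cases "z \<in> carrier \<Gamma>")
    case True
    then have "conv \<Gamma> (delta d) g z = (\<Sum>x\<in>{d}. delta d x * g (inv x \<otimes> z))"
      by (rule conv_eq) (use assms in \<open>auto simp: delta_def split: if_splits\<close>)
    with True assms show ?thesis by (simp add: delta_def translate_def m_comm)
  qed (simp add: conv_outside translate_def)
qed

lemma conv_tr_left:
  assumes "a \<in> carrier \<Gamma>" "f \<in> Cfun \<Gamma>"
    "\<And>z. z \<in> carrier \<Gamma> \<Longrightarrow> conv_fin f g z"
  shows "conv \<Gamma> (tr a f) g = tr a (conv \<Gamma> f g)"
proof
  fix z
  show "conv \<Gamma> (tr a f) g z = tr a (conv \<Gamma> f g) z"
  proof (cases "z \<in> carrier \<Gamma>")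
    case z: True
    let ?S = "{x \<in> carrier \<Gamma>. f x * g (inv x \<otimes> (z \<otimes> inv a)) \<noteq> 0}"
    have fin: "finite ?S" using assms z by (simp add: conv_fin_def)
    have eq: "inv (x \<otimes> a) \<otimes> z = inv x \<otimes> (z \<otimes> inv a)" if "x \<in> carrier \<Gamma>" for x
      using that z assms by (simp add: inv_mult m_ac)
    have inj: "inj_on (\<lambda>x. x \<otimes> a) ?S" by (rule inj_onI) (use assms in auto)
    have shift: "x = (x \<otimes> inv a) \<otimes> a" if "x \<in> carrier \<Gamma>" for x
      using that assms by (simp add: m_assoc)
    have "conv \<Gamma> (tr a f) g z = (\<Sum>x\<in>(\<lambda>x. x \<otimes> a) ` ?S. tr a f x * g (inv x \<otimes> z))"
    proof (rule conv_eq[OF z])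
      fix x assume x: "x \<in> carrier \<Gamma>" "tr a f x * g (inv x \<otimes> z) \<noteq> 0"
      then show "x \<in> (\<lambda>x. x \<otimes> a) ` ?S"
        using shift[OF x(1)] eq[of "x \<otimes> inv a"] assms
        by (intro image_eqI[of _ _ "x \<otimes> inv a"]) (auto simp: translate_def)
    qed (use fin assms in auto)
    also have "\<dots> = (\<Sum>x\<in>?S. tr a f (x \<otimes> a) * g (inv (x \<otimes> a) \<otimes> z))"
      by (rule sum.reindex_cong[OF inj]) auto
    also have "\<dots> = (\<Sum>x\<in>?S. f x * g (inv x \<otimes> (z \<otimes> inv a)))"
      by (rule sum.cong) (use assms eq in \<open>auto simp: translate_def m_assoc\<close>)
    also have "\<dots> = conv \<Gamma> f g (z \<otimes> inv a)"
      by (rule conv_eq[symmetric]) (use fin z assms in auto)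
    finally show ?thesis using z by (simp add: translate_def)
  qed (simp add: conv_outside translate_def)
qed

lemma conv_dif_left:
  assumes l: "linear l" and f: "slice_fin l f" and g: "bnd l g" and a: "a \<in> carrier \<Gamma>"
  shows "conv \<Gamma> (dif a f) g = dif a (conv \<Gamma> f g)"
proof -
  have fin: "conv_fin f g z" "conv_fin (tr a f) g z" if "z \<in> carrier \<Gamma>" for z
    using assms that by (auto intro: conv_fin_bnd slice_fin_tr)
  have "conv \<Gamma> (dif a f) g = (\<lambda>x. conv \<Gamma> f g x - conv \<Gamma> (tr a f) g x)"
    using conv_linear[OF fin, of 1 1] by (simp add: nabla_def)
  also have "conv \<Gamma> (tr a f) g = tr a (conv \<Gamma> f g)"
    by (rule conv_tr_left[OF a slice_fin_Cfun[OF f] fin(1)])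
  finally show ?thesis by (simp add: nabla_def)
qed

lemma conv_difs_left:
  assumes "linear l" "slice_fin l f" "bnd l g" "set Y \<subseteq> carrier \<Gamma>"
  shows "conv \<Gamma> (difs Y f) g = difs Y (conv \<Gamma> f g)"
  using assms(4)
  by (induction Y) (use assms conv_dif_left slice_fin_difs in auto)


section \<open>Heaviside functions as inverses of difference operators\<close>

lemma pow_inj:
  assumes "a \<in> carrier \<Gamma>" "l (bar a) \<noteq> (0::real)" "linear l" "a [^] (j::nat) = a [^] (k::nat)"
  shows "j = k"
proof -
  have "real j *\<^sub>R bar a = real k *\<^sub>R bar a" using assms bar_pow by metis
  moreover have "bar a \<noteq> 0" using assms(2,3) linear_0 by metis
  ultimately show ?thesis by simp
qed

lemma heaviside_eq:
  assumes "a \<in> carrier \<Gamma>" "l (bar a) \<noteq> (0::real)" "linear l"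
  shows "heaviside \<Gamma> a x = (if \<exists>k::nat. x = a [^] k then 1 else 0)"
proof (cases "\<exists>k::nat. x = a [^] k")
  case True
  then obtain k :: nat where k: "x = a [^] k" by auto
  then have "{k::nat. x = a [^] k} = {k}" using pow_inj[OF assms] by auto
  with k show ?thesis by (auto simp: heaviside_def delta_def)
qed (auto simp: heaviside_def)

text \<open>Along the multiples of \<open>a\<close> the functional grows linearly, so each slice
  meets finitely many of them; and shifting the ray by \<open>a\<close> removes exactly its starting
  point.\<close>

lemma heaviside:
  assumes "a \<in> carrier \<Gamma>" "l (bar a) > 0" "linear l"
  shows "slice_fin l (heaviside \<Gamma> a)" "dif a (heaviside \<Gamma> a) = delta \<one>"
proof -
  have ne: "l (bar a) \<noteq> 0" using assms by simp
  note H = heaviside_eq[OF assms(1) ne assms(3)]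
  have "finite {x. heaviside \<Gamma> a x \<noteq> 0 \<and> l (bar x) \<le> c}" for c
  proof (rule finite_subset)
    show "{x. heaviside \<Gamma> a x \<noteq> 0 \<and> l (bar x) \<le> c} \<subseteq> (\<lambda>k. a [^] k) ` {..nat \<lceil>c / l (bar a)\<rceil>}"
    proof
      fix x assume "x \<in> {x. heaviside \<Gamma> a x \<noteq> 0 \<and> l (bar x) \<le> c}"
      then obtain k :: nat where k: "x = a [^] k" "l (bar x) \<le> c" by (auto simp: H split: if_splits)
      then have "real k * l (bar a) \<le> c" using assms by (simp add: bar_pow linear_scale)
      then have "real k \<le> c / l (bar a)" using assms by (simp add: field_simps)
      then have "k \<le> nat \<lceil>c / l (bar a)\<rceil>" by linarith
      with k show "x \<in> (\<lambda>k. a [^] k) ` {..nat \<lceil>c / l (bar a)\<rceil>}" by blast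
    qed
  qed simp
  moreover have "heaviside \<Gamma> a \<in> Cfun \<Gamma>" using assms by (auto simp: Cfun_def H)
  ultimately show "slice_fin l (heaviside \<Gamma> a)" by (simp add: slice_fin_def)
  have shift: "x \<otimes> inv a = a [^] (k::nat) \<longleftrightarrow> x = a [^] Suc k" if "x \<in> carrier \<Gamma>" for x k
    using that assms(1) inv_solve_right'[of "a [^] k" x a] by simp
  \<comment> \<open>A positive power of \<open>a\<close> is never the identity, so the shifted ray
    really misses the starting point.\<close>
  have one: "\<not> (\<exists>k::nat. \<one> = a [^] Suc k)"
    using pow_inj[OF assms(1) ne assms(3), of 0] by force
  have split: "(\<exists>k::nat. x = a [^] k) \<longleftrightarrow> x = \<one> \<or> (\<exists>k::nat. x = a [^] Suc k)" for x
    using nat_pow_0 by (metis not0_implies_Suc)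
  show "dif a (heaviside \<Gamma> a) = delta \<one>"
  proof
    fix x
    show "dif a (heaviside \<Gamma> a) x = delta \<one> x"
    proof (cases "x \<in> carrier \<Gamma>")
      case True
      have "dif a (heaviside \<Gamma> a) x = heaviside \<Gamma> a x - heaviside \<Gamma> a (x \<otimes> inv a)"
        using True by (simp add: nabla_def translate_def)
      also have "\<dots> = (if \<exists>k::nat. x = a [^] k then 1 else 0) - (if \<exists>k::nat. x = a [^] Suc k then 1 else 0)"
        unfolding H shift[OF True] ..
      also have "\<dots> = delta \<one> x"
        unfolding split[of x] delta_def using one by (cases "x = \<one>") (simp_all del: nat_pow_Suc)
      finally show ?thesis .
    next
      case False
      then have "\<not> (\<exists>k::nat. x = a [^] k)" "x \<noteq> \<one>" using assms(1) by auto
      with False show ?thesis by (simp add: nabla_def translate_def H delta_def)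
    qed
  qed
qed

lemma heaviside_list:
  assumes "linear l" "set A \<subseteq> carrier \<Gamma>" "\<And>a. a \<in> set A \<Longrightarrow> l (bar a) > 0"
  shows "slice_fin l (heaviside_list \<Gamma> A) \<and> difs A (heaviside_list \<Gamma> A) = delta \<one>"
  using assms(2,3)
proof (induction A)
  case Nil
  then show ?case by (simp add: heaviside_list_def slice_fin_delta)
next
  case (Cons a A)
  let ?H = "heaviside_list \<Gamma> A"
  have a: "a \<in> carrier \<Gamma>" "l (bar a) > 0" and A: "set A \<subseteq> carrier \<Gamma>" using Cons by auto
  have IH: "slice_fin l ?H" "difs A ?H = delta \<one>" using Cons by auto
  note h = heaviside[OF a assms(1)]
  have eq: "heaviside_list \<Gamma> (a # A) = conv \<Gamma> (heaviside \<Gamma> a) ?H" by (simp add: heaviside_list_def)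
  have "dif a (heaviside_list \<Gamma> (a # A)) = conv \<Gamma> (delta \<one>) ?H"
    unfolding eq h(2)[symmetric]
    by (rule conv_dif_left[symmetric, OF assms(1) h(1) slice_fin_bnd[OF IH(1)] a(1)])
  also have "\<dots> = ?H" using IH by (simp add: conv_delta tr_one slice_fin_Cfun)
  finally have "difs A (dif a (heaviside_list \<Gamma> (a # A))) = delta \<one>" using IH by simp
  then show ?case
    using dif_difs[OF a(1) A] slice_fin_conv[OF assms(1) h(1) IH(1)] by (simp add: eq)
qed

text \<open>In operator form: 1 - tau_b = - tau_b (1 - tau_(-b)). It trades an element on the
  negative side of a hyperplane for its inverse on the positive side.\<close>

lemma dif_inv: "b \<in> carrier \<Gamma> \<Longrightarrow> f \<in> Cfun \<Gamma> \<Longrightarrow> dif b f = (\<lambda>x. - tr b (dif (inv b) f) x)"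
  by (auto simp: nabla_def tr_diff tr_tr tr_one)

lemma list_total_closed: "set B \<subseteq> carrier \<Gamma> \<Longrightarrow> list_total \<Gamma> B \<in> carrier \<Gamma>"
  by (induction B) (auto simp: list_total_def)

lemma set_neg_list: "set B \<subseteq> carrier \<Gamma> \<Longrightarrow> set (neg_list \<Gamma> B) \<subseteq> carrier \<Gamma>"
  by (auto simp: neg_list_def)

text \<open>The product of \<open>dif_inv\<close> over \<open>B\<close>. This is the origin of the
  sign (-1)^|B| and of the shift by the sum of \<open>B\<close> in the definition of
  \<open>Q\<close>.\<close>

lemma difs_neg_list:
  assumes "set B \<subseteq> carrier \<Gamma>" "f \<in> Cfun \<Gamma>"
  shows "difs B f = (\<lambda>x. (-1) ^ length B * tr (list_total \<Gamma> B) (difs (neg_list \<Gamma> B) f) x)"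
  using assms(1)
proof (induction B)
  case Nil
  then show ?case using assms by (simp add: list_total_def neg_list_def tr_one)
next
  case (Cons b B)
  then have b: "b \<in> carrier \<Gamma>" and B: "set B \<subseteq> carrier \<Gamma>" by auto
  let ?t = "list_total \<Gamma> B" and ?n = "neg_list \<Gamma> B"
  have n: "set ?n \<subseteq> carrier \<Gamma>" and t: "?t \<in> carrier \<Gamma>"
    using B set_neg_list list_total_closed by auto
  have "difs (b # B) f = (\<lambda>x. (-1) ^ length B * dif b (tr ?t (difs ?n f)) x)"
    using Cons B by (simp add: dif_scale)
  also have "dif b (tr ?t (difs ?n f)) = (\<lambda>x. - tr b (tr ?t (dif (inv b) (difs ?n f))) x)"
    using b t dif_inv[OF b Cfun_tr[of ?t "difs ?n f"]] by (simp add: tr_dif)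
  also have "tr b (tr ?t (dif (inv b) (difs ?n f))) =
      tr (list_total \<Gamma> (b # B)) (difs (neg_list \<Gamma> (b # B)) f)"
    using b t by (simp add: tr_tr list_total_def neg_list_def)
  finally show ?case by simp
qed

text \<open>The kernel in the first term of \<open>Q\<close> without its sign; exchanging
  \<open>A\<close> and \<open>B\<close> gives the kernel in the second term.\<close>

definition half_Q :: "'g list \<Rightarrow> 'g list \<Rightarrow> 'g \<Rightarrow> int" where
  "half_Q A B = conv \<Gamma> (conv \<Gamma> (delta (inv (list_total \<Gamma> B))) (heaviside_list \<Gamma> A))
     (heaviside_list \<Gamma> (neg_list \<Gamma> B))"

text \<open>Inverting the elements of \<open>B\<close> puts every Heaviside factor on the side where
  \<open>l\<close> is positive, so all sums are finite. The shift in \<open>difs_neg_list\<close>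
  cancels the leading \<open>delta\<close>, and only the sign survives.\<close>

lemma half_Q:
  assumes l: "linear l" and A: "set A \<subseteq> carrier \<Gamma>" "\<And>a. a \<in> set A \<Longrightarrow> l (bar a) > 0"
    and B: "set B \<subseteq> carrier \<Gamma>" "\<And>b. b \<in> set B \<Longrightarrow> l (bar b) < 0"
  shows "slice_fin l (half_Q A B)"
    and "difs A (difs B (half_Q A B)) = (\<lambda>x. (-1) ^ length B * delta \<one> x)"
proof -
  let ?n = "neg_list \<Gamma> B" and ?t = "list_total \<Gamma> B"
  let ?K = "conv \<Gamma> (delta (inv ?t)) (heaviside_list \<Gamma> A)"
  have n: "set ?n \<subseteq> carrier \<Gamma>" and t: "?t \<in> carrier \<Gamma>"
    using B set_neg_list list_total_closed by auto
  have HA: "slice_fin l (heaviside_list \<Gamma> A)" "difs A (heaviside_list \<Gamma> A) = delta \<one>"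
    using heaviside_list[OF l A] by auto
  have "l (bar b) > 0" if "b \<in> set ?n" for b
    using that B l by (auto simp: neg_list_def linear_neg subset_iff)
  from heaviside_list[OF l n this]
  have HB: "slice_fin l (heaviside_list \<Gamma> ?n)" "difs ?n (heaviside_list \<Gamma> ?n) = delta \<one>" by auto
  have K_tr: "?K = tr (inv ?t) (heaviside_list \<Gamma> A)" using t by (simp add: conv_delta)
  have K: "slice_fin l ?K" unfolding K_tr using HA l t by (intro slice_fin_tr) auto
  show sf: "slice_fin l (half_Q A B)" unfolding half_Q_def by (rule slice_fin_conv[OF l K HB(1)])
  have "difs A (half_Q A B) = conv \<Gamma> (difs A ?K) (heaviside_list \<Gamma> ?n)"
    unfolding half_Q_def by (rule conv_difs_left[symmetric, OF l K slice_fin_bnd[OF HB(1)] A(1)])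
  also have "difs A ?K = tr (inv ?t) (delta \<one>)"
    unfolding K_tr using t A HA by (simp add: tr_difs[symmetric])
  also have "tr (inv ?t) (delta \<one>) = delta (inv ?t)"
    using t inv_solve_right'[of \<one> _ "inv ?t"]
    by (auto simp: translate_def delta_def fun_eq_iff)
  also have "conv \<Gamma> (delta (inv ?t)) (heaviside_list \<Gamma> ?n) = tr (inv ?t) (heaviside_list \<Gamma> ?n)"
    using t by (simp add: conv_delta)
  finally have "difs ?n (difs A (half_Q A B)) = tr (inv ?t) (delta \<one>)"
    using t n HB by (simp add: tr_difs[symmetric])
  then have "tr ?t (difs ?n (difs A (half_Q A B))) = delta \<one>"
    using t by (simp add: tr_tr tr_one slice_fin_Cfun[OF slice_fin_delta])
  then have "difs B (difs A (half_Q A B)) = (\<lambda>x. (-1) ^ length B * delta \<one> x)"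
    using difs_neg_list[OF B(1) Cfun_difs[OF slice_fin_Cfun[OF sf]], of A] by simp
  then show "difs A (difs B (half_Q A B)) = (\<lambda>x. (-1) ^ length B * delta \<one> x)"
    using difs_commute A B by simp
qed

lemma sol_half_Q:
  assumes l: "linear l" and X: "set X \<subseteq> carrier \<Gamma>" and g: "g \<in> Cfun \<Gamma>" "bnd l g"
    and A: "A = filter (\<lambda>x. 0 < l (bar x)) X" and B: "B = filter (\<lambda>x. l (bar x) < 0) X"
  shows "sol l X g (\<lambda>x. (-1) ^ length B * conv \<Gamma> (half_Q A B) g x)"
proof -
  have AB: "set A \<subseteq> carrier \<Gamma>" "\<And>a. a \<in> set A \<Longrightarrow> l (bar a) > 0"
    "set B \<subseteq> carrier \<Gamma>" "\<And>b. b \<in> set B \<Longrightarrow> l (bar b) < 0"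
    using X A B by auto
  note hQ = half_Q[OF l AB]
  let ?W = "half_Q A B" and ?h = "conv \<Gamma> (half_Q A B) g"
  have 1: "mset (off l X) = mset A + mset B"
    unfolding A B by (induction X) auto
  have "difs (off l X) ?h = difs A (difs B ?h)"
    by (rule difs_mset_union[OF 1]) (use X in auto)
  also have "\<dots> = conv \<Gamma> (difs A (difs B ?W)) g"
    using conv_difs_left[OF l _ g(2)] slice_fin_difs[OF l hQ(1)] hQ(1) AB by simp
  also have "\<dots> = conv \<Gamma> (\<lambda>x. (-1) ^ length B * delta \<one> x - 0 * delta \<one> x) g"
    using hQ(2) by simp
  also have "\<dots> = (\<lambda>x. (-1) ^ length B * g x)"
    using conv_fin_bnd[OF l slice_fin_delta[OF one_closed] g(2)]
    by (subst conv_linear) (auto simp: conv_delta tr_one g)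
  finally have 2: "difs (off l X) ?h = (\<lambda>x. (-1) ^ length B * g x)" .
  \<comment> \<open>The sign left over by \<open>half_Q\<close> meets the equal sign in front of the
    term of \<open>Q\<close>, and they cancel.\<close>
  have "(-1) ^ length B * ((-1) ^ length B * c) = (c::int)" for c
    by (simp add: mult.assoc[symmetric] power_add[symmetric])
  with 2 show ?thesis
    using bnd_conv[OF l slice_fin_bnd[OF hQ(1)] g(2)]
    by (auto simp: sol_def difs_scale Cfun_scale Cfun_conv intro: bnd_mono)
qed

lemma sol_exists:
  assumes "linear l" "set X \<subseteq> carrier \<Gamma>" "g \<in> Cfun \<Gamma>" "bnd l g"
  shows "\<exists>h. sol l X g h"
  using sol_half_Q[OF assms refl refl] by blast

text \<open>Replacing \<open>l\<close> by its negative exchanges \<open>A\<close> and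
  \<open>B\<close>, so the second term of \<open>Q\<close> is the solution for \<open>- l\<close>.
  By uniqueness any pair of one-sided solutions may be supplied. The two bounds on \<open>g\<close>
  make the convolution with each half finite.\<close>

lemma conv_Q_fun:
  assumes l: "linear l" "set X \<subseteq> carrier \<Gamma>" and g: "g \<in> Cfun \<Gamma>"
    and b: "bnd l g" "bnd (\<lambda>v. - l v) g"
    and s: "sol l X g h1" "sol (\<lambda>v. - l v) X g h2"
  shows "conv \<Gamma> (Q_fun \<Gamma> bar X {v. l v = 0} {v. 0 < l v}) g = (\<lambda>x. h1 x - h2 x)"
proof -
  let ?m = "\<lambda>v. - l v"
  define A B where "A = filter (\<lambda>x. 0 < l (bar x)) X" and "B = filter (\<lambda>x. l (bar x) < 0) X"
  have m: "linear ?m" using l(1) linear_compose_neg by blast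
  have AB: "set A \<subseteq> carrier \<Gamma>" "\<And>a. a \<in> set A \<Longrightarrow> l (bar a) > 0"
    "set B \<subseteq> carrier \<Gamma>" "\<And>b. b \<in> set B \<Longrightarrow> l (bar b) < 0"
    using l A_def B_def by auto
  have B': "sub_list_in bar (- ({v. l v = 0} \<union> {v. 0 < l v})) X = B"
    and A': "sub_list_in bar {v. 0 < l v} X = A"
    by (auto simp: sub_list_in_def A_def B_def intro: filter_cong)
  have Q: "Q_fun \<Gamma> bar X {v. l v = 0} {v. 0 < l v} =
      (\<lambda>x. (-1) ^ length B * half_Q A B x - (-1) ^ length A * half_Q B A x)"
    unfolding Q_fun_def Let_def A' B' half_Q_def ..
  have f1: "conv_fin (half_Q A B) g z" if "z \<in> carrier \<Gamma>" for z
    using conv_fin_bnd[OF l(1) half_Q(1)[OF l(1) AB] b(1) that] .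
  have "slice_fin ?m (half_Q B A)"
    by (rule half_Q(1)[OF m]) (use AB in auto)
  then have f2: "conv_fin (half_Q B A) g z" if "z \<in> carrier \<Gamma>" for z
    using conv_fin_bnd[OF m _ b(2) that] by blast
  have "h1 = (\<lambda>x. (-1) ^ length B * conv \<Gamma> (half_Q A B) g x)"
    using sol_unique[OF l s(1) sol_half_Q[OF l g b(1) A_def B_def]] .
  moreover have "h2 = (\<lambda>x. (-1) ^ length A * conv \<Gamma> (half_Q B A) g x)"
    using sol_unique[OF m l(2) s(2) sol_half_Q[OF m l(2) g b(2)]] A_def B_def by simp
  ultimately show ?thesis unfolding Q by (simp add: conv_linear[OF f1 f2])
qed


subsection \<open>Dahmen--Micchelli spaces relative to a subspace and a list of periods\<close>

text \<open>
  \<open>rel_DM U L X\<close> plays the role of \<open>DM\<close> for the image of \<open>X\<close> in the quotient of \<open>\<Gamma>\<^bsub>U\<^esub>\<close> by the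
  subgroup generated by \<open>L\<close>, made a module over the group ring of \<open>\<Gamma>\<close>: functions on the quotient
  are \<open>L\<close>-periodic functions, so that no quotient group has to be formed. Among the sublists \<open>Y\<close>
  of \<open>X\<close> with non-spanning complement the minimal ones are those of the elements outside a
  subspace \<open>T\<close>.
\<close>

lemma dif_difs_filter:
  "a \<in> carrier \<Gamma> \<Longrightarrow> set Y \<subseteq> carrier \<Gamma> \<Longrightarrow> dif a (difs (filter P Y) f) = difs (filter P Y) (dif a f)"
  by (rule dif_difs) auto

definition rel_DM :: "'v set \<Rightarrow> 'g set \<Rightarrow> 'g list \<Rightarrow> ('g \<Rightarrow> int) set" where
  "rel_DM U L X = {f \<in> Cfun \<Gamma>. (\<forall>b\<in>L. dif b f = (\<lambda>_. 0)) \<and>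
     (\<forall>T. subspace T \<longrightarrow> bar ` L \<subseteq> T \<longrightarrow> \<not> U \<subseteq> T \<longrightarrow>
        difs (filter (\<lambda>x. bar x \<notin> T) X) f = (\<lambda>_. 0)) \<and>
     (\<exists>F. finite F \<and> (\<forall>x. f x \<noteq> 0 \<longrightarrow> (\<exists>v\<in>F. bar x - v \<in> U)))}"

lemma rel_DM_Cfun: "f \<in> rel_DM U L X \<Longrightarrow> f \<in> Cfun \<Gamma>"
  by (simp add: rel_DM_def)

lemma rel_DM_outside:
  "f \<in> rel_DM U L X \<Longrightarrow> subspace T \<Longrightarrow> bar ` L \<subseteq> T \<Longrightarrow> \<not> U \<subseteq> T \<Longrightarrow>
    difs (filter (\<lambda>x. bar x \<notin> T) X) f = (\<lambda>_. 0)"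
  unfolding rel_DM_def mem_Collect_eq by (elim conjE allE[of _ T] impE)

lemma rel_DM_cosets:
  assumes "f \<in> rel_DM U L X"
  obtains F where "finite F" "\<And>x. f x \<noteq> 0 \<Longrightarrow> \<exists>v\<in>F. bar x - v \<in> U"
  using assms unfolding rel_DM_def mem_Collect_eq by (elim conjE exE) simp

lemma fin_cosets_comb:
  assumes "finite F" "\<And>x. f x \<noteq> 0 \<Longrightarrow> \<exists>v\<in>F. bar x - v \<in> U"
    and "finite F'" "\<And>x. f' x \<noteq> 0 \<Longrightarrow> \<exists>v\<in>F'. bar x - v \<in> U"
    and "\<And>x. f x = 0 \<Longrightarrow> f' x = 0 \<Longrightarrow> h x = (0::int)"
  shows "\<exists>F. finite F \<and> (\<forall>x. h x \<noteq> 0 \<longrightarrow> (\<exists>v\<in>F. bar x - v \<in> U))"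
  by (rule exI[of _ "F \<union> F'"]) (use assms in blast)

lemma rel_DM_zero: "(\<lambda>_. 0) \<in> rel_DM U L X"
  by (auto simp: rel_DM_def Cfun_zero)

lemma rel_DM_add: "f \<in> rel_DM U L X \<Longrightarrow> g \<in> rel_DM U L X \<Longrightarrow> (\<lambda>x. f x + g x) \<in> rel_DM U L X"
  unfolding rel_DM_def mem_Collect_eq
  apply (intro conjI)
  subgoal by (auto intro: Cfun_add)
  subgoal by (simp add: dif_add)
  subgoal by (simp add: difs_add)
  subgoal by (elim conjE exE, rule fin_cosets_comb[of _ f U _ g], blast+) simp
  done

lemma rel_DM_diff: "f \<in> rel_DM U L X \<Longrightarrow> g \<in> rel_DM U L X \<Longrightarrow> (\<lambda>x. f x - g x) \<in> rel_DM U L X"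
  unfolding rel_DM_def mem_Collect_eq
  apply (intro conjI)
  subgoal by (auto intro: Cfun_diff)
  subgoal by (simp add: dif_diff)
  subgoal by (simp add: difs_diff)
  subgoal by (elim conjE exE, rule fin_cosets_comb[of _ f U _ g], blast+) simp
  done

text \<open>The kernel of \<open>nabla\<close> by \<open>a\<close>, read as the space for the
  quotient. For a function with period \<open>a\<close>, the condition for a \<open>T\<close>
  without \<open>bar a\<close> holds automatically, as its operator contains the factor of
  \<open>a\<close>; for a \<open>T\<close> with \<open>bar a\<close> the two lists give the same
  operator.\<close>

lemma rel_DM_periodic:
  assumes "a \<in> carrier \<Gamma>" "set Z \<subseteq> carrier \<Gamma>"
  shows "f \<in> rel_DM U L (a # Z) \<and> dif a f = (\<lambda>_. 0) \<longleftrightarrow> f \<in> rel_DM U (insert a L) Z"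
proof -
  have *: "difs (filter (\<lambda>x. bar x \<notin> T) (a # Z)) f = (\<lambda>_. 0) \<longleftrightarrow>
      bar a \<notin> T \<or> difs (filter (\<lambda>x. bar x \<notin> T) Z) f = (\<lambda>_. 0)" if "dif a f = (\<lambda>_. 0)" for T
    using that dif_difs_filter[OF assms, of _ f] by auto
  show ?thesis
  proof (cases "dif a f = (\<lambda>_. 0)")
    case True
    then show ?thesis unfolding rel_DM_def mem_Collect_eq *[OF True] by auto
  qed (auto simp: rel_DM_def)
qed

text \<open>Every admissible \<open>T\<close> contains the image of \<open>L\<close> and hence
  \<open>bar a\<close>, so \<open>a\<close> never occurs in the filtered list.\<close>

lemma rel_DM_drop:
  assumes "set Z \<subseteq> carrier \<Gamma>" "subspace U" "bar a \<in> span (bar ` L)"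
  shows "rel_DM U L (a # Z) = rel_DM U L Z"
proof -
  have "bar a \<in> T" if "subspace T" "bar ` L \<subseteq> T" for T
    using assms(3) span_minimal[OF that(2,1)] by auto
  then show ?thesis unfolding rel_DM_def by auto
qed

lemma tr_cosets:
  assumes U: "subspace U" and a: "a \<in> carrier \<Gamma>"
    and F: "finite F" "\<And>x. f x \<noteq> 0 \<Longrightarrow> \<exists>v\<in>F. bar x - v \<in> U"
  shows "\<exists>F. finite F \<and> (\<forall>x. tr a f x \<noteq> 0 \<longrightarrow> (\<exists>v\<in>F. bar x - v \<in> U))"
proof (intro exI[of _ "(\<lambda>v. v + bar a) ` F"] conjI allI impI)
  fix x assume x: "tr a f x \<noteq> 0"
  then have xc: "x \<in> carrier \<Gamma>" "f (x \<otimes> inv a) \<noteq> 0" by (auto simp: translate_def split: if_splits)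
  then obtain v where "v \<in> F" "bar (x \<otimes> inv a) - v \<in> U" using F by blast
  then show "\<exists>v\<in>(\<lambda>v. v + bar a) ` F. bar x - v \<in> U"
    using xc a by (intro bexI[of _ "v + bar a"]) (auto simp: bar_mult algebra_simps)
qed (use F in simp)

lemma rel_DM_tr:
  assumes U: "subspace U" and a: "a \<in> carrier \<Gamma>" and L: "L \<subseteq> carrier \<Gamma>" and X: "set X \<subseteq> carrier \<Gamma>"
    and f: "f \<in> rel_DM U L X"
  shows "tr a f \<in> rel_DM U L X"
proof -
  have "dif b (tr a f) = tr a (dif b f)" if "b \<in> L" for b
    using tr_dif[of a b f] a L that by auto
  moreover have "difs (filter P X) (tr a f) = tr a (difs (filter P X) f)" for P
    by (rule tr_difs[symmetric, OF a]) (use X in auto)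
  moreover obtain F where "finite F" "\<And>x. f x \<noteq> 0 \<Longrightarrow> \<exists>v\<in>F. bar x - v \<in> U"
    using rel_DM_cosets[OF f] by blast
  note tr_cosets[OF U a this]
  ultimately show ?thesis using f unfolding rel_DM_def by (auto simp: Cfun_tr)
qed

text \<open>If \<open>bar a\<close> lies outside \<open>T\<close>, the operator of the longer list
  is that of the shorter one times \<open>nabla\<close> by \<open>a\<close>. If it lies in
  \<open>T\<close>, both operators agree and commute with \<open>nabla\<close> by
  \<open>a\<close>.\<close>

lemma rel_DM_dif:
  assumes "subspace U" "a \<in> carrier \<Gamma>" "L \<subseteq> carrier \<Gamma>" "set Z \<subseteq> carrier \<Gamma>"
    and f: "f \<in> rel_DM U L (a # Z)"
  shows "dif a f \<in> rel_DM U L Z"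
proof -
  have Y: "difs (filter P Z) (dif a f) = dif a (difs (filter P Z) f)" for P
    using dif_difs_filter[of a Z P f] assms by simp
  have "dif b (dif a f) = dif a (dif b f)" if "b \<in> L" for b
    using dif_commute[of a b f] assms that by auto
  moreover have "difs (filter (\<lambda>x. bar x \<notin> T) Z) (dif a f) = (\<lambda>_. 0)"
    if T: "subspace T" "bar ` L \<subseteq> T" "\<not> U \<subseteq> T" for T
  proof -
    have "difs (filter (\<lambda>x. bar x \<notin> T) (a # Z)) f = (\<lambda>_. 0)"
      by (rule rel_DM_outside[OF f T])
    then show ?thesis unfolding Y by (cases "bar a \<in> T") auto
  qed
  moreover obtain F where F: "finite F" "\<And>x. f x \<noteq> 0 \<Longrightarrow> \<exists>v\<in>F. bar x - v \<in> U"
    using rel_DM_cosets[OF f] by blast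
  obtain F' where F': "finite F'" "\<And>x. tr a f x \<noteq> 0 \<Longrightarrow> \<exists>v\<in>F'. bar x - v \<in> U"
    using tr_cosets[OF assms(1,2) F] by blast
  have "\<exists>F. finite F \<and> (\<forall>x. dif a f x \<noteq> 0 \<longrightarrow> (\<exists>v\<in>F. bar x - v \<in> U))"
    by (rule fin_cosets_comb[OF F F']) (auto simp: nabla_def)
  ultimately show ?thesis using f unfolding rel_DM_def by (auto simp: Cfun_dif)
qed

text \<open>The functional is constant on each coset of \<open>U\<close>, and finitely many cosets
  occur. Used for \<open>l\<close> and for its negative, this bounds a function on both sides of a
  hyperplane.\<close>

lemma rel_DM_bnd:
  assumes f: "f \<in> rel_DM U L X" and l: "linear l" "\<And>u. u \<in> U \<Longrightarrow> l u = 0"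
  shows "bnd l f"
proof -
  obtain F where F: "finite F" "\<And>x. f x \<noteq> 0 \<Longrightarrow> \<exists>v\<in>F. bar x - v \<in> U"
    using rel_DM_cosets[OF f] by blast
  have "Min (l ` F) \<le> l (bar x)" if x: "f x \<noteq> 0" for x
  proof -
    obtain v where v: "v \<in> F" "bar x - v \<in> U" using F(2)[OF x] by blast
    then have "l (bar x) = l v" using l(2)[OF v(2)] l(1) by (simp add: linear_diff)
    then show ?thesis using v F(1) by simp
  qed
  then show ?thesis unfolding bnd_def by blast
qed

text \<open>
  The image of \<open>\<Pi>\<^sub>X\<close> in the relative setting: \<open>h1 - h2\<close> is the convolution of \<open>Q\<^sub>r\<close> with \<open>g\<close>, and
  summands that differ by the choice of the orientation \<open>l\<close> of \<open>r\<close> are all admitted.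
\<close>

inductive_set gen :: "'v set \<Rightarrow> 'g set \<Rightarrow> 'g list \<Rightarrow> ('g \<Rightarrow> int) set" for U L X where
  zero: "(\<lambda>_. 0) \<in> gen U L X"
| add: "f \<in> gen U L X \<Longrightarrow> g \<in> gen U L X \<Longrightarrow> (\<lambda>x. f x + g x) \<in> gen U L X"
| Q: "linear l \<Longrightarrow> r = {v\<in>U. l v = 0} \<Longrightarrow> r \<noteq> U \<Longrightarrow>
    r = span (bar ` (L \<union> {x \<in> set X. l (bar x) = 0})) \<Longrightarrow>
    g \<in> rel_DM r L (filter (\<lambda>x. l (bar x) = 0) X) \<Longrightarrow>
    sol l X g h1 \<Longrightarrow> sol (\<lambda>v. - l v) X g h2 \<Longrightarrow> (\<lambda>x. h1 x - h2 x) \<in> gen U L X"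

text \<open>Each property of \<open>g\<close> says that some operator kills or fixes
  \<open>g\<close>. Applied to the defining equation, the operator yields a solution for 0 or again
  for \<open>g\<close>, and uniqueness moves the property to \<open>h\<close>. The conditions for
  those \<open>T\<close> that contain \<open>r\<close> are not obtained for one half alone.\<close>

lemma sol_rel_DM:
  assumes l: "linear l" and U: "subspace U" and r: "r = {v\<in>U. l v = 0}"
    and L: "L \<subseteq> carrier \<Gamma>" "bar ` L \<subseteq> r" and X: "set X \<subseteq> carrier \<Gamma>" "bar ` set X \<subseteq> U"
    and g: "g \<in> rel_DM r L (filter (\<lambda>x. l (bar x) = 0) X)" and h: "sol l X g h"
  shows "\<And>b. b \<in> L \<Longrightarrow> dif b h = (\<lambda>_. 0)"
    and "\<And>T. subspace T \<Longrightarrow> bar ` L \<subseteq> T \<Longrightarrow> \<not> r \<subseteq> T \<Longrightarrow> difs (filter (\<lambda>x. bar x \<notin> T) X) h = (\<lambda>_. 0)"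
    and "\<exists>F. finite F \<and> (\<forall>x. h x \<noteq> 0 \<longrightarrow> (\<exists>v\<in>F. bar x - v \<in> U))"
proof -
  show "dif b h = (\<lambda>_. 0)" if "b \<in> L" for b
  proof -
    have b: "b \<in> carrier \<Gamma>" using that L by auto
    have "sol l X (dif b g) (dif b h)" by (rule sol_dif[OF l X(1) b h])
    moreover have "dif b g = (\<lambda>_. 0)" using g that by (simp add: rel_DM_def)
    ultimately have "sol l X (\<lambda>_. 0) (dif b h)" by simp
    then show ?thesis by (rule sol_unique[OF l X(1) _ sol_zero])
  qed
  show "difs (filter (\<lambda>x. bar x \<notin> T) X) h = (\<lambda>_. 0)"
    if T: "subspace T" "bar ` L \<subseteq> T" "\<not> r \<subseteq> T" for T
  proof -
    let ?Y = "filter (\<lambda>x. bar x \<notin> T) (filter (\<lambda>x. l (bar x) = 0) X)"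
    have "difs ?Y g = (\<lambda>_. 0)" by (rule rel_DM_outside[OF g T])
    moreover have "sol l X (difs ?Y g) (difs ?Y h)" by (rule sol_difs[OF l X(1) _ h]) (use X in auto)
    ultimately have "sol l X (\<lambda>_. 0) (difs ?Y h)" by simp
    then have "difs ?Y h = (\<lambda>_. 0)" by (rule sol_unique[OF l X(1) _ sol_zero])
    moreover have "mset ?Y \<subseteq># mset (filter (\<lambda>x. bar x \<notin> T) X)"
      unfolding mset_filter by (rule multiset_filter_mono[OF multiset_filter_subset])
    ultimately show ?thesis using difs_eq_0_mono[of ?Y "filter (\<lambda>x. bar x \<notin> T) X" h] X by auto
  qed
  show "\<exists>F. finite F \<and> (\<forall>x. h x \<noteq> 0 \<longrightarrow> (\<exists>v\<in>F. bar x - v \<in> U))"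
  proof -
    obtain F where F: "finite F" "\<And>x. g x \<noteq> 0 \<Longrightarrow> \<exists>v\<in>F. bar x - v \<in> r"
      using rel_DM_cosets[OF g] by blast
    define W where "W = {w. \<exists>v\<in>F. w - v \<in> U}"
    have "restr W g = g" using F r by (auto simp: restr_def W_def fun_eq_iff)
    moreover have "sol l X (restr W g) (restr W h)"
      by (rule sol_restr[OF _ X(1) h]) (use X stable_cosets[OF U] in \<open>auto simp: W_def\<close>)
    ultimately have "sol l X g (restr W h)" by simp
    then have "restr W h = h" by (rule sol_unique[OF l X(1) _ h])
    then have "bar x \<in> W" if "h x \<noteq> 0" for x
      using that by (metis restr_def)
    then have "\<exists>v\<in>F. bar x - v \<in> U" if "h x \<noteq> 0" for x
      using that by (simp add: W_def)
    with F show ?thesis by blast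
  qed
qed

text \<open>If \<open>T\<close> contains \<open>r\<close>, it meets \<open>U\<close> exactly in
  \<open>r\<close>, and the operator is that of \<open>off l X\<close>. It sends both halves to the
  same \<open>g\<close>, so their difference is killed. Otherwise the operator kills each
  half.\<close>

lemma gen_rel_DM:
  assumes U: "subspace U" and L: "L \<subseteq> carrier \<Gamma>" and X: "set X \<subseteq> carrier \<Gamma>" "bar ` set X \<subseteq> U"
    and f: "f \<in> gen U L X"
  shows "f \<in> rel_DM U L X"
  using f
proof induction
  case (Q l r g h1 h2)
  let ?m = "\<lambda>v. - l v"
  have m: "linear ?m" using Q linear_compose_neg by blast
  have Lr: "bar ` L \<subseteq> r" unfolding Q(4) by (auto intro: span_base)
  note s1 = sol_rel_DM[OF Q(1) U Q(2) L Lr X Q(5) Q(6)]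
  have "g \<in> rel_DM r L (filter (\<lambda>x. - l (bar x) = 0) X)" "r = {v\<in>U. - l v = 0}" using Q by auto
  note s2 = sol_rel_DM[OF m U this(2) L Lr X this(1) Q(7)]
  have "difs (filter (\<lambda>x. bar x \<notin> T) X) (\<lambda>x. h1 x - h2 x) = (\<lambda>_. 0)"
    if T: "subspace T" "bar ` L \<subseteq> T" "\<not> U \<subseteq> T" for T
  proof (cases "r \<subseteq> T")
    case True
    have "bar x \<notin> T \<longleftrightarrow> l (bar x) \<noteq> 0" if x: "x \<in> set X" for x
    proof
      show "bar x \<notin> T \<Longrightarrow> l (bar x) \<noteq> 0" using True x X Q(2) by auto
      show "bar x \<notin> T" if lx: "l (bar x) \<noteq> 0"
      proof
        assume xT: "bar x \<in> T"
        have xU: "bar x \<in> U" using x X by auto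
        have "u \<in> T" if u: "u \<in> U" for u
        proof -
          \<comment> \<open>Since \<open>l\<close> is nonzero at \<open>bar x\<close>, the
            hyperplane \<open>r\<close> of \<open>U\<close> together with \<open>bar x\<close> spans
            \<open>U\<close>.\<close>
          have "u - (l u / l (bar x)) *\<^sub>R bar x \<in> r"
            using u xU U lx Q(1,2) by (auto simp: linear_diff linear_scale intro!: subspace_diff subspace_scale)
          then have "u - (l u / l (bar x)) *\<^sub>R bar x + (l u / l (bar x)) *\<^sub>R bar x \<in> T"
            using True xT T by (intro subspace_add subspace_scale) auto
          then show ?thesis by simp
        qed
        with T show False by auto
      qed
    qed
    then have "filter (\<lambda>x. bar x \<notin> T) X = off l X" by (rule filter_cong[OF refl])
    then show ?thesis using Q(6,7) by (simp add: difs_diff sol_def)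
  next
    case False
    then show ?thesis using s1(2) s2(2) T by (simp add: difs_diff)
  qed
  moreover obtain F F' where "finite F" "\<And>x. h1 x \<noteq> 0 \<Longrightarrow> \<exists>v\<in>F. bar x - v \<in> U"
    "finite F'" "\<And>x. h2 x \<noteq> 0 \<Longrightarrow> \<exists>v\<in>F'. bar x - v \<in> U"
    using s1(3) s2(3) by blast
  then have "\<exists>F. finite F \<and> (\<forall>x. h1 x - h2 x \<noteq> 0 \<longrightarrow> (\<exists>v\<in>F. bar x - v \<in> U))"
    by (rule fin_cosets_comb) auto
  moreover have "h1 \<in> Cfun \<Gamma>" "h2 \<in> Cfun \<Gamma>" using Q by (auto simp: sol_def)
  ultimately show ?case using s1(1) s2(1) unfolding rel_DM_def by (auto simp: Cfun_diff dif_diff)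
qed (auto intro: rel_DM_zero rel_DM_add)


subsection \<open>Discreteness\<close>

lemma basis_of_span:
  fixes S :: "'a::real_vector set"
  obtains B where "B \<subseteq> S" "independent B" "span B = span S"
proof -
  obtain B where B: "B \<subseteq> S" "independent B" "S \<subseteq> span B" by (rule maximal_independent_subset)
  then have "span B = span S" by (simp add: span_minimal span_mono subset_antisym)
  with B that show ?thesis by blast
qed

lemma lattice_basis:
  obtains B where "independent B" "span B = UNIV" "finite B" "B \<subseteq> bar ` carrier \<Gamma>"
    "bar ` carrier \<Gamma> = {\<Sum>b\<in>B. real_of_int (c b) *\<^sub>R b | c. True}"
proof -
  obtain B where B: "independent B" "span B = UNIV"
    and lat: "bar ` carrier \<Gamma> = {\<Sum>b\<in>B. real_of_int (c b) *\<^sub>R b | c. True}"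
    using bar_lattice unfolding full_lattice_def by blast
  have finB: "finite B" using B independent_imp_finite by blast
  have "B \<subseteq> bar ` carrier \<Gamma>"
  proof
    fix b assume b: "b \<in> B"
    have "(\<Sum>x\<in>B. real_of_int (if x = b then 1 else 0) *\<^sub>R x) = (\<Sum>x\<in>B. if x = b then x else 0)"
      by (rule sum.cong) auto
    also have "\<dots> = b" using b finB by simp
    finally have "b = (\<Sum>x\<in>B. real_of_int (if x = b then 1 else 0) *\<^sub>R x)" by (rule sym)
    then show "b \<in> bar ` carrier \<Gamma>" unfolding lat mem_Collect_eq
      by (intro exI[of _ "\<lambda>x. if x = b then 1 else 0"]) simp
  qed
  with B lat finB that show thesis by blast
qed

text \<open>Coordinates with respect to a lattice basis are bounded linear functionals with integer
  values on the lattice, so a ball leaves finitely many choices for each.\<close>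

lemma lattice_finite: "finite (bar ` carrier \<Gamma> \<inter> cball 0 R)"
proof -
  obtain B where B: "independent B" and finB: "finite B"
    and lat: "bar ` carrier \<Gamma> = {\<Sum>b\<in>B. real_of_int (c b) *\<^sub>R b | c. True}"
    by (rule lattice_basis)
  have "\<exists>g :: 'v \<Rightarrow> real. linear g \<and> (\<forall>x\<in>B. g x = (if x = b then 1 else 0))" for b
    by (rule linear_independent_extend[OF B])
  then obtain g :: "'v \<Rightarrow> 'v \<Rightarrow> real" where g: "\<And>b. linear (g b)"
    "\<And>b x. x \<in> B \<Longrightarrow> g b x = (if x = b then 1 else 0)" by metis
  have "\<exists>K>0. \<forall>x. norm (g b x) \<le> K * norm x" for b
    by (rule linear_bounded_pos[OF g(1)]) blast
  then obtain K where K: "\<And>b. K b > 0" "\<And>b x. norm (g b x) \<le> K b * norm x" by metis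
  define M where "M b = \<lceil>K b * R\<rceil>" for b
  define S where "S = (\<lambda>c. \<Sum>b\<in>B. real_of_int (c b) *\<^sub>R b) ` (\<Pi>\<^sub>E b\<in>B. {- M b..M b})"
  have "bar ` carrier \<Gamma> \<inter> cball 0 R \<subseteq> S"
  proof
    fix v assume v: "v \<in> bar ` carrier \<Gamma> \<inter> cball 0 R"
    then obtain c where c: "v = (\<Sum>b\<in>B. real_of_int (c b) *\<^sub>R b)" using lat by auto
    have "c b \<in> {- M b..M b}" if b: "b \<in> B" for b
    proof -
      have "g b v = (\<Sum>x\<in>B. if x = b then real_of_int (c x) else 0)"
        unfolding c using g by (auto simp: linear_sum linear_scale intro!: sum.cong)
      also have "\<dots> = c b" using b finB by simp
      finally have "\<bar>real_of_int (c b)\<bar> \<le> K b * norm v" using K(2)[of b v] by simp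
      also have "\<dots> \<le> K b * R" using v K(1)[of b] by (intro mult_left_mono) auto
      finally show ?thesis unfolding M_def by (auto simp: abs_le_iff) linarith+
    qed
    then show "v \<in> S" unfolding S_def c
      by (intro image_eqI[of _ _ "restrict c B"]) (auto intro!: sum.cong)
  qed
  moreover have "finite S" unfolding S_def using finB by (intro finite_imageI finite_PiE) auto
  ultimately show ?thesis using finite_subset by blast
qed

text \<open>
  Modulo \<open>\<Gamma>\<^bsub>r\<^esub>\<close> a slab of \<open>\<Gamma>\<^bsub>U\<^esub>\<close> is bounded, since \<open>r\<close> is spanned by lattice vectors.
\<close>

lemma slab_finite:
  fixes l :: "'v \<Rightarrow> real"
  assumes L: "L \<subseteq> carrier \<Gamma>" and l: "linear l" "l e = 1" "\<And>u. u \<in> span (bar ` L) \<Longrightarrow> l u = 0"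
    and U: "U = span (insert e (bar ` L))" and F: "finite F"
  obtains F' where "finite F'" "\<And>x. x \<in> carrier \<Gamma> \<Longrightarrow> \<exists>v\<in>F. bar x - v \<in> U \<Longrightarrow>
    \<bar>l (bar x)\<bar> \<le> C \<Longrightarrow> \<exists>w\<in>F'. bar x - w \<in> span (bar ` L)"
proof -
  obtain B where B: "B \<subseteq> bar ` L" "independent B" "span B = span (bar ` L)"
    by (rule basis_of_span)
  have finB: "finite B" using B independent_imp_finite by blast
  \<comment> \<open>The bound for a representative \<open>v + k e + ...\<close> of the coset:
    \<open>k\<close> is at most \<open>\<bar>C\<bar> + \<bar>l v\<bar>\<close> in absolute value,
    the fractional coordinates along \<open>B\<close> contribute at most the sum of its norms, and
    the sum over \<open>F\<close> dominates the term of each single \<open>v\<close>.\<close>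
  define R where "R = (\<Sum>v\<in>F. norm v + \<bar>l v\<bar> * norm e) + \<bar>C\<bar> * norm e + (\<Sum>b\<in>B. norm b)"
  show thesis
  proof (rule that)
    show "finite (bar ` carrier \<Gamma> \<inter> cball 0 R)" by (rule lattice_finite)
    fix x assume x: "x \<in> carrier \<Gamma>" "\<exists>v\<in>F. bar x - v \<in> U" "\<bar>l (bar x)\<bar> \<le> C"
    then obtain v where v: "v \<in> F" "bar x - v \<in> U" by blast
    then obtain k where k: "bar x - v - k *\<^sub>R e \<in> span B" unfolding U B(3) span_insert by blast
    then obtain c where c: "bar x - v - k *\<^sub>R e = (\<Sum>b\<in>B. c b *\<^sub>R b)"
      unfolding span_finite[OF finB] by blast
    have bx: "bar x = v + k *\<^sub>R e + (\<Sum>b\<in>B. c b *\<^sub>R b)" unfolding c[symmetric] by simp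
    have "l (bar x - v - k *\<^sub>R e) = 0" using k B l by auto
    then have keq: "k = l (bar x) - l v" using l by (simp add: linear_diff linear_scale)
    \<comment> \<open>Rounding the coordinates down keeps \<open>y\<close> in the image of the
      group, because \<open>B\<close> consists of images of elements of \<open>L\<close>; so
      \<open>bar x - y\<close> is still a lattice point.\<close>
    define y where "y = (\<Sum>b\<in>B. real_of_int \<lfloor>c b\<rfloor> *\<^sub>R b)"
    have "\<exists>z\<in>carrier \<Gamma>. bar z = (\<Sum>b\<in>A. real_of_int \<lfloor>c b\<rfloor> *\<^sub>R b)" if "A \<subseteq> B" for A
      using finite_subset[OF that finB] that
    proof (induction A)
      case empty
      show ?case by (intro bexI[of _ \<one>]) auto
    next
      case (insert b A)
      then obtain z where z: "z \<in> carrier \<Gamma>" "bar z = (\<Sum>b\<in>A. real_of_int \<lfloor>c b\<rfloor> *\<^sub>R b)"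
        by auto
      have "b \<in> bar ` L" using insert B(1) by auto
      then obtain p where p: "p \<in> carrier \<Gamma>" "b = bar p" using L by auto
      show ?case
        by (intro bexI[of _ "p [^] \<lfloor>c b\<rfloor> \<otimes> z"])
          (use insert.hyps z p in \<open>simp_all add: bar_mult bar_int_pow\<close>)
    qed
    then obtain z where z: "z \<in> carrier \<Gamma>" "bar z = y" using y_def by blast
    define w where "w = bar x - y"
    have "w = bar (x \<otimes> inv z)" using x z by (simp add: bar_mult w_def)
    then have "w \<in> bar ` carrier \<Gamma>" using x z by blast
    moreover have "norm w \<le> R"
    proof -
      have "w = v + k *\<^sub>R e + (\<Sum>b\<in>B. (c b - real_of_int \<lfloor>c b\<rfloor>) *\<^sub>R b)"
        unfolding w_def y_def bx by (simp add: scaleR_left_diff_distrib sum_subtractf)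
      then have "norm w \<le> norm (v + k *\<^sub>R e) + norm (\<Sum>b\<in>B. (c b - real_of_int \<lfloor>c b\<rfloor>) *\<^sub>R b)"
        by (simp only: norm_triangle_ineq)
      moreover have "norm (v + k *\<^sub>R e) \<le> norm v + \<bar>k\<bar> * norm e"
        using norm_triangle_ineq[of v "k *\<^sub>R e"] by simp
      moreover have "\<bar>k\<bar> * norm e \<le> (\<bar>C\<bar> + \<bar>l v\<bar>) * norm e"
        using x(3) keq by (intro mult_right_mono) auto
      moreover have "norm (\<Sum>b\<in>B. (c b - real_of_int \<lfloor>c b\<rfloor>) *\<^sub>R b) \<le> (\<Sum>b\<in>B. norm b)"
      proof (rule sum_norm_le)
        fix b
        have "\<bar>c b - real_of_int \<lfloor>c b\<rfloor>\<bar> \<le> 1" by linarith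
        then show "norm ((c b - real_of_int \<lfloor>c b\<rfloor>) *\<^sub>R b) \<le> norm b"
          using mult_right_mono[of _ 1 "norm b"] by simp
      qed
      moreover have "norm v + \<bar>l v\<bar> * norm e \<le> (\<Sum>v\<in>F. norm v + \<bar>l v\<bar> * norm e)"
        by (rule member_le_sum) (use v F in auto)
      ultimately show ?thesis unfolding R_def by (simp add: algebra_simps)
    qed
    moreover have "y \<in> span (bar ` L)"
      unfolding y_def using B by (intro span_sum span_scale) (auto intro: span_base)
    then have "bar x - w \<in> span (bar ` L)" by (simp add: w_def)
    ultimately show "\<exists>w\<in>bar ` carrier \<Gamma> \<inter> cball 0 R. bar x - w \<in> span (bar ` L)" by auto
  qed
qed


subsection \<open>Surjectivity by induction on the list\<close>

text \<open>
  If \<open>U\<close> is one dimension larger than the span of \<open>L\<close>, cut \<open>f\<close> along the only hyperplane: \<open>f\<^sub>+\<close> and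
  \<open>f - f\<^sub>+\<close> are one-sided, so they are recovered from \<open>g = \<nabla> f\<^sub>+ = - \<nabla> (f - f\<^sub>+)\<close>.
\<close>

lemma gen_codim_1:
  assumes L: "L \<subseteq> carrier \<Gamma>" and X: "set X \<subseteq> carrier \<Gamma>" "bar ` set X \<subseteq> U"
    and U: "U = span (insert e (bar ` L))" and e: "e \<notin> span (bar ` L)"
    and f: "f \<in> rel_DM U L X"
  shows "f \<in> gen U L X"
proof -
  let ?r = "span (bar ` L)"
  obtain B where B: "B \<subseteq> bar ` L" "independent B" "span B = ?r"
    by (rule basis_of_span)
  \<comment> \<open>The functional wanted is the coordinate along \<open>e\<close>: it is 1 at
    \<open>e\<close> and vanishes on the span of the periods, which becomes its kernel in
    \<open>U\<close>.\<close>
  have "independent (insert e B)" using B e by (simp add: independent_insertI)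
  then obtain l :: "'v \<Rightarrow> real" where
    l: "linear l" and lB: "\<forall>x\<in>insert e B. l x = (if x = e then 1 else 0)"
    using linear_independent_extend[of "insert e B" "\<lambda>x. if x = e then 1 else 0 :: real"] by blast
  have l': "l x = (if x = e then 1 else 0)" if "x \<in> insert e B" for x using lB that by blast
  have le: "l e = 1" using l' by simp
  have eB: "e \<notin> B" using B e span_base by blast
  have lr: "l u = 0" if "u \<in> ?r" for u
  proof (rule linear_eq_0_on_span[OF l, of B])
    show "l x = 0" if "x \<in> B" for x using that l'[of x] eB by auto
  qed (use that B in simp)
  have r: "?r = {v\<in>U. l v = 0}"
  proof
    show "?r \<subseteq> {v\<in>U. l v = 0}" using lr span_mono[of "bar ` L" "insert e (bar ` L)"] U by auto
    show "{v\<in>U. l v = 0} \<subseteq> ?r"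
    proof clarify
      fix v assume v: "v \<in> U" "l v = 0"
      then obtain k where k: "v - k *\<^sub>R e \<in> ?r" unfolding U span_insert by blast
      then have "k = 0" using lr[OF k] v le l by (simp add: linear_diff linear_scale)
      with k show "v \<in> ?r" by simp
    qed
  qed
  have rU: "?r \<noteq> U" using e U by (auto intro: span_base)
  have r2: "?r = span (bar ` (L \<union> {x \<in> set X. l (bar x) = 0}))"
  proof
    show "?r \<subseteq> span (bar ` (L \<union> {x \<in> set X. l (bar x) = 0}))" by (rule span_mono) auto
    show "span (bar ` (L \<union> {x \<in> set X. l (bar x) = 0})) \<subseteq> ?r"
    proof (rule span_minimal)
      have "bar x \<in> ?r" if "x \<in> L" for x using that by (simp add: span_base)
      moreover have "bar x \<in> ?r" if "x \<in> set X" "l (bar x) = 0" for x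
        unfolding r using that X by auto
      ultimately show "bar ` (L \<union> {x \<in> set X. l (bar x) = 0}) \<subseteq> ?r" by blast
    qed simp
  qed
  \<comment> \<open>The boundary goes to the upper piece, and both pieces have the bound 0 along
    their functional.\<close>
  define fp where "fp = (\<lambda>x. if 0 \<le> l (bar x) then f x else 0)"
  define g where "g = difs (off l X) fp"
  let ?m = "\<lambda>v. - l v"
  have m: "linear ?m" using l linear_compose_neg by blast
  have fC: "f \<in> Cfun \<Gamma>" using f by (rule rel_DM_Cfun)
  have fpC: "fp \<in> Cfun \<Gamma>" using fC by (auto simp: fp_def Cfun_def)
  have "filter (\<lambda>x. bar x \<notin> ?r) X = off l X"
    by (rule filter_cong) (use X r in auto)
  moreover have "\<not> U \<subseteq> ?r" using r rU by auto
  ultimately have f0: "difs (off l X) f = (\<lambda>_. 0)"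
    using rel_DM_outside[OF f, of ?r] by (auto intro: span_base)
  \<comment> \<open>The operator of \<open>off l X\<close> kills \<open>f\<close>, so
    \<open>fp\<close> and \<open>fp - f\<close> have the same image \<open>g\<close>. One is bounded
    below and the other above, hence \<open>g\<close> lives in a slab.\<close>
  have s1: "sol l X g fp"
    unfolding sol_def g_def using fpC by (auto simp: bnd_def fp_def intro!: exI[of _ 0])
  have s2: "sol ?m X g (\<lambda>x. fp x - f x)"
    unfolding sol_def g_def using fpC fC f0
    by (auto simp: bnd_def fp_def difs_diff Cfun_diff intro!: exI[of _ 0])
  have b1: "bnd l g" using s1 bnd_difs[OF l, of _ "off l X"] X unfolding sol_def by auto
  have b2: "bnd ?m g" using s2 bnd_difs[OF m, of _ "off l X"] X unfolding sol_def by auto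
  have gC: "g \<in> Cfun \<Gamma>" unfolding g_def using fpC by (rule Cfun_difs)
  obtain F where F: "finite F" "\<And>x. f x \<noteq> 0 \<Longrightarrow> \<exists>v\<in>F. bar x - v \<in> U"
    using rel_DM_cosets[OF f] by blast
  define W where "W = {w. \<exists>v\<in>F. w - v \<in> U}"
  have "subspace U" using U by simp
  then have st: "stable W u" if "u \<in> U" for u unfolding W_def using that by (rule stable_cosets)
  have "restr W fp = fp" using F by (auto simp: restr_def W_def fp_def fun_eq_iff)
  then have "restr W g = g"
    unfolding g_def using restr_difs[of "off l X" W fp] st X by auto
  then have "bar x \<in> W" if "g x \<noteq> 0" for x
    using that by (metis restr_def)
  then have gU: "\<exists>v\<in>F. bar x - v \<in> U" if "g x \<noteq> 0" for x
    using that by (simp add: W_def)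
  obtain C1 where C1: "\<And>x. g x \<noteq> 0 \<Longrightarrow> C1 \<le> l (bar x)" using b1 unfolding bnd_def by blast
  obtain C2 where C2: "\<And>x. g x \<noteq> 0 \<Longrightarrow> C2 \<le> - l (bar x)" using b2 unfolding bnd_def by blast
  obtain F' where F': "finite F'" "\<And>x. x \<in> carrier \<Gamma> \<Longrightarrow> \<exists>v\<in>F. bar x - v \<in> U \<Longrightarrow>
    \<bar>l (bar x)\<bar> \<le> \<bar>C1\<bar> + \<bar>C2\<bar> \<Longrightarrow> \<exists>w\<in>F'. bar x - w \<in> ?r"
    using slab_finite[OF L l le lr U F(1), of "\<bar>C1\<bar> + \<bar>C2\<bar>"] by blast
  have supp: "\<exists>w\<in>F'. bar x - w \<in> ?r" if x: "g x \<noteq> 0" for x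
  proof (rule F'(2))
    show "x \<in> carrier \<Gamma>" using gC x supp_carrier by blast
    show "\<bar>l (bar x)\<bar> \<le> \<bar>C1\<bar> + \<bar>C2\<bar>" using C1[OF x] C2[OF x] by linarith
  qed (rule gU[OF x])
  \<comment> \<open>The periods lie in the kernel of \<open>l\<close>, so the cut respects
    them.\<close>
  have "dif b g = (\<lambda>_. 0)" if b: "b \<in> L" for b
  proof -
    have bc: "b \<in> carrier \<Gamma>" using b L by auto
    have lb: "l (bar b) = 0" using b by (intro lr span_base) auto
    have "dif b f = (\<lambda>_. 0)" using f b by (simp add: rel_DM_def)
    then have "dif b fp = (\<lambda>_. 0)"
      using bc lb l by (auto simp: fun_eq_iff nabla_def translate_def fp_def bar_mult linear_diff)
    then show ?thesis unfolding g_def using dif_difs_filter[OF bc X(1)] by simp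
  qed
  \<comment> \<open>Every admissible \<open>T\<close> contains all of \<open>?r\<close>, so no
    vanishing condition is left for \<open>g\<close>.\<close>
  moreover have "?r \<subseteq> T" if "subspace T" "bar ` L \<subseteq> T" for T
    using span_minimal that by blast
  ultimately have "g \<in> rel_DM ?r L (filter (\<lambda>x. l (bar x) = 0) X)"
    unfolding rel_DM_def using gC F'(1) supp by blast
  from gen.Q[OF l r rU r2 this s1 s2] show ?thesis by simp
qed

text \<open>Each hyperplane \<open>r\<close> that occurs contains the image of \<open>L\<close>,
  hence \<open>bar a\<close>. So \<open>a\<close> changes neither the lists \<open>off l Z\<close>,
  nor the span, nor the space of admissible \<open>g\<close>.\<close>

lemma gen_Cons_span:
  assumes a: "bar a \<in> span (bar ` L)" and Z: "set Z \<subseteq> carrier \<Gamma>" and U: "subspace U"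
    and f: "f \<in> gen U L Z"
  shows "f \<in> gen U L (a # Z)"
  using f
proof induction
  case (Q l r g h1 h2)
  have sr: "subspace r" using Q(4) by simp
  have "bar ` L \<subseteq> r" unfolding Q(4) by (auto intro: span_base)
  then have ar: "bar a \<in> r" using a span_minimal[OF _ sr] by auto
  then have la: "l (bar a) = 0" using Q(2) by auto
  have "bar ` (L \<union> {x \<in> set (a # Z). l (bar x) = 0}) = insert (bar a) (bar ` (L \<union> {x \<in> set Z. l (bar x) = 0}))"
    using la by auto
  then have r: "r = span (bar ` (L \<union> {x \<in> set (a # Z). l (bar x) = 0}))"
    using ar span_redundant[of "bar a" "bar ` (L \<union> {x \<in> set Z. l (bar x) = 0})"] unfolding Q(4)[symmetric]
    by (simp only:)
  have "rel_DM r L (a # filter (\<lambda>x. l (bar x) = 0) Z) = rel_DM r L (filter (\<lambda>x. l (bar x) = 0) Z)"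
    by (rule rel_DM_drop[OF _ sr a]) (use Z in auto)
  then have "g \<in> rel_DM r L (filter (\<lambda>x. l (bar x) = 0) (a # Z))" using Q(5) la by simp
  from gen.Q[OF Q(1,2,3) r this] show ?case using Q(6,7) la by (simp add: sol_Cons_on)
qed (auto intro: gen.intros)

text \<open>Reads a period back as a list element: the hyperplanes of the quotient are those
  containing \<open>bar a\<close>, and by \<open>rel_DM_periodic\<close> an admissible
  \<open>g\<close> for the quotient is admissible for the list with \<open>a\<close>.\<close>

lemma gen_insert_period:
  assumes a: "a \<in> carrier \<Gamma>" and Z: "set Z \<subseteq> carrier \<Gamma>" and f: "f \<in> gen U (insert a L) Z"
  shows "f \<in> gen U L (a # Z)"
  using f
proof induction
  case (Q l r g h1 h2)
  have "bar a \<in> r" unfolding Q(4) by (auto intro: span_base)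
  then have la: "l (bar a) = 0" using Q(2) by auto
  have "insert a L \<union> {x \<in> set Z. l (bar x) = 0} = L \<union> {x \<in> set (a # Z). l (bar x) = 0}"
    using la by auto
  then have r: "r = span (bar ` (L \<union> {x \<in> set (a # Z). l (bar x) = 0}))" using Q(4) by simp
  have "g \<in> rel_DM r L (a # filter (\<lambda>x. l (bar x) = 0) Z)"
    using rel_DM_periodic[OF a, of "filter (\<lambda>x. l (bar x) = 0) Z" g r L] Q(5) Z by auto
  with Q show ?case by (intro gen.Q[OF Q(1,2,3) r]) (use la in \<open>auto simp: sol_Cons_on\<close>)
qed (auto intro: gen.intros)

text \<open>Part 2 in relative form. That \<open>U\<close> is not inside the span of the periods
  says that the quotient has positive rank, the analogue of \<open>V\<close> being nonzero.
  Quantifying over \<open>U\<close> and \<open>L\<close> here lets the induction hypothesis cover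
  hyperplanes and quotients.\<close>

definition splits :: "'g list \<Rightarrow> bool" where
  "splits X \<longleftrightarrow> (\<forall>U L f. subspace U \<longrightarrow> L \<subseteq> carrier \<Gamma> \<longrightarrow> bar ` L \<subseteq> U \<longrightarrow> bar ` set X \<subseteq> U \<longrightarrow>
     \<not> U \<subseteq> span (bar ` L) \<longrightarrow> f \<in> rel_DM U L X \<longrightarrow> f \<in> gen U L X)"

text \<open>Surjectivity of \<open>nabla\<close> by \<open>a\<close> in relative form; the condition
  on \<open>bar a\<close> says that \<open>a\<close> has infinite order modulo the periods. The
  preimage is asked for in \<open>gen\<close> because the decomposition for the longer list uses it
  as a summand.\<close>

definition lifts :: "'g \<Rightarrow> 'g list \<Rightarrow> bool" where
  "lifts a Z \<longleftrightarrow> (\<forall>U L f. subspace U \<longrightarrow> L \<subseteq> carrier \<Gamma> \<longrightarrow> bar ` L \<subseteq> U \<longrightarrow> bar ` set Z \<subseteq> U \<longrightarrow>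
     bar a \<in> U \<longrightarrow> bar a \<notin> span (bar ` L) \<longrightarrow> f \<in> rel_DM U L Z \<longrightarrow>
     (\<exists>f'\<in>gen U L (a # Z). dif a f' = f))"

lemma splitsD:
  "splits X \<Longrightarrow> subspace U \<Longrightarrow> L \<subseteq> carrier \<Gamma> \<Longrightarrow> bar ` L \<subseteq> U \<Longrightarrow> bar ` set X \<subseteq> U \<Longrightarrow>
     \<not> U \<subseteq> span (bar ` L) \<Longrightarrow> f \<in> rel_DM U L X \<Longrightarrow> f \<in> gen U L X"
  unfolding splits_def by (elim allE impE)

lemma liftsD:
  "lifts a Z \<Longrightarrow> subspace U \<Longrightarrow> L \<subseteq> carrier \<Gamma> \<Longrightarrow> bar ` L \<subseteq> U \<Longrightarrow> bar ` set Z \<subseteq> U \<Longrightarrow>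
     bar a \<in> U \<Longrightarrow> bar a \<notin> span (bar ` L) \<Longrightarrow> f \<in> rel_DM U L Z \<Longrightarrow>
     \<exists>f'\<in>gen U L (a # Z). dif a f' = f"
  unfolding lifts_def by (elim allE impE)

lemma gen_lift:
  assumes a: "a \<in> carrier \<Gamma>" "bar a \<notin> span (bar ` L)" and Z: "set Z \<subseteq> carrier \<Gamma>"
    and U: "subspace U" "bar a \<in> U" "bar ` set Z \<subseteq> U" and L: "L \<subseteq> carrier \<Gamma>"
    and IH: "\<And>Z'. set Z' \<subseteq> carrier \<Gamma> \<Longrightarrow> length Z' < length Z \<Longrightarrow> lifts a Z'"
    and f: "f \<in> gen U L Z"
  shows "\<exists>f'\<in>gen U L (a # Z). dif a f' = f"
  using f
proof induction
  case zero
  show ?case using gen.zero by (intro bexI[of _ "\<lambda>_. 0"]) auto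
next
  case (add f g)
  then obtain f' g' where "f' \<in> gen U L (a # Z)" "dif a f' = f" "g' \<in> gen U L (a # Z)" "dif a g' = g"
    by blast
  then show ?case by (intro bexI[of _ "\<lambda>x. f' x + g' x"]) (auto simp: dif_add intro: gen.add)
next
  case (Q l r g h1 h2)
  let ?m = "\<lambda>v. - l v"
  let ?Z = "filter (\<lambda>x. l (bar x) = 0) Z"
  have m: "linear ?m" using Q(1) linear_compose_neg by blast
  have aZ: "set (a # Z) \<subseteq> carrier \<Gamma>" using a Z by simp
  have Lr: "bar ` L \<subseteq> r" unfolding Q(4) by (auto intro: span_base)
  have sr: "subspace r" using Q(4) by simp
  show ?case
  proof (cases "l (bar a) = 0")
    case False
    have gC: "g \<in> Cfun \<Gamma>" using Q(5) by (rule rel_DM_Cfun)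
    have gb: "bnd l g" "bnd ?m g" using rel_DM_bnd[OF Q(5)] Q(1,2) m by auto
    obtain k1 where k1: "sol l (a # Z) g k1" using sol_exists[OF Q(1) aZ gC gb(1)] by blast
    obtain k2 where k2: "sol ?m (a # Z) g k2" using sol_exists[OF m aZ gC gb(2)] by blast
    have "dif a k1 = h1"
      by (rule sol_unique[OF Q(1) Z sol_Cons_off Q(6)]) (use False Q(1) a Z k1 in auto)
    moreover have "dif a k2 = h2"
      by (rule sol_unique[OF m Z sol_Cons_off Q(7)]) (use False m a Z k2 in auto)
    moreover have "(\<lambda>x. k1 x - k2 x) \<in> gen U L (a # Z)"
      by (rule gen.Q[OF Q(1,2,3) _ _ k1 k2]) (use False Q(4,5) in \<open>auto simp: conj_disj_distribR
        intro!: arg_cong[of _ _ span] arg_cong[of _ _ "image bar"]\<close>)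
    ultimately show ?thesis by (intro bexI[of _ "\<lambda>x. k1 x - k2 x"]) (auto simp: dif_diff)
  next
    case la: True
    then have ar: "bar a \<in> r" using U Q(2) by simp
    show ?thesis
    \<comment> \<open>If all of \<open>Z\<close> lies over the kernel of \<open>l\<close>,
      restricting to the kernel does not shorten the list. But then both halves equal
      \<open>g\<close>, and the summand is zero.\<close>
    proof (cases "off l Z = []")
      case True
      then have "h1 = g" "h2 = g" using Q(6,7) by (auto simp: sol_def simp del: filter_empty_conv)
      then show ?thesis using gen.zero by (intro bexI[of _ "\<lambda>_. 0"]) auto
    next
      case False
      then have "length ?Z < length Z"
        using length_filter_less[of _ Z "\<lambda>x. l (bar x) = 0"] by (auto simp: filter_empty_conv)
      then have "lifts a ?Z" by (intro IH) (use Z in auto)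
      moreover have Zr: "bar ` set ?Z \<subseteq> r" using U Q(2) by auto
      ultimately obtain g' where g': "g' \<in> gen r L (a # ?Z)" "dif a g' = g"
        using liftsD[OF _ sr L Lr _ ar a(2) Q(5)] by blast
      have gr: "g' \<in> rel_DM r L (a # ?Z)"
        by (rule gen_rel_DM[OF sr L _ _ g'(1)]) (use a Z Zr ar in auto)
      have gC: "g' \<in> Cfun \<Gamma>" using gr by (rule rel_DM_Cfun)
      have gb: "bnd l g'" "bnd ?m g'" using rel_DM_bnd[OF gr] Q(1,2) m by auto
      obtain k1 where k1: "sol l (a # Z) g' k1" using sol_exists[OF Q(1) aZ gC gb(1)] by blast
      obtain k2 where k2: "sol ?m (a # Z) g' k2" using sol_exists[OF m aZ gC gb(2)] by blast
      have "sol l Z g (dif a k1)" "sol ?m Z g (dif a k2)"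
        using sol_dif[OF Q(1) Z a(1), of g' k1] sol_dif[OF m Z a(1), of g' k2] k1 k2 g'(2) la
        by (auto simp: sol_Cons_on)
      then have "dif a k1 = h1" "dif a k2 = h2"
        using sol_unique[OF Q(1) Z _ Q(6)] sol_unique[OF m Z _ Q(7)] by auto
      moreover have "bar ` (L \<union> {x \<in> set (a # Z). l (bar x) = 0}) =
          insert (bar a) (bar ` (L \<union> {x \<in> set Z. l (bar x) = 0}))" using la by auto
      then have r: "r = span (bar ` (L \<union> {x \<in> set (a # Z). l (bar x) = 0}))"
        using ar span_redundant[of "bar a" "bar ` (L \<union> {x \<in> set Z. l (bar x) = 0})"] unfolding Q(4)[symmetric]
        by (simp only:)
      have "(\<lambda>x. k1 x - k2 x) \<in> gen U L (a # Z)"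
        by (rule gen.Q[OF Q(1,2,3) r _ k1 k2]) (use la gr in auto)
      ultimately show ?thesis by (intro bexI[of _ "\<lambda>x. k1 x - k2 x"]) (auto simp: dif_diff)
    qed
  qed
qed

lemma lifts_of_splits:
  assumes a: "a \<in> carrier \<Gamma>" and Z: "set Z \<subseteq> carrier \<Gamma>" and s: "splits Z"
    and IH: "\<And>Z'. set Z' \<subseteq> carrier \<Gamma> \<Longrightarrow> length Z' < length Z \<Longrightarrow> lifts a Z'"
  shows "lifts a Z"
  unfolding lifts_def
proof (intro allI impI)
  fix U L f
  assume *: "subspace U" "L \<subseteq> carrier \<Gamma>" "bar ` L \<subseteq> U" "bar ` set Z \<subseteq> U"
     "bar a \<in> U" "bar a \<notin> span (bar ` L)" "f \<in> rel_DM U L Z"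
  have "\<not> U \<subseteq> span (bar ` L)" using * by blast
  then have "f \<in> gen U L Z" using * by (intro splitsD[OF s])
  then show "\<exists>f'\<in>gen U L (a # Z). dif a f' = f"
    using gen_lift[OF a *(6) Z *(1,5,4,2) IH] by blast
qed

text \<open>The span of the periods is an admissible \<open>T\<close>, and its condition for the
  empty list is that \<open>f\<close> itself vanishes.\<close>

lemma splits_Nil: "splits []"
  unfolding splits_def
proof (intro allI impI)
  fix U L f
  assume *: "\<not> U \<subseteq> span (bar ` L)" "f \<in> rel_DM U L []"
  have "f = (\<lambda>_. 0)" using rel_DM_outside[OF *(2), of "span (bar ` L)"] *(1) by (auto intro: span_base)
  then show "f \<in> gen U L []" by (simp add: gen.zero)
qed

lemma splits_Cons:
  assumes a: "a \<in> carrier \<Gamma>" and Z: "set Z \<subseteq> carrier \<Gamma>" and s: "splits Z" and li: "lifts a Z"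
  shows "splits (a # Z)"
  unfolding splits_def
proof (intro allI impI)
  fix U L f
  assume U: "subspace U" and L: "L \<subseteq> carrier \<Gamma>" "bar ` L \<subseteq> U" and aZ: "bar ` set (a # Z) \<subseteq> U"
    and ne: "\<not> U \<subseteq> span (bar ` L)" and f: "f \<in> rel_DM U L (a # Z)"
  show "f \<in> gen U L (a # Z)"
  proof (cases "bar a \<in> span (bar ` L)")
    case True
    then have "f \<in> rel_DM U L Z" using f rel_DM_drop[OF Z U True] by simp
    then have "f \<in> gen U L Z" by (intro splitsD[OF s U L _ ne]) (use aZ in auto)
    then show ?thesis by (rule gen_Cons_span[OF True Z U])
  next
    case aL: False
    show ?thesis
    proof (cases "U \<subseteq> span (bar ` insert a L)")
      case True
      have "span (bar ` insert a L) \<subseteq> U" by (rule span_minimal) (use U L aZ in auto)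
      with True have "U = span (insert (bar a) (bar ` L))" by auto
      then show ?thesis by (intro gen_codim_1[OF L(1) _ aZ _ aL f]) (use a Z in auto)
    next
      case False
      have df: "dif a f \<in> rel_DM U L Z" by (rule rel_DM_dif[OF U a L(1) Z f])
      have "bar ` set Z \<subseteq> U" "bar a \<in> U" using aZ by auto
      from liftsD[OF li U L this aL df] obtain f' where
        f': "f' \<in> gen U L (a # Z)" "dif a f' = dif a f" by blast
      have "f' \<in> rel_DM U L (a # Z)" by (rule gen_rel_DM[OF U L(1) _ aZ f'(1)]) (use a Z in auto)
      then have "(\<lambda>x. f x - f' x) \<in> rel_DM U L (a # Z)" using f by (intro rel_DM_diff)
      then have "(\<lambda>x. f x - f' x) \<in> rel_DM U (insert a L) Z"
        using f'(2) by (auto simp: rel_DM_periodic[OF a Z, symmetric] dif_diff)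
      then have "(\<lambda>x. f x - f' x) \<in> gen U (insert a L) Z"
        by (intro splitsD[OF s U _ _ _ False]) (use L aZ a in auto)
      then have "(\<lambda>x. f x - f' x) \<in> gen U L (a # Z)" by (rule gen_insert_period[OF a Z])
      from gen.add[OF this f'(1)] show ?thesis by simp
    qed
  qed
qed

text \<open>For each list, \<open>splits\<close> comes first and \<open>lifts\<close> follows from
  it. The induction is over all shorter lists because lifting recurses into the sublist over a
  hyperplane, which need not be the tail.\<close>

lemma splits_and_lifts:
  assumes "set X \<subseteq> carrier \<Gamma>"
  shows "splits X \<and> (\<forall>a\<in>carrier \<Gamma>. lifts a X)"
  using assms
proof (induction X rule: length_induct)
  case (1 X)
  then have X: "set X \<subseteq> carrier \<Gamma>" by simp
  have IH: "splits Z \<and> (\<forall>a\<in>carrier \<Gamma>. lifts a Z)"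
    if "set Z \<subseteq> carrier \<Gamma>" "length Z < length X" for Z
    using 1 that by blast
  have s: "splits X"
  proof (cases X)
    case Nil
    then show ?thesis by (simp add: splits_Nil)
  next
    case (Cons a Z)
    then show ?thesis using X IH[of Z] splits_Cons[of a Z] by auto
  qed
  have "lifts a X" if a: "a \<in> carrier \<Gamma>" for a
    by (rule lifts_of_splits[OF a X s]) (use IH a in blast)
  with s show ?case by blast
qed


subsection \<open>Identification of \<open>DM\<close> and \<open>DM\<^sup>(\<^sup>G\<^sup>)\<close>\<close>

lemma subgroup_over_UNIV: "subgroup_over \<Gamma> bar UNIV = \<Gamma>"
  by (simp add: subgroup_over_def)

lemma subgroup_over:
  assumes "subspace U"
  shows "subgroup {\<gamma> \<in> carrier \<Gamma>. bar \<gamma> \<in> U} \<Gamma>"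
  by (rule subgroupI)
    (use assms in \<open>auto simp: bar_mult subspace_0 intro: subspace_neg subspace_add exI[of _ \<one>]\<close>)

text \<open>Extension by 0 is compatible with \<open>nabla\<close>: from a point outside the
  subgroup, subtracting \<open>b\<close> does not lead into it.\<close>

lemma nabla_subgroup_over:
  assumes U: "subspace U" and K: "K = subgroup_over \<Gamma> bar U" and b: "b \<in> carrier K" and f: "f \<in> Cfun K"
  shows "nabla K b f = dif b f" "nabla K b f \<in> Cfun K"
proof -
  have bc: "b \<in> carrier \<Gamma>" "bar b \<in> U" using b K by (auto simp: subgroup_over_def)
  have inv: "inv\<^bsub>K\<^esub> b = inv b"
    using m_inv_consistent[OF subgroup_over[OF U], of b] bc by (simp add: K subgroup_over_def)
  have fK: "f x = 0" if "\<not> (x \<in> carrier \<Gamma> \<and> bar x \<in> U)" for x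
    using f that by (auto simp: Cfun_def K subgroup_over_def)
  have "f (x \<otimes> inv b) = 0" if "x \<in> carrier \<Gamma>" "bar x \<notin> U" for x
  proof (rule fK)
    have "bar x - bar b \<in> U \<Longrightarrow> bar x \<in> U" using subspace_add[OF U, of "bar x - bar b" "bar b"] bc by simp
    then show "\<not> (x \<otimes> inv b \<in> carrier \<Gamma> \<and> bar (x \<otimes> inv b) \<in> U)"
      using that bc by (auto simp: bar_mult)
  qed
  then show "nabla K b f = dif b f"
    by (auto simp: nabla_def translate_def fun_eq_iff inv) (auto simp: K subgroup_over_def)
  show "nabla K b f \<in> Cfun K"
    using f by (auto simp: Cfun_def nabla_def translate_def)
qed

lemma nabla_list_subgroup_over:
  assumes "subspace U" "K = subgroup_over \<Gamma> bar U" "f \<in> Cfun K" "set Y \<subseteq> carrier K"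
  shows "nabla_list K Y f = difs Y f"
proof -
  have "nabla_list K Y f = difs Y f \<and> nabla_list K Y f \<in> Cfun K"
    using assms(4)
  proof (induction Y)
    case (Cons b Y)
    then have "b \<in> carrier K" "nabla_list K Y f \<in> Cfun K" by auto
    note nabla_subgroup_over[OF assms(1,2) this]
    with Cons show ?case by auto
  qed (use assms in auto)
  then show ?thesis by simp
qed

text \<open>A subspace \<open>T\<close> gives the sublist of elements outside it. Conversely, a
  sublist with non-spanning complement contains all elements outside the span of that complement,
  and vanishing passes to the longer list.\<close>

lemma DM_eq_rel_DM:
  assumes U: "subspace U" and X: "set X \<subseteq> carrier \<Gamma>" "bar ` set X \<subseteq> U"
  shows "DM (subgroup_over \<Gamma> bar U) (spans_in bar U) X = {f \<in> rel_DM U {} X. \<forall>x. f x \<noteq> 0 \<longrightarrow> bar x \<in> U}"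
proof -
  define K where "K = subgroup_over \<Gamma> bar U"
  have CK: "f \<in> Cfun K \<longleftrightarrow> f \<in> Cfun \<Gamma> \<and> (\<forall>x. f x \<noteq> 0 \<longrightarrow> bar x \<in> U)" for f
    by (auto simp: Cfun_def K_def subgroup_over_def)
  have XK: "set X \<subseteq> carrier K" using X by (auto simp: K_def subgroup_over_def)
  have Y_K: "set Y \<subseteq> carrier K" if "mset Y \<subseteq># mset X" for Y
    using set_mset_mono[OF that] XK by auto
  have 1: "(\<forall>Y. mset Y \<subseteq># mset X \<and> \<not> spans_in bar U (set_mset (mset X - mset Y)) \<longrightarrow> difs Y f = (\<lambda>_. 0)) \<longleftrightarrow>
    (\<forall>T. subspace T \<longrightarrow> \<not> U \<subseteq> T \<longrightarrow> difs (filter (\<lambda>x. bar x \<notin> T) X) f = (\<lambda>_. 0))" (is "?A \<longleftrightarrow> ?B") for f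
  proof
    assume A: ?A
    show ?B
    proof (intro allI impI)
      fix T :: "'v set" assume T: "subspace T" "\<not> U \<subseteq> T"
      let ?Y = "filter (\<lambda>x. bar x \<notin> T) X"
      have rest: "mset X - mset ?Y = filter_mset (\<lambda>x. \<not> bar x \<notin> T) (mset X)"
        by (rule multiset_eqI) (simp add: mset_filter)
      have "span (bar ` set_mset (mset X - mset ?Y)) \<subseteq> T"
        unfolding rest by (rule span_minimal) (use T in auto)
      then have "\<not> spans_in bar U (set_mset (mset X - mset ?Y))" using T by (auto simp: spans_in_def)
      moreover have "mset ?Y \<subseteq># mset X" by (simp add: mset_filter)
      ultimately show "difs ?Y f = (\<lambda>_. 0)" using A by blast
    qed
  next
    assume B: ?B
    show ?A
    proof (intro allI impI, elim conjE)
      fix Y assume Y: "mset Y \<subseteq># mset X" "\<not> spans_in bar U (set_mset (mset X - mset Y))"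
      define T where "T = span (bar ` set_mset (mset X - mset Y))"
      have "set_mset (mset X - mset Y) \<subseteq> set X" by (auto dest: in_diffD)
      then have "T \<subseteq> U" unfolding T_def using X U by (intro span_minimal) auto
      then have T: "subspace T" "\<not> U \<subseteq> T" using Y(2) by (auto simp: T_def spans_in_def)
      have "mset (filter (\<lambda>x. bar x \<notin> T) X) \<subseteq># mset Y"
      proof (rule mset_subset_eqI)
        fix x
        \<comment> \<open>Repetitions count: an element outside \<open>T\<close> has no copy left in
          the complement, so all its copies are in \<open>Y\<close>.\<close>
        have "count (mset X) x \<le> count (mset Y) x" if "bar x \<notin> T"
        proof -
          have "x \<notin># mset X - mset Y" using that unfolding T_def by (auto intro: span_base)
          then show ?thesis by (simp add: not_in_iff)
        qed
        then show "count (mset (filter (\<lambda>x. bar x \<notin> T) X)) x \<le> count (mset Y) x"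
          by (simp add: mset_filter)
      qed
      moreover have "set Y \<subseteq> carrier \<Gamma>" using set_mset_mono[OF Y(1)] X by auto
      moreover have "difs (filter (\<lambda>x. bar x \<notin> T) X) f = (\<lambda>_. 0)" using B T by blast
      ultimately show "difs Y f = (\<lambda>_. 0)" by (rule difs_eq_0_mono)
    qed
  qed
  have "f \<in> DM K (spans_in bar U) X \<longleftrightarrow> f \<in> rel_DM U {} X" if f: "f \<in> Cfun K" for f
  proof -
    have "f \<in> DM K (spans_in bar U) X \<longleftrightarrow>
        (\<forall>Y. mset Y \<subseteq># mset X \<and> \<not> spans_in bar U (set_mset (mset X - mset Y)) \<longrightarrow> nabla_list K Y f = (\<lambda>_. 0))"
      unfolding DM_def mem_Collect_eq using f by blast
    also have "\<dots> \<longleftrightarrow>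
        (\<forall>Y. mset Y \<subseteq># mset X \<and> \<not> spans_in bar U (set_mset (mset X - mset Y)) \<longrightarrow> difs Y f = (\<lambda>_. 0))"
      by (intro all_cong) (simp add: nabla_list_subgroup_over[OF U K_def f] Y_K)
    also note 1
    also have "(\<forall>T. subspace T \<longrightarrow> \<not> U \<subseteq> T \<longrightarrow> difs (filter (\<lambda>x. bar x \<notin> T) X) f = (\<lambda>_. 0)) \<longleftrightarrow>
        f \<in> rel_DM U {} X"
    proof -
      have "\<exists>F. finite F \<and> (\<forall>x. f x \<noteq> 0 \<longrightarrow> (\<exists>v\<in>F. bar x - v \<in> U))"
        using f by (intro exI[of _ "{0}"]) (simp add: CK)
      then show ?thesis using f unfolding rel_DM_def CK by simp
    qed
    finally show ?thesis .
  qed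
  moreover have "f \<in> Cfun K" if "f \<in> DM K (spans_in bar U) X" for f
    using that by (simp add: DM_def)
  ultimately show ?thesis unfolding K_def[symmetric] using CK rel_DM_Cfun by blast
qed

lemma DM_eq_rel_DM_UNIV: "set X \<subseteq> carrier \<Gamma> \<Longrightarrow> DM \<Gamma> (spans_in bar UNIV) X = rel_DM UNIV {} X"
  using DM_eq_rel_DM[OF subspace_UNIV, of X] by (simp add: subgroup_over_UNIV)

lemma rel_DM_scale: "f \<in> rel_DM U L X \<Longrightarrow> (\<lambda>x. c * f x) \<in> rel_DM U L X"
  unfolding rel_DM_def by (auto simp: Cfun_scale dif_scale difs_scale)

lemma submodule_rel_DM:
  assumes U: "subspace U" and X: "set X \<subseteq> carrier \<Gamma>"
  shows "submodule_C \<Gamma> (rel_DM U {} X)"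
proof -
  have "ring_act \<Gamma> c f \<in> rel_DM U {} X" if c: "c \<in> group_ring \<Gamma>" and f: "f \<in> rel_DM U {} X" for c f
  proof -
    have "(\<lambda>x. \<Sum>\<gamma>\<in>S. c \<gamma> * tr \<gamma> f x) \<in> rel_DM U {} X" if "finite S" "S \<subseteq> carrier \<Gamma>" for S
      using that
    proof (induction S)
      case (insert \<gamma> S)
      then have "(\<lambda>x. c \<gamma> * tr \<gamma> f x) \<in> rel_DM U {} X"
        using rel_DM_tr[OF U _ _ X f] by (intro rel_DM_scale) auto
      with insert rel_DM_add show ?case by auto
    qed (auto intro: rel_DM_zero)
    moreover have "finite {\<gamma>. c \<gamma> \<noteq> 0}" "{\<gamma>. c \<gamma> \<noteq> 0} \<subseteq> carrier \<Gamma>"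
      using c by (auto simp: group_ring_def Cfun_def)
    ultimately show ?thesis by (simp add: ring_act_def)
  qed
  then show ?thesis
    unfolding submodule_C_def by (auto intro: rel_DM_zero rel_DM_add rel_DM_Cfun)
qed

lemma stable_coset:
  assumes "subspace U" "u \<in> U"
  shows "stable {w. w - v \<in> U} u" "stable {w. w - v \<notin> U} u"
  using stable_cosets[OF assms, of "{v}"] by (auto simp: stable_def)

lemma rel_DM_restr:
  assumes f: "f \<in> rel_DM U {} X" and X: "set X \<subseteq> carrier \<Gamma>"
    and W: "\<And>x. x \<in> set X \<Longrightarrow> stable W (bar x)"
  shows "restr W f \<in> rel_DM U {} X"
proof -
  have "difs (filter P X) (restr W f) = restr W (difs (filter P X) f)" for P
    by (rule restr_difs[symmetric]) (use X W in auto)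
  moreover have "restr W (\<lambda>_. 0) = (\<lambda>_. 0)" by (simp add: restr_def)
  moreover obtain F where F: "finite F" "\<And>x. f x \<noteq> 0 \<Longrightarrow> \<exists>v\<in>F. bar x - v \<in> U"
    using rel_DM_cosets[OF f] by blast
  then have "\<exists>F. finite F \<and> (\<forall>x. restr W f x \<noteq> 0 \<longrightarrow> (\<exists>v\<in>F. bar x - v \<in> U))"
    by (auto simp: restr_def)
  ultimately show ?thesis using f unfolding rel_DM_def by (auto simp: Cfun_restr)
qed

lemma ring_act_delta: "\<gamma> \<in> carrier \<Gamma> \<Longrightarrow> ring_act \<Gamma> (delta \<gamma>) f = tr \<gamma> f"
  and delta_group_ring: "\<gamma> \<in> carrier \<Gamma> \<Longrightarrow> delta \<gamma> \<in> group_ring \<Gamma>"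
  by (auto simp: ring_act_def delta_def group_ring_def Cfun_def)

text \<open>Induction on the number of cosets: one coset is cut off, its piece is translated into
  \<open>U\<close>, where it lies in the generating set, and the group ring moves it back.\<close>

lemma rel_DM_in_submodule:
  assumes U: "subspace U" and X: "set X \<subseteq> carrier \<Gamma>" "bar ` set X \<subseteq> U"
    and M: "submodule_C \<Gamma> M" "{f \<in> rel_DM U {} X. \<forall>x. f x \<noteq> 0 \<longrightarrow> bar x \<in> U} \<subseteq> M"
    and F: "finite F"
  shows "f \<in> rel_DM U {} X \<Longrightarrow> (\<And>x. f x \<noteq> 0 \<Longrightarrow> \<exists>v\<in>F. bar x - v \<in> U) \<Longrightarrow> f \<in> M"
  using F
proof (induction F arbitrary: f)
  case empty
  then have "f = (\<lambda>_. 0)" by auto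
  then show ?case using M by (simp add: submodule_C_def)
next
  case (insert v F)
  let ?W = "{w. w - v \<in> U}" and ?W' = "{w. w - v \<notin> U}"
  have 1: "restr ?W f \<in> rel_DM U {} X" "restr ?W' f \<in> rel_DM U {} X"
    using insert.prems X U stable_coset[OF U] by (intro rel_DM_restr; auto)+
  have "restr ?W' f \<in> M"
  proof (rule insert.IH[OF 1(2)])
    fix x assume "restr ?W' f x \<noteq> 0"
    then have "f x \<noteq> 0" "bar x - v \<notin> U" by (auto simp: restr_def split: if_splits)
    then show "\<exists>v\<in>F. bar x - v \<in> U" using insert.prems(2) by blast
  qed
  moreover have "restr ?W f \<in> M"
  proof (cases "restr ?W f = (\<lambda>_. 0)")
    case True
    then show ?thesis using M by (simp add: submodule_C_def)
  next
    case False
    \<comment> \<open>The representative \<open>v\<close> need not come from the group; a point of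
      the support does, and can be used for the translation.\<close>
    then obtain x0 where x0: "restr ?W f x0 \<noteq> 0" by auto
    then have x0U: "bar x0 - v \<in> U" by (auto simp: restr_def split: if_splits)
    have x0c: "x0 \<in> carrier \<Gamma>" using x0 supp_carrier[OF rel_DM_Cfun[OF 1(1)]] by blast
    let ?g = "tr (inv x0) (restr ?W f)"
    have "bar y \<in> U" if y: "?g y \<noteq> 0" for y
    proof -
      have yc: "y \<in> carrier \<Gamma>" and y': "restr ?W f (y \<otimes> x0) \<noteq> 0"
        using y x0c by (auto simp: translate_def split: if_splits)
      then have "bar y + bar x0 - v \<in> U" using x0c by (auto simp: restr_def bar_mult split: if_splits)
      from subspace_diff[OF U this x0U] show ?thesis by simp
    qed
    moreover have "?g \<in> rel_DM U {} X"
      by (rule rel_DM_tr[OF U _ _ X(1) 1(1)]) (use x0c in auto)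
    ultimately have "?g \<in> M" using M(2) by blast
    then have "ring_act \<Gamma> (delta x0) ?g \<in> M"
      using M(1) delta_group_ring[OF x0c] by (simp add: submodule_C_def)
    moreover have "ring_act \<Gamma> (delta x0) ?g = restr ?W f"
      using x0c rel_DM_Cfun[OF 1(1)] by (simp add: ring_act_delta tr_tr tr_one)
    ultimately show ?thesis by simp
  qed
  ultimately have "(\<lambda>x. restr ?W f x + restr ?W' f x) \<in> M" using M by (simp add: submodule_C_def)
  moreover have "(\<lambda>x. restr ?W f x + restr ?W' f x) = f" by (auto simp: restr_def)
  ultimately show ?case by simp
qed

text \<open>The condition on finitely many cosets makes the hull explicit: these functions form a
  module, and cutting them into cosets shows that they are generated by the ones supported over
  \<open>r\<close>.\<close>

lemma DM_G_eq:
  assumes r: "subspace r" and X: "set X \<subseteq> carrier \<Gamma>"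
  shows "DM_G \<Gamma> bar X r = rel_DM r {} (sub_list_in bar r X)"
proof
  let ?X = "sub_list_in bar r X"
  have X': "set ?X \<subseteq> carrier \<Gamma>" "bar ` set ?X \<subseteq> r" using X by (auto simp: sub_list_in_def)
  note eq = DM_eq_rel_DM[OF r X']
  show "DM_G \<Gamma> bar X r \<subseteq> rel_DM r {} ?X"
    unfolding DM_G_def eq by (rule hull_minimal) (use submodule_rel_DM[OF r X'(1)] in auto)
  show "rel_DM r {} ?X \<subseteq> DM_G \<Gamma> bar X r"
    unfolding DM_G_def eq hull_def
  proof (intro subsetI InterI, elim CollectE conjE)
    fix f M assume f: "f \<in> rel_DM r {} ?X" and M: "submodule_C \<Gamma> M"
      "{f \<in> rel_DM r {} ?X. \<forall>x. f x \<noteq> 0 \<longrightarrow> bar x \<in> r} \<subseteq> M"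
    obtain F where "finite F" "\<And>x. f x \<noteq> 0 \<Longrightarrow> \<exists>v\<in>F. bar x - v \<in> r"
      using rel_DM_cosets[OF f] by blast
    then show "f \<in> M" using rel_DM_in_submodule[OF r X' M _ f] by blast
  qed
qed

end

subsection \<open>Spanning in the tensor product with the reals\<close>

text \<open>
  Linear functionals on \<open>\<Gamma>/\<int>a \<otimes> \<real>\<close> correspond to linear functionals on \<open>V\<close> vanishing at \<open>bar a\<close>;
  \<open>free_real_linear\<close> and \<open>hom_real_factors\<close> give the two directions.
\<close>

lemma free_real_linear:
  fixes \<phi> :: "'k \<Rightarrow> real"
  defines "\<Phi> \<equiv> \<lambda>p. \<Sum>C\<in>Poly_Mapping.keys p. poly_mapping.lookup p C * \<phi> C"
  shows "free_real.subspace {p. \<Phi> p = 0}" "\<Phi> (Poly_Mapping.single C 1) = \<phi> C"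
    "\<Phi> (p - q) = \<Phi> p - \<Phi> q"
proof -
  have sup: "\<Phi> p = (\<Sum>C\<in>A. poly_mapping.lookup p C * \<phi> C)" if "finite A" "Poly_Mapping.keys p \<subseteq> A" for p A
    unfolding \<Phi>_def by (rule sum.mono_neutral_left) (use that in \<open>auto simp: in_keys_iff\<close>)
  have l: "poly_mapping.lookup (scale_free r p) x = r * poly_mapping.lookup p x" for r x and p :: "'k \<Rightarrow>\<^sub>0 real"
    by (simp add: scale_free_def Poly_Mapping.map.rep_eq when_def)
  have add: "\<Phi> (p + q) = \<Phi> p + \<Phi> q" for p q
  proof -
    let ?A = "Poly_Mapping.keys p \<union> Poly_Mapping.keys q"
    have "\<Phi> (p + q) = (\<Sum>C\<in>?A. poly_mapping.lookup (p + q) C * \<phi> C)"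
      by (rule sup) (use keys_add[of p q] in auto)
    moreover have "\<Phi> p = (\<Sum>C\<in>?A. poly_mapping.lookup p C * \<phi> C)" by (rule sup) auto
    moreover have "\<Phi> q = (\<Sum>C\<in>?A. poly_mapping.lookup q C * \<phi> C)" by (rule sup) auto
    ultimately show ?thesis by (simp add: lookup_add sum.distrib distrib_right)
  qed
  show "\<Phi> (p - q) = \<Phi> p - \<Phi> q" for p q using add[of "p - q" q] by simp
  have scale: "\<Phi> (scale_free r p) = r * \<Phi> p" for r p
  proof -
    have "Poly_Mapping.keys (scale_free r p) \<subseteq> Poly_Mapping.keys p" by (auto simp: in_keys_iff l)
    then show ?thesis using sup[of "Poly_Mapping.keys p" "scale_free r p"] sup[of "Poly_Mapping.keys p" p]
      by (simp add: l sum_distrib_left mult.assoc)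
  qed
  show "\<Phi> (Poly_Mapping.single C 1) = \<phi> C" by (simp add: \<Phi>_def)
  have "\<Phi> 0 = 0" by (simp add: \<Phi>_def)
  then show "free_real.subspace {p. \<Phi> p = 0}"
    by (auto simp: free_real.subspace_def add scale)
qed

text \<open>The functional comes from extending a basis of the span of \<open>E\<close> by
  \<open>e\<close>. Only the rule for differences is recorded, since tensor relations are written as
  differences of generators.\<close>

lemma free_real_functional:
  fixes E :: "('k \<Rightarrow>\<^sub>0 real) set"
  assumes "e \<notin> free_real.span E"
  shows "\<exists>\<Phi> :: ('k \<Rightarrow>\<^sub>0 real) \<Rightarrow> real. (\<forall>p q. \<Phi> (p - q) = \<Phi> p - \<Phi> q) \<and>
    (\<forall>p\<in>E. \<Phi> p = 0) \<and> \<Phi> e = 1"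
proof -
  interpret vp: vector_space_pair "scale_free :: real \<Rightarrow> ('k \<Rightarrow>\<^sub>0 real) \<Rightarrow> _" "(*) :: real \<Rightarrow> real \<Rightarrow> real"
    by unfold_locales (auto simp: algebra_simps)
  obtain B where B: "B \<subseteq> E" "free_real.independent B" "E \<subseteq> free_real.span B"
    using free_real.maximal_independent_subset by blast
  have eB: "e \<notin> free_real.span B" using assms free_real.span_mono[OF B(1)] by blast
  then have "free_real.independent (insert e B)" using B(2) by (rule free_real.independent_insertI)
  from vp.linear_independent_extend[OF this, of "\<lambda>p. if p = e then 1 else 0"]
  obtain \<Phi> where \<Phi>: "Vector_Spaces.linear scale_free (*) \<Phi>"
    "\<forall>p\<in>insert e B. \<Phi> p = (if p = e then 1 else 0)" by blast
  have "\<Phi> p = 0" if "p \<in> B" for p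
    using \<Phi>(2) that eB free_real.span_base[of e B] by auto
  then have "\<Phi> p = 0" if "p \<in> E" for p
    using vp.linear_eq_0_on_span[OF \<Phi>(1), of B p] B(3) that by auto
  moreover have "\<Phi> (p - q) = \<Phi> p - \<Phi> q" for p q by (rule vp.linear_diff[OF \<Phi>(1)])
  moreover have "\<Phi> e = 1" using \<Phi>(2) by simp
  ultimately show ?thesis by blast
qed

context lattice_group
begin

lemma span_lattice: "span (bar ` carrier \<Gamma>) = UNIV"
proof -
  obtain B where "span B = UNIV" "B \<subseteq> bar ` carrier \<Gamma>" by (rule lattice_basis)
  then show ?thesis using span_mono[of B "bar ` carrier \<Gamma>"] by auto
qed

lemma hom_real_factors:
  fixes \<phi> :: "'g \<Rightarrow> real"
  assumes \<phi>: "\<And>x y. x \<in> carrier \<Gamma> \<Longrightarrow> y \<in> carrier \<Gamma> \<Longrightarrow> \<phi> (x \<otimes> y) = \<phi> x + \<phi> y"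
  obtains l :: "'v \<Rightarrow> real" where "linear l" "\<And>x. x \<in> carrier \<Gamma> \<Longrightarrow> \<phi> x = l (bar x)"
proof -
  have one: "\<phi> \<one> = 0" using \<phi>[of \<one> \<one>] by simp
  have inv: "\<phi> (inv x) = - \<phi> x" if "x \<in> carrier \<Gamma>" for x
    using \<phi>[of x "inv x"] that one by simp
  have pow: "\<phi> (x [^] n) = n * \<phi> x" if "x \<in> carrier \<Gamma>" for x and n :: nat
    by (induction n) (use that one \<phi> in \<open>auto simp: algebra_simps\<close>)
  have ipow: "\<phi> (x [^] n) = n * \<phi> x" if "x \<in> carrier \<Gamma>" for x and n :: int
    by (cases n rule: int_cases2) (use that pow inv in \<open>auto simp: int_pow_neg int_pow_int\<close>)
  \<comment> \<open>The kernel of \<open>bar\<close> is torsion and the reals are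
    torsion-free.\<close>
  have ker: "\<phi> x = 0" if x: "x \<in> carrier \<Gamma>" "bar x = 0" for x
  proof -
    obtain n :: nat where "n > 0" "x [^] n = \<one>" using x bar_eq_0_iff[OF x(1)] by (auto simp: torsion_def)
    then show ?thesis using pow[OF x(1), of n] one by simp
  qed
  have fac: "\<phi> x = \<phi> y" if "x \<in> carrier \<Gamma>" "y \<in> carrier \<Gamma>" "bar x = bar y" for x y
    using ker[of "x \<otimes> inv y"] that by (simp add: \<phi> inv bar_mult)
  obtain B where B: "independent B" "finite B" "B \<subseteq> bar ` carrier \<Gamma>"
    and lat: "bar ` carrier \<Gamma> = {\<Sum>b\<in>B. real_of_int (c b) *\<^sub>R b | c. True}"
    by (rule lattice_basis)
  \<comment> \<open>Group elements over a lattice basis prescribe \<open>l\<close>; any other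
    element has the same image as a product of their powers, and \<open>fac\<close> compares the
    values.\<close>
  have "\<exists>z\<in>carrier \<Gamma>. bar z = b" if "b \<in> B" for b using that B(3) by auto
  then obtain z where z: "\<And>b. b \<in> B \<Longrightarrow> z b \<in> carrier \<Gamma>" "\<And>b. b \<in> B \<Longrightarrow> bar (z b) = b" by metis
  obtain l :: "'v \<Rightarrow> real" where l: "linear l" "\<forall>b\<in>B. l b = \<phi> (z b)"
    using linear_independent_extend[OF B(1), of "\<lambda>b. \<phi> (z b)"] by blast
  have "\<phi> x = l (bar x)" if x: "x \<in> carrier \<Gamma>" for x
  proof -
    have "bar x \<in> bar ` carrier \<Gamma>" using x by simp
    then obtain c where c: "bar x = (\<Sum>b\<in>B. real_of_int (c b) *\<^sub>R b)" unfolding lat by auto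
    have "\<exists>y\<in>carrier \<Gamma>. bar y = (\<Sum>b\<in>A. real_of_int (c b) *\<^sub>R b) \<and>
        \<phi> y = (\<Sum>b\<in>A. real_of_int (c b) * \<phi> (z b))" if "A \<subseteq> B" for A
      using finite_subset[OF that B(2)] that
    proof (induction A)
      case empty
      show ?case using one by (intro bexI[of _ \<one>]) auto
    next
      case (insert b A)
      then obtain y where "y \<in> carrier \<Gamma>" "bar y = (\<Sum>b\<in>A. real_of_int (c b) *\<^sub>R b)"
        "\<phi> y = (\<Sum>b\<in>A. real_of_int (c b) * \<phi> (z b))" by auto
      moreover have "b \<in> B" using insert by simp
      ultimately show ?case using insert.hyps z[of b]
        by (intro bexI[of _ "z b [^] c b \<otimes> y"]) (simp_all add: bar_mult bar_int_pow \<phi> ipow)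
    qed
    then obtain y where y: "y \<in> carrier \<Gamma>" "bar y = bar x" "\<phi> y = (\<Sum>b\<in>B. real_of_int (c b) * \<phi> (z b))"
      using c by (metis order_refl)
    have "l (bar x) = (\<Sum>b\<in>B. real_of_int (c b) * l b)" unfolding c using l by (simp add: linear_sum linear_scale)
    also have "\<dots> = \<phi> y" unfolding y(3) by (rule sum.cong) (use l in auto)
    also have "\<dots> = \<phi> x" using fac x y by blast
    finally show ?thesis by simp
  qed
  with l(1) that show thesis by blast
qed


subsection \<open>The quotient by a cyclic subgroup\<close>

context
  fixes a assumes a: "a \<in> carrier \<Gamma>"
begin

abbreviation "quo \<equiv> cyclic_quotient \<Gamma> a"
abbreviation "cst \<equiv> coset_of \<Gamma> a"

lemma subgroup_cyclic: "subgroup (generate \<Gamma> {a}) \<Gamma>"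
  using a by (intro generate_is_subgroup) auto

lemma comm_group_quo: "comm_group quo"
  unfolding cyclic_quotient_def by (rule abelian_FactGroup[OF subgroup_cyclic])

lemma carrier_quo: "carrier quo = cst ` carrier \<Gamma>"
  by (simp add: cyclic_quotient_def carrier_FactGroup coset_of_def)

lemma cst_hom: "group_hom \<Gamma> quo cst"
proof -
  have "cst \<in> hom \<Gamma> quo"
    unfolding cyclic_quotient_def coset_of_def
    by (rule normal.r_coset_hom_Mod[OF subgroup_imp_normal[OF subgroup_cyclic]])
  then show ?thesis
    using comm_group_quo by (simp add: group_hom_def group_hom_axioms_def comm_group_def)
qed

lemma cst_eqD:
  assumes "x \<in> carrier \<Gamma>" "y \<in> carrier \<Gamma>" "cst x = cst y"
  obtains k :: int where "x = y \<otimes> a [^] k"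
proof -
  have "x \<in> cst y" using assms rcos_self[OF assms(1) subgroup_cyclic] by (simp add: coset_of_def)
  then obtain k :: int where "x = a [^] k \<otimes> y"
    unfolding coset_of_def r_coset_def generate_pow[OF a] by auto
  then have "x = y \<otimes> a [^] k" using assms a by (simp add: m_comm)
  then show thesis by (rule that)
qed

lemma cst_a: "cst a = \<one>\<^bsub>quo\<^esub>"
proof -
  have "a \<in> generate \<Gamma> {a}" by (rule generate.incl) simp
  then show ?thesis
    unfolding cyclic_quotient_def coset_of_def
    using coset_join2[OF a subgroup_cyclic] by simp
qed

lemma pull_nabla:
  assumes "\<gamma> \<in> carrier \<Gamma>"
  shows "pull_quotient \<Gamma> a (nabla quo (cst \<gamma>) f) = dif \<gamma> (pull_quotient \<Gamma> a f)"
proof -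
  interpret q: group_hom \<Gamma> quo cst by (rule cst_hom)
  show ?thesis
    using assms by (auto simp: fun_eq_iff pull_quotient_def nabla_def translate_def)
qed

lemma pull_nabla_list:
  "set Y \<subseteq> carrier \<Gamma> \<Longrightarrow>
    pull_quotient \<Gamma> a (nabla_list quo (map cst Y) f) = difs Y (pull_quotient \<Gamma> a f)"
  by (induction Y) (auto simp: pull_nabla)

lemma pull_inj:
  assumes "f \<in> Cfun quo" "g \<in> Cfun quo" "pull_quotient \<Gamma> a f = pull_quotient \<Gamma> a g"
  shows "f = g"
proof
  fix C
  show "f C = g C"
  proof (cases "C \<in> carrier quo")
    case True
    then obtain x where "x \<in> carrier \<Gamma>" "C = cst x" using carrier_quo by auto
    then show ?thesis using fun_cong[OF assms(3), of x] by (simp add: pull_quotient_def)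
  qed (use assms in \<open>auto simp: Cfun_def\<close>)
qed

lemma pull_Cfun: "pull_quotient \<Gamma> a f \<in> Cfun \<Gamma>"
  by (simp add: pull_quotient_def Cfun_def)

lemma pull_zero [simp]: "pull_quotient \<Gamma> a (\<lambda>_. 0) = (\<lambda>_. 0)"
  by (auto simp: pull_quotient_def)

lemma periodic_pow:
  assumes "dif a h = (\<lambda>_. 0)" "x \<in> carrier \<Gamma>"
  shows "h (x \<otimes> a [^] (k::int)) = h x"
proof -
  have 1: "h (x \<otimes> a [^] n) = h x" if "x \<in> carrier \<Gamma>" for n :: nat and x
  proof (induction n)
    case (Suc n)
    have "h (x \<otimes> a [^] n \<otimes> a) = h (x \<otimes> a [^] n)"
      by (rule dif_eq_0D'[OF assms(1)]) (use that a in auto)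
    with Suc show ?case using that a by (simp add: m_assoc)
  qed (use that in auto)
  show ?thesis
  proof (cases k rule: int_cases2)
    case (nonneg n)
    then show ?thesis using 1 assms by (simp add: int_pow_int)
  next
    case (nonpos n)
    have "h (x \<otimes> inv (a [^] n)) = h (x \<otimes> inv (a [^] n) \<otimes> a [^] n)"
      by (rule 1[symmetric]) (use assms a in auto)
    then show ?thesis using nonpos assms a by (simp add: int_pow_neg int_pow_int m_assoc)
  qed
qed

text \<open>The choice of representatives is harmless: two of them differ by a power of
  \<open>a\<close>, along which \<open>h\<close> is constant.\<close>

lemma periodic_is_pull:
  assumes h: "h \<in> Cfun \<Gamma>" "dif a h = (\<lambda>_. 0)"
  shows "\<exists>f\<in>Cfun quo. pull_quotient \<Gamma> a f = h"
proof -
  define rep where "rep C = (SOME x. x \<in> carrier \<Gamma> \<and> cst x = C)" for C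
  have rep: "rep (cst x) \<in> carrier \<Gamma> \<and> cst (rep (cst x)) = cst x" if "x \<in> carrier \<Gamma>" for x
    unfolding rep_def by (rule someI[of _ x]) (use that in simp)
  define f where "f = (\<lambda>C. if C \<in> carrier quo then h (rep C) else 0)"
  have "h (rep (cst x)) = h x" if x: "x \<in> carrier \<Gamma>" for x
  proof -
    obtain k :: int where "rep (cst x) = x \<otimes> a [^] k"
      using cst_eqD[of "rep (cst x)" x] rep[OF x] x by blast
    then show ?thesis using periodic_pow[OF h(2) x] by simp
  qed
  then have "pull_quotient \<Gamma> a f = h"
    using h(1) by (auto simp: pull_quotient_def f_def carrier_quo Cfun_def fun_eq_iff)
  moreover have "f \<in> Cfun quo" by (simp add: f_def Cfun_def)
  ultimately show ?thesis by blast
qed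

text \<open>Duality in both directions. A nonzero \<open>u\<close> orthogonal to
  \<open>bar a\<close> and to the images of \<open>S\<close> gives a functional killing
  \<open>S\<close> and the relations; a generator missing from the span is detected by a functional,
  which comes from \<open>V\<close> and kills a spanning set.\<close>

lemma spans_tensor_iff:
  assumes S: "S \<subseteq> carrier \<Gamma>"
  shows "spans_tensor quo (cst ` S) \<longleftrightarrow> span (insert (bar a) (bar ` S)) = UNIV"
proof -
  interpret qh: group_hom \<Gamma> quo cst by (rule cst_hom)
  let ?G = "(\<lambda>C. Poly_Mapping.single C 1) ` cst ` S \<union> tensor_relations quo"
  let ?K = "{p :: 'g set \<Rightarrow>\<^sub>0 real. Poly_Mapping.keys p \<subseteq> carrier quo}"
  show ?thesis
  proof
    assume sp: "spans_tensor quo (cst ` S)"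
    show "span (insert (bar a) (bar ` S)) = UNIV"
    proof (rule ccontr)
      assume "span (insert (bar a) (bar ` S)) \<noteq> UNIV"
      from span_not_UNIV_orthogonal[OF this] obtain u where
        u: "u \<noteq> 0" "\<And>v. v \<in> span (insert (bar a) (bar ` S)) \<Longrightarrow> u \<bullet> v = 0" by blast
      have ua: "u \<bullet> bar a = 0" "\<And>s. s \<in> S \<Longrightarrow> u \<bullet> bar s = 0" by (auto intro!: u(2) span_base)
      \<comment> \<open>Orthogonality of \<open>u\<close> to \<open>bar a\<close> makes the value
        independent of the representative.\<close>
      define \<phi> where "\<phi> C = u \<bullet> bar (SOME x. x \<in> carrier \<Gamma> \<and> cst x = C)" for C
      have \<phi>: "\<phi> (cst x) = u \<bullet> bar x" if x: "x \<in> carrier \<Gamma>" for x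
      proof -
        let ?y = "SOME y. y \<in> carrier \<Gamma> \<and> cst y = cst x"
        have y: "?y \<in> carrier \<Gamma> \<and> cst ?y = cst x" by (rule someI[of _ x]) (use x in simp)
        then obtain k :: int where "?y = x \<otimes> a [^] k" using cst_eqD[of ?y x] x by blast
        then show ?thesis using x a ua unfolding \<phi>_def by (simp add: bar_mult bar_int_pow inner_add_right)
      qed
      note \<Phi> = free_real_linear[where \<phi> = \<phi>]
      have "?G \<subseteq> {p. (\<Sum>C\<in>Poly_Mapping.keys p. poly_mapping.lookup p C * \<phi> C) = 0}"
      proof (rule Un_least)
        show "(\<lambda>C. Poly_Mapping.single C 1) ` cst ` S \<subseteq>
            {p. (\<Sum>C\<in>Poly_Mapping.keys p. poly_mapping.lookup p C * \<phi> C) = 0}"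
          using \<phi> ua S by (auto simp: \<Phi>(2))
        show "tensor_relations quo \<subseteq>
            {p. (\<Sum>C\<in>Poly_Mapping.keys p. poly_mapping.lookup p C * \<phi> C) = 0}"
        proof
          fix p assume "p \<in> tensor_relations quo"
          then obtain x y where p: "x \<in> carrier \<Gamma>" "y \<in> carrier \<Gamma>"
            "p = Poly_Mapping.single (cst x \<otimes>\<^bsub>quo\<^esub> cst y) 1 - Poly_Mapping.single (cst x) 1
              - Poly_Mapping.single (cst y) 1"
            by (auto simp: tensor_relations_def carrier_quo)
          have "\<phi> (cst x \<otimes>\<^bsub>quo\<^esub> cst y) = \<phi> (cst x) + \<phi> (cst y)"
            using p \<phi>[of "x \<otimes> y"] by (simp add: \<phi> bar_mult inner_add_right)
          then show "p \<in> {p. (\<Sum>C\<in>Poly_Mapping.keys p. poly_mapping.lookup p C * \<phi> C) = 0}"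
            unfolding p(3) by (simp only: mem_Collect_eq \<Phi>(2,3))
        qed
      qed
      from free_real.span_minimal[OF this \<Phi>(1)]
      have "?K \<subseteq> {p. (\<Sum>C\<in>Poly_Mapping.keys p. poly_mapping.lookup p C * \<phi> C) = 0}"
        using sp by (simp add: spans_tensor_def)
      moreover have "Poly_Mapping.single (cst x) 1 \<in> ?K" if "x \<in> carrier \<Gamma>" for x
        using that by (simp add: carrier_quo)
      ultimately have "u \<bullet> bar x = 0" if "x \<in> carrier \<Gamma>" for x
        using that \<Phi>(2)[of "cst x"] \<phi>[OF that] by fastforce
      \<comment> \<open>The lattice spans \<open>V\<close>, so \<open>u\<close> would be orthogonal
        to itself.\<close>
      then have "bar ` carrier \<Gamma> \<subseteq> {v. u \<bullet> v = 0}" by auto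
      from span_minimal[OF this subspace_hyperplane] have "u \<in> {v. u \<bullet> v = 0}"
        unfolding span_lattice by blast
      then show False using u by simp
    qed
  next
    assume sp: "span (insert (bar a) (bar ` S)) = UNIV"
    have l: "poly_mapping.lookup (scale_free r p) x = r * poly_mapping.lookup p x"
      for r x and p :: "'g set \<Rightarrow>\<^sub>0 real"
      by (simp add: scale_free_def Poly_Mapping.map.rep_eq when_def)
    have K: "free_real.subspace ?K"
      unfolding free_real.subspace_def
    proof (intro conjI ballI allI)
      show "p + q \<in> ?K" if "p \<in> ?K" "q \<in> ?K" for p q using keys_add[of p q] that by auto
      show "scale_free r p \<in> ?K" if "p \<in> ?K" for r p using that by (auto simp: in_keys_iff l)
    qed simp
    have "?G \<subseteq> ?K"
    proof (rule Un_least)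
      show "(\<lambda>C. Poly_Mapping.single C 1) ` cst ` S \<subseteq> ?K" using S by (auto simp: carrier_quo)
      show "tensor_relations quo \<subseteq> ?K"
      proof
        fix p assume "p \<in> tensor_relations quo"
        then obtain x y where p: "x \<in> carrier quo" "y \<in> carrier quo"
          "p = Poly_Mapping.single (x \<otimes>\<^bsub>quo\<^esub> y) 1 - Poly_Mapping.single x 1 - Poly_Mapping.single y 1"
          by (auto simp: tensor_relations_def)
        have "Poly_Mapping.single c 1 \<in> ?K" if "c \<in> carrier quo" for c using that by simp
        then show "p \<in> ?K" unfolding p(3) using p(1,2)
          by (intro free_real.subspace_diff[OF K]) auto
      qed
    qed
    then have 1: "free_real.span ?G \<subseteq> ?K" by (rule free_real.span_minimal[OF _ K])
    have 2: "Poly_Mapping.single (cst x0) 1 \<in> free_real.span ?G" if x0: "x0 \<in> carrier \<Gamma>" for x0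
    proof (rule ccontr)
      assume "Poly_Mapping.single (cst x0) 1 \<notin> free_real.span ?G"
      from free_real_functional[OF this] obtain \<Phi> :: "('g set \<Rightarrow>\<^sub>0 real) \<Rightarrow> real" where
        \<Phi>_all: "\<forall>p q. \<Phi> (p - q) = \<Phi> p - \<Phi> q" "\<forall>p\<in>?G. \<Phi> p = 0"
        and \<Phi>_1: "\<Phi> (Poly_Mapping.single (cst x0) 1) = 1" by (elim exE conjE)
      have \<Phi>: "\<Phi> (p - q) = \<Phi> p - \<Phi> q" "p \<in> ?G \<Longrightarrow> \<Phi> p = 0" for p q
        using \<Phi>_all by (blast, blast)
      define \<phi> where "\<phi> x = \<Phi> (Poly_Mapping.single (cst x) 1)" for x
      have add: "\<phi> (x \<otimes> y) = \<phi> x + \<phi> y" if "x \<in> carrier \<Gamma>" "y \<in> carrier \<Gamma>" for x y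
      proof -
        have "Poly_Mapping.single (cst x \<otimes>\<^bsub>quo\<^esub> cst y) 1 - Poly_Mapping.single (cst x) 1
            - Poly_Mapping.single (cst y) 1 \<in> ?G"
          using that qh.hom_closed unfolding tensor_relations_def by blast
        from \<Phi>(2)[OF this] show ?thesis using that by (simp add: \<Phi>(1) \<phi>_def)
      qed
      obtain l :: "'v \<Rightarrow> real" where l: "linear l" "\<And>x. x \<in> carrier \<Gamma> \<Longrightarrow> \<phi> x = l (bar x)"
        using hom_real_factors[of \<phi>] add by blast
      have "\<phi> a = \<phi> \<one>" by (simp add: \<phi>_def cst_a)
      then have "l (bar a) = 0" using l a add[of \<one> \<one>] by simp
      moreover have "l (bar s) = 0" if "s \<in> S" for s
      proof -
        have "\<phi> s = 0" unfolding \<phi>_def by (rule \<Phi>(2)) (use that in blast)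
        then show ?thesis using l(2)[of s] that S by auto
      qed
      ultimately have "l (bar x0) = 0"
        using linear_eq_0_on_span[OF l(1), of "insert (bar a) (bar ` S)" "bar x0"] sp by auto
      then show False using l(2)[OF x0] \<Phi>_1 by (simp add: \<phi>_def)
    qed
    have "p \<in> free_real.span ?G" if p: "p \<in> ?K" for p
    proof -
      have "p = (\<Sum>C\<in>Poly_Mapping.keys p. scale_free (poly_mapping.lookup p C) (Poly_Mapping.single C 1))"
      proof (rule poly_mapping_eqI)
        fix k
        have "(\<Sum>C\<in>Poly_Mapping.keys p. poly_mapping.lookup p C * (if C = k then 1 else 0)) =
            (\<Sum>C\<in>Poly_Mapping.keys p. if C = k then poly_mapping.lookup p C else 0)"
          by (rule sum.cong) auto
        also have "\<dots> = poly_mapping.lookup p k" by (simp add: in_keys_iff)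
        finally show "poly_mapping.lookup p k = poly_mapping.lookup (\<Sum>C\<in>Poly_Mapping.keys p.
            scale_free (poly_mapping.lookup p C) (Poly_Mapping.single C 1)) k"
          by (simp add: lookup_sum l lookup_single when_def)
      qed
      moreover have "\<dots> \<in> free_real.span ?G"
        by (intro free_real.span_sum free_real.span_scale) (use p 2 in \<open>auto simp: carrier_quo\<close>)
      ultimately show ?thesis by simp
    qed
    with 1 show "spans_tensor quo (cst ` S)" unfolding spans_tensor_def by blast
  qed
qed

text \<open>By \<open>spans_tensor_iff\<close>, a sublist of cosets fails to span exactly when its
  preimages and \<open>a\<close> lie over a proper subspace \<open>T\<close>. Distinct elements of
  \<open>Z\<close> may share a coset, so multiplicities are compared in the list of cosets.\<close>

lemma pull_image_DM:
  assumes Z: "set Z \<subseteq> carrier \<Gamma>"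
  shows "pull_quotient \<Gamma> a ` DM quo (spans_tensor quo) (map cst Z) = rel_DM UNIV {a} Z"
proof
  interpret q: comm_group quo by (rule comm_group_quo)
  interpret qh: group_hom \<Gamma> quo cst by (rule cst_hom)
  show "pull_quotient \<Gamma> a ` DM quo (spans_tensor quo) (map cst Z) \<subseteq> rel_DM UNIV {a} Z"
  proof clarify
    fix f assume f: "f \<in> DM quo (spans_tensor quo) (map cst Z)"
    have "dif a (pull_quotient \<Gamma> a f) = (\<lambda>_. 0)"
      using a by (auto simp: nabla_def translate_def pull_quotient_def cst_a)
    moreover have "difs (filter (\<lambda>x. bar x \<notin> T) Z) (pull_quotient \<Gamma> a f) = (\<lambda>_. 0)"
      if T: "subspace T" "bar a \<in> T" "T \<noteq> UNIV" for T
    proof -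
      let ?Y = "filter (\<lambda>x. bar x \<notin> T) Z" and ?Y' = "filter (\<lambda>x. bar x \<in> T) Z"
      have ms: "mset (map cst Z) = mset (map cst ?Y) + mset (map cst ?Y')"
        by (induction Z) auto
      have "span (insert (bar a) (bar ` set ?Y')) \<subseteq> T"
        by (rule span_minimal) (use T in auto)
      then have "\<not> spans_tensor quo (cst ` set ?Y')"
        using spans_tensor_iff[of "set ?Y'"] Z T by auto
      moreover have "set_mset (mset (map cst Z) - mset (map cst ?Y)) = cst ` set ?Y'"
        unfolding ms by simp
      moreover have "mset (map cst ?Y) \<subseteq># mset (map cst Z)" unfolding ms by simp
      ultimately have "nabla_list quo (map cst ?Y) f = (\<lambda>_. 0)"
        using f unfolding DM_def mem_Collect_eq by metis
      moreover have "set ?Y \<subseteq> carrier \<Gamma>" using Z by auto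
      ultimately show ?thesis using pull_nabla_list[of ?Y f] by simp
    qed
    moreover have "\<exists>F :: 'v set. finite F \<and> F \<noteq> {}" by (rule exI[of _ "{0}"]) simp
    ultimately show "pull_quotient \<Gamma> a f \<in> rel_DM UNIV {a} Z"
      unfolding rel_DM_def by (auto simp: pull_Cfun top.extremum_unique)
  qed
  show "rel_DM UNIV {a} Z \<subseteq> pull_quotient \<Gamma> a ` DM quo (spans_tensor quo) (map cst Z)"
  proof
    fix h assume h: "h \<in> rel_DM UNIV {a} Z"
    then have "dif a h = (\<lambda>_. 0)" by (simp add: rel_DM_def)
    from periodic_is_pull[OF rel_DM_Cfun[OF h] this] obtain f where
      f: "f \<in> Cfun quo" "pull_quotient \<Gamma> a f = h" by blast
    have "nabla_list quo Y f = (\<lambda>_. 0)"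
      if Y: "mset Y \<subseteq># mset (map cst Z)" "\<not> spans_tensor quo (set_mset (mset (map cst Z) - mset Y))" for Y
    proof -
      let ?R = "set_mset (mset (map cst Z) - mset Y)"
      \<comment> \<open>\<open>Y\<close> is a list of cosets and does not tell which preimages were
        removed; so every element of \<open>Z\<close> whose coset remains is taken.\<close>
      define S where "S = {z \<in> set Z. cst z \<in> ?R}"
      have "?R \<subseteq> cst ` set Z" by (auto dest: in_diffD)
      then have R: "?R = cst ` S" unfolding S_def by blast
      define T where "T = span (insert (bar a) (bar ` S))"
      have "S \<subseteq> carrier \<Gamma>" using Z by (auto simp: S_def)
      then have T: "\<not> UNIV \<subseteq> T" using Y(2) spans_tensor_iff[of S] unfolding R T_def by auto
      let ?Y = "filter (\<lambda>x. bar x \<notin> T) Z"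
      have "difs ?Y h = (\<lambda>_. 0)"
        by (rule rel_DM_outside[OF h _ _ T]) (auto simp: T_def intro: span_base)
      then have "pull_quotient \<Gamma> a (nabla_list quo (map cst ?Y) f) = pull_quotient \<Gamma> a (\<lambda>_. 0)"
        using pull_nabla_list[of ?Y f] f(2) Z by (simp add: subset_iff)
      then have 0: "nabla_list quo (map cst ?Y) f = (\<lambda>_. 0)"
        by (intro pull_inj q.Cfun_difs f(1) q.Cfun_zero)
      have "mset (map cst ?Y) \<subseteq># mset Y"
      proof (rule mset_subset_eqI)
        fix C
        show "count (mset (map cst ?Y)) C \<le> count (mset Y) C"
        proof (cases "C \<in> ?R")
          case True
          have "C \<notin> cst ` set ?Y"
          proof
            assume "C \<in> cst ` set ?Y"
            then obtain z where z: "z \<in> set Z" "bar z \<notin> T" "C = cst z" by auto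
            then have "z \<in> S" using True by (simp add: S_def)
            then show False using z(2) by (auto simp: T_def intro: span_base)
          qed
          then have "count (mset (map cst ?Y)) C = 0" by (subst count_mset_0_iff) simp
          then show ?thesis by simp
        next
          case False
          then have "count (mset (map cst Z)) C \<le> count (mset Y) C" by (simp add: not_in_iff)
          moreover have "mset (map cst ?Y) \<subseteq># mset (map cst Z)"
            by (simp add: mset_filter image_mset_subseteq_mono)
          then have "count (mset (map cst ?Y)) C \<le> count (mset (map cst Z)) C"
            by (rule mset_subset_eq_count)
          ultimately show ?thesis by linarith
        qed
      qed
      moreover have "set Y \<subseteq> carrier quo"
        using set_mset_mono[OF Y(1)] Z by (auto simp: carrier_quo)
      ultimately show ?thesis using 0 by (rule q.difs_eq_0_mono)
    qed
    then have "f \<in> DM quo (spans_tensor quo) (map cst Z)" using f(1) unfolding DM_def by blast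
    with f(2) show "h \<in> pull_quotient \<Gamma> a ` DM quo (spans_tensor quo) (map cst Z)" by blast
  qed
qed

end

end

section \<open>The short exact sequence\<close>

lemma comm_group_fun_group:
  assumes "(\<lambda>_. 0) \<in> M" "\<And>f g. f \<in> M \<Longrightarrow> g \<in> M \<Longrightarrow> (\<lambda>x. f x + g x) \<in> M"
    "\<And>f. f \<in> M \<Longrightarrow> (\<lambda>x. - f x) \<in> M"
  shows "comm_group (fun_group M)"
proof (rule comm_groupI)
  fix f assume "f \<in> carrier (fun_group M)"
  then have "(\<lambda>x. - f x) \<in> M" using assms(3) by (simp add: fun_group_def)
  then show "\<exists>g\<in>carrier (fun_group M). g \<otimes>\<^bsub>fun_group M\<^esub> f = \<one>\<^bsub>fun_group M\<^esub>"
    by (intro bexI[of _ "\<lambda>x. - f x"]) (simp_all add: fun_group_def)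
qed (use assms in \<open>auto simp: fun_group_def algebra_simps\<close>)

lemma comm_group_DM: "comm_group (fun_group (DM K S X))"
proof (rule comm_group_fun_group)
  show "(\<lambda>_. 0) \<in> DM K S X" by (simp add: DM_def Cfun_def)
  show "(\<lambda>x. f x + g x) \<in> DM K S X" if "f \<in> DM K S X" "g \<in> DM K S X" for f g
    using that by (auto simp: DM_def Cfun_def difs_add)
  show "(\<lambda>x. - f x) \<in> DM K S X" if "f \<in> DM K S X" for f
    using that difs_scale[of K _ "-1" f] by (auto simp: DM_def Cfun_def)
qed

lemma DM_mset: "mset X = mset Y \<Longrightarrow> DM K S X = DM K S Y"
  by (simp add: DM_def)

context lattice_group
begin

text \<open>In the middle, image and kernel are both the space \<open>rel_DM\<close> with the single
  period \<open>a\<close>. Surjectivity is \<open>lifts\<close> with \<open>U\<close> the whole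
  space and no periods, where infinite order of \<open>a\<close> means that \<open>bar a\<close> is
  nonzero.\<close>

lemma exact_sequence:
  assumes X: "mset X = mset (Z @ [a])" "set X \<subseteq> carrier \<Gamma>" and a: "a \<notin> torsion \<Gamma>"
  shows "short_exact
           (fun_group (DM (cyclic_quotient \<Gamma> a) (spans_tensor (cyclic_quotient \<Gamma> a))
              (map (coset_of \<Gamma> a) Z)))
           (fun_group (DM \<Gamma> (spans_in bar UNIV) X))
           (fun_group (DM \<Gamma> (spans_in bar UNIV) Z))
           (pull_quotient \<Gamma> a) (dif a)"
    (is "short_exact (fun_group ?A) (fun_group ?B) (fun_group ?C) _ _")
proof -
  have "set X = insert a (set Z)" using X(1) by (metis Un_insert_right append_Nil2 list.simps(15) mset_eq_setD set_append)
  then have aZ: "a \<in> carrier \<Gamma>" "set Z \<subseteq> carrier \<Gamma>" using X(2) by auto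
  have B: "?B = rel_DM UNIV {} (a # Z)"
    using DM_mset[of X "a # Z" \<Gamma>] X(1) DM_eq_rel_DM_UNIV[of "a # Z"] aZ by simp
  have C: "?C = rel_DM UNIV {} Z" by (rule DM_eq_rel_DM_UNIV[OF aZ(2)])
  have A: "pull_quotient \<Gamma> a ` ?A = rel_DM UNIV {a} Z" by (rule pull_image_DM[OF aZ])
  have ker: "rel_DM UNIV {a} Z = {f \<in> ?B. dif a f = (\<lambda>_. 0)}"
    unfolding B using rel_DM_periodic[OF aZ] by blast
  have "pull_quotient \<Gamma> a \<in> hom (fun_group ?A) (fun_group ?B)"
    using A ker by (auto simp: hom_def fun_group_def pull_quotient_def fun_eq_iff)
  moreover have "inj_on (pull_quotient \<Gamma> a) ?A"
    by (rule inj_onI) (use pull_inj[OF aZ(1)] in \<open>auto simp: DM_def\<close>)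
  ultimately have "pull_quotient \<Gamma> a \<in> mon (fun_group ?A) (fun_group ?B)"
    by (simp add: mon_def fun_group_def)
  moreover have "pull_quotient \<Gamma> a ` ?A = kernel (fun_group ?B) (fun_group ?C) (dif a)"
    unfolding A ker by (simp add: kernel_def fun_group_def)
  moreover have "dif a \<in> epi (fun_group ?B) (fun_group ?C)"
  proof -
    have sub: "dif a f \<in> ?C" if "f \<in> ?B" for f
      using rel_DM_dif[OF subspace_UNIV aZ(1) _ aZ(2)] that unfolding B C by blast
    have "bar a \<notin> span (bar ` {})" using a bar_eq_0_iff[OF aZ(1)] by simp
    then have "\<exists>f'\<in>gen UNIV {} (a # Z). dif a f' = f" if "f \<in> ?C" for f
      using liftsD[of a Z UNIV "{}" f] splits_and_lifts[OF aZ(2)] aZ that unfolding C by simp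
    moreover have "gen UNIV {} (a # Z) \<subseteq> ?B"
      unfolding B using gen_rel_DM[OF subspace_UNIV, of "{}" "a # Z"] aZ by auto
    ultimately have "dif a ` ?B = ?C" using sub by blast
    then show ?thesis using sub by (auto simp: epi_def hom_def fun_group_def dif_add)
  qed
  ultimately show ?thesis
    by (simp add: short_exact_def comm_group_DM) (simp add: fun_group_def)
qed


subsection \<open>Surjectivity of \<open>\<Pi>\<^sub>X\<close>\<close>

lemma finite_rational_subspaces: "finite (rational_subspaces bar X i)"
proof (rule finite_subset)
  show "rational_subspaces bar X i \<subseteq> (\<lambda>S. span (bar ` S)) ` Pow (set X)"
    unfolding rational_subspaces_def using set_mset_mono by fastforce
qed simp

lemma sub_list_in_kernel: "sub_list_in bar {v. l v = 0} X = filter (\<lambda>x. l (bar x) = 0) X"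
  by (simp add: sub_list_in_def)

lemma rel_DM_sols:
  assumes "linear l" "set X \<subseteq> carrier \<Gamma>" "g \<in> rel_DM {v. l v = 0} L Y"
  obtains h1 h2 where "sol l X g h1" "sol (\<lambda>v. - l v) X g h2"
    "conv \<Gamma> (Q_fun \<Gamma> bar X {v. l v = 0} {v. 0 < l v}) g = (\<lambda>x. h1 x - h2 x)"
proof -
  have m: "linear (\<lambda>v. - l v)" using assms(1) linear_compose_neg by blast
  have g: "g \<in> Cfun \<Gamma>" "bnd l g" "bnd (\<lambda>v. - l v) g"
    using assms rel_DM_Cfun rel_DM_bnd[OF assms(3)] m by auto
  obtain h1 where h1: "sol l X g h1" using sol_exists[OF assms(1,2) g(1,2)] by blast
  obtain h2 where h2: "sol (\<lambda>v. - l v) X g h2" using sol_exists[OF m assms(2) g(1,3)] by blast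
  show thesis using that[OF h1 h2 conv_Q_fun[OF assms(1,2) g h1 h2]] .
qed

text \<open>Additivity is taken from the solutions, which avoids a further discussion of finite
  sums.\<close>

lemma conv_Q_fun_add:
  fixes l :: "'v \<Rightarrow> real"
  assumes l: "linear l" "set X \<subseteq> carrier \<Gamma>"
    and g: "g \<in> rel_DM {v. l v = 0} L Y" "g' \<in> rel_DM {v. l v = 0} L Y"
  shows "conv \<Gamma> (Q_fun \<Gamma> bar X {v. l v = 0} {v. 0 < l v}) (\<lambda>x. g x + g' x) =
    (\<lambda>x. conv \<Gamma> (Q_fun \<Gamma> bar X {v. l v = 0} {v. 0 < l v}) g x +
      conv \<Gamma> (Q_fun \<Gamma> bar X {v. l v = 0} {v. 0 < l v}) g' x)"
proof -
  have m: "linear (\<lambda>v. - l v)" using l(1) linear_compose_neg by blast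
  have gg: "(\<lambda>x. g x + g' x) \<in> rel_DM {v. l v = 0} L Y" using g by (rule rel_DM_add)
  obtain h1 h2 where h: "sol l X g h1" "sol (\<lambda>v. - l v) X g h2"
    "conv \<Gamma> (Q_fun \<Gamma> bar X {v. l v = 0} {v. 0 < l v}) g = (\<lambda>x. h1 x - h2 x)"
    using rel_DM_sols[OF l g(1)] by blast
  obtain k1 k2 where k: "sol l X g' k1" "sol (\<lambda>v. - l v) X g' k2"
    "conv \<Gamma> (Q_fun \<Gamma> bar X {v. l v = 0} {v. 0 < l v}) g' = (\<lambda>x. k1 x - k2 x)"
    using rel_DM_sols[OF l g(2)] by blast
  have "conv \<Gamma> (Q_fun \<Gamma> bar X {v. l v = 0} {v. 0 < l v}) (\<lambda>x. g x + g' x) =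
      (\<lambda>x. (h1 x + k1 x) - (h2 x + k2 x))"
    by (rule conv_Q_fun[OF l rel_DM_Cfun[OF gg] _ _ sol_add[OF h(1) k(1)] sol_add[OF h(2) k(2)]])
      (use rel_DM_bnd[OF gg] l m in auto)
  then show ?thesis unfolding h(3) k(3) by (simp add: algebra_simps)
qed

lemma conv_zero_right: "conv \<Gamma> q (\<lambda>_. 0) = (\<lambda>_. 0)"
  by (simp add: conv_def)

lemma functional_proportional:
  fixes l l' :: "'v \<Rightarrow> real"
  assumes "linear l" "linear l'" "{v. l v = 0} = {v. l' v = 0}" "l u \<noteq> 0"
  shows "l' = (\<lambda>v. (l' u / l u) * l v)"
proof
  fix v
  have "l (v - (l v / l u) *\<^sub>R u) = 0" using assms by (simp add: linear_diff linear_scale)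
  then have "l' (v - (l v / l u) *\<^sub>R u) = 0" using assms(3) by blast
  then show "l' v = (l' u / l u) * l v" using assms(2) by (simp add: linear_diff linear_scale)
qed

text \<open>\<open>gen\<close> admits both orientations of \<open>r\<close>, whereas the map in the
  theorem has a fixed positive side. Reversing the side exchanges \<open>A\<close> and
  \<open>B\<close> and changes the sign of \<open>Q\<close>; replacing \<open>g\<close> by its
  negative absorbs this.\<close>

lemma conv_Q_fun_either_side:
  fixes l l' :: "'v \<Rightarrow> real"
  assumes l: "linear l" "linear l'" "{v. l v = 0} = {v. l' v = 0}" "l u \<noteq> 0"
    and X: "set X \<subseteq> carrier \<Gamma>" and g: "g \<in> rel_DM {v. l v = 0} L Y"
    and s: "sol l X g h1" "sol (\<lambda>v. - l v) X g h2"
  shows "\<exists>g'\<in>rel_DM {v. l v = 0} L Y.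
    conv \<Gamma> (Q_fun \<Gamma> bar X {v. l v = 0} {v. 0 < l' v}) g' = (\<lambda>x. h1 x - h2 x)"
proof -
  define c where "c = l' u / l u"
  have l': "l' = (\<lambda>v. c * l v)" unfolding c_def using functional_proportional[OF l] .
  have "l' u \<noteq> 0" using l(3,4) by blast
  then have "c \<noteq> 0" using l(4) by (simp add: c_def)
  have m: "linear (\<lambda>v. - l v)" using l(1) linear_compose_neg by blast
  show ?thesis
  proof (cases "c > 0")
    case True
    then have "{v. 0 < l' v} = {v. 0 < l v}" by (auto simp: l' zero_less_mult_iff)
    moreover have "conv \<Gamma> (Q_fun \<Gamma> bar X {v. l v = 0} {v. 0 < l v}) g = (\<lambda>x. h1 x - h2 x)"
      by (rule conv_Q_fun[OF l(1) X rel_DM_Cfun[OF g] _ _ s])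
        (use rel_DM_bnd[OF g l(1)] rel_DM_bnd[OF g m] in auto)
    ultimately show ?thesis using g by auto
  next
    case False
    with \<open>c \<noteq> 0\<close> have c: "c < 0" by simp
    let ?g = "\<lambda>x. 0 - g x"
    have g': "?g \<in> rel_DM {v. l v = 0} L Y" by (rule rel_DM_diff[OF rel_DM_zero g])
    have "{v. 0 < l' v} = {v. 0 < - l v}" using c by (auto simp: l' zero_less_mult_iff)
    moreover have "conv \<Gamma> (Q_fun \<Gamma> bar X {v. - l v = 0} {v. 0 < - l v}) ?g =
        (\<lambda>x. (0 - h2 x) - (0 - h1 x))"
      by (rule conv_Q_fun[OF m X rel_DM_Cfun[OF g']])
        (use rel_DM_bnd[OF g' l(1)] rel_DM_bnd[OF g' m] sol_diff[OF sol_zero s(1)]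
          sol_diff[OF sol_zero s(2)] in auto)
    ultimately show ?thesis using g' by (intro bexI[of _ ?g]) auto
  qed
qed

lemma kernel_rational:
  fixes l :: "'v \<Rightarrow> real"
  assumes l: "linear l" "{v. l v = 0} \<noteq> UNIV"
    and r: "{v. l v = 0} = span (bar ` {x \<in> set X. l (bar x) = 0})"
  shows "{v. l v = 0} \<in> rational_subspaces bar X (DIM('v) - 1)"
proof -
  define u where "u = adjoint l 1"
  have lu: "l v = u \<bullet> v" for v using adjoint_works[OF l(1), of v 1] by (simp add: u_def inner_commute)
  then have "u \<noteq> 0" using l(2) by auto
  then have "dim {v. l v = 0} = DIM('v) - 1" unfolding lu by (rule dim_hyperplane)
  moreover have "mset (filter (\<lambda>x. l (bar x) = 0) X) \<subseteq># mset X" by (simp add: mset_filter)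
  moreover have "{v. l v = 0} = span (bar ` set (filter (\<lambda>x. l (bar x) = 0) X))" using r by simp
  ultimately show ?thesis unfolding rational_subspaces_def by blast
qed

text \<open>A sublist spanning \<open>r\<close> consists of elements over \<open>r\<close>, so all
  elements of \<open>X\<close> over \<open>r\<close> span it too, which is the form that
  \<open>gen\<close> asks for.\<close>

lemma rational_kernel:
  assumes r: "r \<in> rational_subspaces bar X i" "r = {v. l v = 0}"
  shows "r = span (bar ` {x \<in> set X. l (bar x) = 0})"
proof -
  obtain Y where Y: "mset Y \<subseteq># mset X" "r = span (bar ` set Y)"
    using r(1) unfolding rational_subspaces_def by blast
  have "set Y \<subseteq> set X" using set_mset_mono[OF Y(1)] by simp
  moreover have "bar ` set Y \<subseteq> r" unfolding Y(2) by (auto intro: span_base)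
  ultimately have "bar ` set Y \<subseteq> bar ` {x \<in> set X. l (bar x) = 0}" using r(2) by auto
  then have "r \<subseteq> span (bar ` {x \<in> set X. l (bar x) = 0})" unfolding Y(2) by (rule span_mono)
  moreover have "span (bar ` {x \<in> set X. l (bar x) = 0}) \<subseteq> r"
  proof (rule span_minimal)
    show "subspace r" unfolding Y(2) by simp
  qed (use r(2) in auto)
  ultimately show ?thesis by blast
qed

text \<open>Surjectivity follows by induction over \<open>gen\<close>: families are added, and a
  single summand becomes a family concentrated at its hyperplane.\<close>

lemma Pi_map_surj:
  assumes X: "set X \<subseteq> carrier \<Gamma>"
    and P: "\<And>r. r \<in> rational_subspaces bar X (DIM('v) - 1) \<Longrightarrow> open_half_space r (P r)"
  shows "Pi_map \<Gamma> bar X P ` H_sum \<Gamma> bar X = DM \<Gamma> (spans_in bar UNIV) X"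
proof -
  define R where "R = rational_subspaces bar X (DIM('v) - 1)"
  have finR: "finite R" unfolding R_def by (rule finite_rational_subspaces)
  have "\<forall>r\<in>R. \<exists>l. linear l \<and> (\<exists>v. l v \<noteq> 0) \<and> r = {v. l v = 0} \<and> P r = {v. 0 < (l v :: real)}"
    using P unfolding open_half_space_def R_def by blast
  from bchoice[OF this] obtain l where l_all: "\<forall>r\<in>R. linear (l r) \<and> (\<exists>v. l r v \<noteq> 0) \<and>
    r = {v. l r v = 0} \<and> P r = {v. 0 < (l r v :: real)}" by blast
  have l: "linear (l r)" "\<exists>v. l r v \<noteq> 0" "r = {v. l r v = 0}" "P r = {v. 0 < l r v}" if "r \<in> R" for r
    using bspec[OF l_all that] by - (elim conjE; assumption)+
  define Q where "Q r = Q_fun \<Gamma> bar X r (P r)" for r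
  have Qr: "Q r = Q_fun \<Gamma> bar X {v. l r v = 0} {v. 0 < l r v}" if "r \<in> R" for r
    unfolding Q_def using l(3,4)[OF that] by simp
  define D where "D r = rel_DM r {} (sub_list_in bar r X)" for r
  have sub: "subspace r" if "r \<in> R" for r
    using that unfolding R_def rational_subspaces_def by auto
  have H: "H_sum \<Gamma> bar X = (\<Pi>\<^sub>E r\<in>R. D r)"
    unfolding H_sum_def R_def[symmetric] D_def by (rule PiE_cong) (simp add: DM_G_eq[OF sub X])
  have Pi: "Pi_map \<Gamma> bar X P F = (\<lambda>x. \<Sum>r\<in>R. conv \<Gamma> (Q r) (F r) x)" for F
    by (simp add: Pi_map_def R_def Q_def)
  have Dl: "D r = rel_DM {v. l r v = 0} {} (filter (\<lambda>x. l r (bar x) = 0) X)" if "r \<in> R" for r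
    unfolding D_def using l(3)[OF that] sub_list_in_kernel[of "l r" X] by simp
  have U: "subspace (UNIV :: 'v set)" "bar ` set X \<subseteq> UNIV" by auto
  have Q_in: "conv \<Gamma> (Q r) g \<in> rel_DM UNIV {} X" if r: "r \<in> R" and g: "g \<in> D r" for r g
  proof -
    have g': "g \<in> rel_DM {v. l r v = 0} {} (filter (\<lambda>x. l r (bar x) = 0) X)" using g Dl[OF r] by simp
    obtain h1 h2 where h: "sol (l r) X g h1" "sol (\<lambda>v. - l r v) X g h2"
      "conv \<Gamma> (Q r) g = (\<lambda>x. h1 x - h2 x)"
      using rel_DM_sols[OF l(1)[OF r] X g'] unfolding Qr[OF r] by blast
    have "(\<lambda>x. h1 x - h2 x) \<in> gen UNIV {} X"
    proof (rule gen.Q[OF l(1)[OF r] _ _ _ _ h(1,2)])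
      show "r = {v \<in> UNIV. l r v = 0}" using l(3)[OF r] by simp
      show "r \<noteq> UNIV" using l(2,3)[OF r] by auto
      show "r = span (bar ` ({} \<union> {x \<in> set X. l r (bar x) = 0}))"
        using rational_kernel[of r X _ "l r"] r l(3)[OF r] unfolding R_def by simp
      show "g \<in> rel_DM r {} (filter (\<lambda>x. l r (bar x) = 0) X)" using g' l(3)[OF r] by simp
    qed
    then show ?thesis unfolding h(3) by (rule gen_rel_DM[OF U(1) empty_subsetI X U(2)])
  qed
  have conv_add: "conv \<Gamma> (Q r) (\<lambda>x. g x + g' x) = (\<lambda>x. conv \<Gamma> (Q r) g x + conv \<Gamma> (Q r) g' x)"
    if r: "r \<in> R" and g: "g \<in> D r" "g' \<in> D r" for r g g'
    using g unfolding Qr[OF r] Dl[OF r] by (rule conv_Q_fun_add[OF l(1)[OF r] X])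
  show ?thesis
    unfolding DM_eq_rel_DM_UNIV[OF X]
  proof
    show "Pi_map \<Gamma> bar X P ` H_sum \<Gamma> bar X \<subseteq> rel_DM UNIV {} X"
    proof clarify
      fix F assume F: "F \<in> H_sum \<Gamma> bar X"
      have "(\<lambda>x. \<Sum>r\<in>S. conv \<Gamma> (Q r) (F r) x) \<in> rel_DM UNIV {} X" if "S \<subseteq> R" for S
        using finite_subset[OF that finR] that
      proof (induction S)
        case empty
        show ?case by (simp add: rel_DM_zero)
      next
        case (insert r S)
        have "F r \<in> D r" using F insert.prems unfolding H by (auto simp: PiE_def)
        then have "conv \<Gamma> (Q r) (F r) \<in> rel_DM UNIV {} X" using insert.prems by (intro Q_in) auto
        from rel_DM_add[OF this insert.IH] show ?case using insert by simp
      qed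
      then show "Pi_map \<Gamma> bar X P F \<in> rel_DM UNIV {} X" unfolding Pi by simp
    qed
    show "rel_DM UNIV {} X \<subseteq> Pi_map \<Gamma> bar X P ` H_sum \<Gamma> bar X"
    proof
      fix f assume f: "f \<in> rel_DM UNIV {} X"
      \<comment> \<open>A Euclidean space is nonzero, so the empty set of periods does not span
        it.\<close>
      have "\<not> (UNIV :: 'v set) \<subseteq> span (bar ` {})"
        using UNIV_not_singleton[of "0 :: 'v"] by auto
      then have "f \<in> gen UNIV {} X"
        using splitsD[of X UNIV "{}" f] splits_and_lifts[OF X] f by simp
      then show "f \<in> Pi_map \<Gamma> bar X P ` H_sum \<Gamma> bar X"
      proof induction
        case zero
        have "(\<lambda>r\<in>R. \<lambda>_. 0) \<in> (\<Pi>\<^sub>E r\<in>R. D r)" by (auto simp: D_def rel_DM_zero)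
        then show ?case unfolding H
          by (rule rev_image_eqI) (auto simp: Pi conv_zero_right)
      next
        case (add f g)
        then obtain F F' where F: "F \<in> (\<Pi>\<^sub>E r\<in>R. D r)" "f = Pi_map \<Gamma> bar X P F"
          "F' \<in> (\<Pi>\<^sub>E r\<in>R. D r)" "g = Pi_map \<Gamma> bar X P F'" unfolding H by blast
        have FD: "F r \<in> D r" "F' r \<in> D r" if "r \<in> R" for r using F that by auto
        have 1: "(\<lambda>r\<in>R. \<lambda>x. F r x + F' r x) \<in> (\<Pi>\<^sub>E r\<in>R. D r)"
          using FD by (auto simp: D_def intro: rel_DM_add)
        have 2: "(\<lambda>x. f x + g x) = Pi_map \<Gamma> bar X P (\<lambda>r\<in>R. \<lambda>x. F r x + F' r x)"
        proof
          fix x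
          have "(\<Sum>r\<in>R. conv \<Gamma> (Q r) ((\<lambda>r\<in>R. \<lambda>x. F r x + F' r x) r) x) =
              (\<Sum>r\<in>R. conv \<Gamma> (Q r) (F r) x + conv \<Gamma> (Q r) (F' r) x)"
            by (rule sum.cong) (simp_all add: conv_add FD)
          then show "f x + g x = Pi_map \<Gamma> bar X P (\<lambda>r\<in>R. \<lambda>x. F r x + F' r x) x"
            unfolding F(2,4) Pi by (simp add: sum.distrib)
        qed
        show ?case unfolding H 2 using 1 by (rule imageI)
      next
        case (Q k r g h1 h2)
        have rk: "r = {v. k v = 0}" using Q(2) by simp
        have "{v. k v = 0} \<in> R"
          unfolding R_def by (rule kernel_rational) (use Q rk in auto)
        then have rR: "r \<in> R" using rk by simp
        obtain u where u: "k u \<noteq> 0" using Q(3) rk by auto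
        have "g \<in> rel_DM {v. k v = 0} {} (filter (\<lambda>x. k (bar x) = 0) X)" using Q(5) rk by simp
        from conv_Q_fun_either_side[OF Q(1) l(1)[OF rR] _ u X this Q(6,7)]
        obtain g' where g': "g' \<in> rel_DM {v. k v = 0} {} (filter (\<lambda>x. k (bar x) = 0) X)"
          "conv \<Gamma> (Q_fun \<Gamma> bar X {v. k v = 0} {v. 0 < l r v}) g' = (\<lambda>x. h1 x - h2 x)"
          using rk l(3)[OF rR] by auto
        have Q_eq: "Q r = Q_fun \<Gamma> bar X r (P r)" by (rule Q_def)
        have "g' \<in> D r" using g'(1) sub_list_in_kernel[of k X] by (simp add: D_def rk)
        then have 1: "(\<lambda>s\<in>R. if s = r then g' else (\<lambda>_. 0)) \<in> (\<Pi>\<^sub>E r\<in>R. D r)"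
          by (auto simp: D_def rel_DM_zero)
        have 2: "(\<lambda>x. h1 x - h2 x) = Pi_map \<Gamma> bar X P (\<lambda>s\<in>R. if s = r then g' else (\<lambda>_. 0))"
        proof
          fix x
          have "(\<Sum>s\<in>R. conv \<Gamma> (Q s) ((\<lambda>s\<in>R. if s = r then g' else (\<lambda>_. 0)) s) x) =
              (\<Sum>s\<in>R. if s = r then h1 x - h2 x else 0)"
            by (rule sum.cong) (use g'(2) l(4)[OF rR] rk Q_eq in \<open>auto simp: conv_zero_right\<close>)
          also have "\<dots> = h1 x - h2 x" using finR rR by simp
          finally show "h1 x - h2 x = Pi_map \<Gamma> bar X P (\<lambda>s\<in>R. if s = r then g' else (\<lambda>_. 0)) x"
            unfolding Pi by simp
        qed
        show ?case unfolding H 2 using 1 by (rule imageI)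
      qed
    qed
  qed
qed

end

theorem theorem3p17:
  fixes \<Gamma> :: "('g, 'm) monoid_scheme" and bar :: "'g \<Rightarrow> 'v::euclidean_space"
    and X Z :: "'g list" and a :: 'g
  assumes "comm_group \<Gamma>" and "fin_gen_group \<Gamma>"
    and "\<And>\<gamma> \<nu>. \<gamma> \<in> carrier \<Gamma> \<Longrightarrow> \<nu> \<in> carrier \<Gamma> \<Longrightarrow> bar (\<gamma> \<otimes>\<^bsub>\<Gamma>\<^esub> \<nu>) = bar \<gamma> + bar \<nu>"
    and "{\<gamma> \<in> carrier \<Gamma>. bar \<gamma> = 0} = torsion \<Gamma>"
    and "full_lattice (bar ` carrier \<Gamma>)"
    and "set X \<subseteq> carrier \<Gamma>"
    and "span (bar ` set X) = UNIV"
    and "a \<in> set X" and "a \<notin> torsion \<Gamma>"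
    and "mset X = mset (Z @ [a])"
  shows "short_exact
           (fun_group (DM (cyclic_quotient \<Gamma> a) (spans_tensor (cyclic_quotient \<Gamma> a))
              (map (coset_of \<Gamma> a) Z)))
           (fun_group (DM \<Gamma> (spans_in bar UNIV) X))
           (fun_group (DM \<Gamma> (spans_in bar UNIV) Z))
           (pull_quotient \<Gamma> a) (nabla \<Gamma> a)
       \<and> (\<forall>P. (\<forall>r \<in> rational_subspaces bar X (DIM('v) - 1). open_half_space r (P r)) \<longrightarrow>
           Pi_map \<Gamma> bar X P ` H_sum \<Gamma> bar X = DM \<Gamma> (spans_in bar UNIV) X)"
proof -
  interpret lattice_group \<Gamma> bar
    by (intro lattice_group.intro lattice_group_axioms.intro) (use assms in auto)
  show ?thesis
    using exact_sequence[OF assms(10,6,9)] Pi_map_surj[OF assms(6)] by blast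
qed

end
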